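(* Let $M^m$ be a compact Kähler manifold of complex dimension $m$ with first Chern class $c_1(M)>0$, and let $g_{\alpha\bar\beta}(x,0)$ be a Kähler metric on $M$ whose Kähler class is the multiple of $c_1(M)$ for which there is a real smooth function $f$ on $M$ with $f_{\alpha\bar\beta}=g_{\alpha\bar\beta}(x,0)-R_{\alpha\bar\beta}(x,0)$; fix such an $f$. Let $\varphi(x,t)$ be a solution, for $t\ge 0$, of the complex Monge–Ampère flow $$\frac{\partial}{\partial t}\varphi(x,t)=\log\frac{\det(g_{\gamma\bar\delta}(x,t))}{\det(g_{\gamma\bar\delta}(x,0))}+\varphi(x,t)+f(x),\qquad g_{\alpha\bar\beta}(x,t)=g_{\alpha\bar\beta}(x,0)+\varphi_{\alpha\bar\beta}(x,t),$$ where $g_{\alpha\bar\beta}(x,t)$ is a Kähler metric for each $t$ (so that $g(t)$ solves the normalized Kähler–Ricci flow $\partial_t g_{\alpha\bar\beta}=-R_{\alpha\bar\beta}+g_{\alpha\bar\beta}$). Set $w=-\varphi_t=-\partial\varphi/\partial t$ and assume $w>0$. Then for all $t>0$, $$w_t-\frac{|\nabla w|^2}{w}+\frac{m}{t}\,w\ \ge\ w\ >\ 0,$$ where $|\nabla w|^2$ is computed with respect to $g(t)$.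
   Context: Conventions. In local holomorphic coordinates, $h_\alpha=\partial h/\partial z^\alpha$, $h_{\bar\beta}=\partial h/\partial\bar z^\beta$, $h_{\alpha\bar\beta}=\partial^2h/\partial z^\alpha\partial\bar z^\beta$ for a function $h$. The Ricci tensor of a Kähler metric $g$ is $R_{\alpha\bar\beta}=-\partial_\alpha\partial_{\bar\beta}\log\det(g_{\gamma\bar\delta})$; $R_{\alpha\bar\beta}(x,t)$ denotes that of $g(t)$. The gradient norm is $|\nabla w|^2=g^{\alpha\bar\beta}(x,t)w_\alpha w_{\bar\beta}$. The cohomological condition on $g(0)$ says that the closed real $(1,1)$-forms $\sqrt{-1}\,g_{\alpha\bar\beta}(x,0)\,dz^\alpha\wedge d\bar z^\beta$ and $\sqrt{-1}\,R_{\alpha\bar\beta}(x,0)\,dz^\alpha\wedge d\bar z^\beta$ are cohomologous (equivalently, $\frac{\sqrt{-1}}{2\pi}g_{\alpha\bar\beta}(x,0)\,dz^\alpha\wedge d\bar z^\beta$ represents $c_1(M)$). *)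

theory Defs
  imports "HOL-Analysis.Analysis"
begin

subsection \<open>Smooth and holomorphic maps\<close>

(* C^k on an open set U of a Euclidean space; the directional derivatives of all orders k are
   required to exist and to be continuous. *)
primrec Ck_on ::
  "nat \<Rightarrow> 'a::euclidean_space set \<Rightarrow> ('a \<Rightarrow> 'b::real_normed_vector) \<Rightarrow> bool" where
  "Ck_on 0 U h \<longleftrightarrow> continuous_on U h"
| "Ck_on (Suc k) U h \<longleftrightarrow>
     (\<forall>x\<in>U. h differentiable (at x)) \<and>
     (\<forall>v. Ck_on k U (\<lambda>x. frechet_derivative h (at x) v))"

(* C^infinity on an arbitrary set S: locally the restriction of a C^infinity map on an open set.
   For open S this is the usual notion; for S = V x [0,oo) it is smoothness up to the boundary. *)
definition smooth_on ::
  "'a::euclidean_space set \<Rightarrow> ('a \<Rightarrow> 'b::real_normed_vector) \<Rightarrow> bool" where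
  "smooth_on S h \<longleftrightarrow>
     (\<forall>x\<in>S. \<exists>U H. open U \<and> x \<in> U \<and> (\<forall>k. Ck_on k U H) \<and> (\<forall>y\<in>S \<inter> U. H y = h y))"

(* Used for open S: the real derivative is complex linear at every point. *)
definition holomorphic_map_on :: "(complex^'m) set \<Rightarrow> (complex^'m \<Rightarrow> complex^'m) \<Rightarrow> bool" where
  "holomorphic_map_on S h \<longleftrightarrow>
     (\<forall>z\<in>S. \<exists>J :: complex^'m^'m. (h has_derivative (\<lambda>v. J *v v)) (at z))"

subsection \<open>Complex manifolds\<close>

(* A chart (U, psi): its domain U and its coordinate map psi, whose values outside U are irrelevant. *)
type_synonym ('a, 'm) chart = "'a set \<times> ('a \<Rightarrow> complex^'m)"

definition coord_inv :: "('a, 'm) chart \<Rightarrow> complex^'m \<Rightarrow> 'a" where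
  "coord_inv c = inv_into (fst c) (snd c)"

definition complex_manifold :: "'a topology \<Rightarrow> ('a, 'm::finite) chart set \<Rightarrow> bool" where
  "complex_manifold X A \<longleftrightarrow>
     Hausdorff_space X \<and> second_countable X \<and>
     (\<Union>c\<in>A. fst c) = topspace X \<and>
     (\<forall>c\<in>A. openin X (fst c) \<and> open (snd c ` fst c) \<and>
        homeomorphic_map (subtopology X (fst c)) (top_of_set (snd c ` fst c)) (snd c)) \<and>
     (\<forall>c\<in>A. \<forall>d\<in>A. holomorphic_map_on (snd c ` (fst c \<inter> fst d)) (snd d \<circ> coord_inv c))"

definition smooth_fun :: "('a, 'm::finite) chart set \<Rightarrow> ('a \<Rightarrow> real) \<Rightarrow> bool" where
  "smooth_fun A h \<longleftrightarrow> (\<forall>c\<in>A. smooth_on (snd c ` fst c) (h \<circ> coord_inv c))"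

(* Smoothness on M x [0,oo). *)
definition smooth_time_fun :: "('a, 'm::finite) chart set \<Rightarrow> ('a \<Rightarrow> real \<Rightarrow> real) \<Rightarrow> bool" where
  "smooth_time_fun A h \<longleftrightarrow>
     (\<forall>c\<in>A. smooth_on ((snd c ` fst c) \<times> {0..}) (\<lambda>(z, t). h (coord_inv c z) t))"

subsection \<open>Derivatives in local coordinates\<close>

definition dir_deriv ::
  "('a, 'm::finite) chart \<Rightarrow> complex^'m \<Rightarrow> ('a \<Rightarrow> 'b::real_normed_vector) \<Rightarrow> 'a \<Rightarrow> 'b" where
  "dir_deriv c v h p = frechet_derivative (h \<circ> coord_inv c) (at (snd c p)) v"

(* With z = x + i y, d/dz = (d/dx - i d/dy)/2 and d/dzbar = (d/dx + i d/dy)/2. *)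
definition dz :: "('a, 'm::finite) chart \<Rightarrow> 'm \<Rightarrow> ('a \<Rightarrow> complex) \<Rightarrow> 'a \<Rightarrow> complex" where
  "dz c \<alpha> h p = (dir_deriv c (axis \<alpha> 1) h p - \<i> * dir_deriv c (axis \<alpha> \<i>) h p) / 2"

definition dzbar :: "('a, 'm::finite) chart \<Rightarrow> 'm \<Rightarrow> ('a \<Rightarrow> complex) \<Rightarrow> 'a \<Rightarrow> complex" where
  "dzbar c \<beta> h p = (dir_deriv c (axis \<beta> 1) h p + \<i> * dir_deriv c (axis \<beta> \<i>) h p) / 2"

definition hess :: "('a, 'm::finite) chart \<Rightarrow> ('a \<Rightarrow> real) \<Rightarrow> 'a \<Rightarrow> complex^'m^'m" where
  "hess c h p = (\<chi> \<alpha> \<beta>. dz c \<alpha> (dzbar c \<beta> (\<lambda>q. complex_of_real (h q))) p)"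

(* One-sided at t = 0, two-sided for t > 0. *)
definition time_deriv :: "('a \<Rightarrow> real \<Rightarrow> real) \<Rightarrow> 'a \<Rightarrow> real \<Rightarrow> real" where
  "time_deriv h x t = vector_derivative (h x) (at t within {0..})"

(* Entry (gamma, alpha) is the derivative of the gamma-th coordinate of d along the alpha-th
   coordinate of c. *)
definition trans_jac :: "('a, 'm::finite) chart \<Rightarrow> ('a, 'm) chart \<Rightarrow> 'a \<Rightarrow> complex^'m^'m" where
  "trans_jac c d p = (\<chi> \<gamma> \<alpha>. dz c \<alpha> (\<lambda>q. snd d q $ \<gamma>) p)"

subsection \<open>Differential forms\<close>

(* A real k-form is given by its expression in each chart, evaluated on the coordinate vectors
   (real tangent vectors, identified with complex^'m by the chart). *)
type_synonym ('a, 'm) form1 = "('a, 'm) chart \<Rightarrow> 'a \<Rightarrow> complex^'m \<Rightarrow> real"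
type_synonym ('a, 'm) form2 = "('a, 'm) chart \<Rightarrow> 'a \<Rightarrow> complex^'m \<Rightarrow> complex^'m \<Rightarrow> real"

definition smooth_form1 :: "('a, 'm::finite) chart set \<Rightarrow> ('a, 'm) form1 \<Rightarrow> bool" where
  "smooth_form1 A \<eta> \<longleftrightarrow>
     (\<forall>c\<in>A. \<forall>p\<in>fst c. linear (\<eta> c p)) \<and>
     (\<forall>c\<in>A. \<forall>v. smooth_on (snd c ` fst c) (\<lambda>z. \<eta> c (coord_inv c z) v)) \<and>
     (\<forall>c\<in>A. \<forall>d\<in>A. \<forall>p\<in>fst c \<inter> fst d. \<forall>v. \<eta> c p v = \<eta> d p (trans_jac c d p *v v))"

(* The exterior derivative evaluated on constant coordinate vector fields (no factor 1/2 or 1/3),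
   consistent with (dz wedge dzbar)(u,v) = dz(u) dzbar(v) - dz(v) dzbar(u). *)
definition ext_deriv1 :: "('a, 'm::finite) form1 \<Rightarrow> ('a, 'm) form2" where
  "ext_deriv1 \<eta> c p u v =
     dir_deriv c u (\<lambda>q. \<eta> c q v) p - dir_deriv c v (\<lambda>q. \<eta> c q u) p"

definition closed_form2 :: "('a, 'm::finite) chart set \<Rightarrow> ('a, 'm) form2 \<Rightarrow> bool" where
  "closed_form2 A \<omega> \<longleftrightarrow>
     (\<forall>c\<in>A. \<forall>p\<in>fst c. \<forall>u v w.
        dir_deriv c u (\<lambda>q. \<omega> c q v w) p - dir_deriv c v (\<lambda>q. \<omega> c q u w) p
          + dir_deriv c w (\<lambda>q. \<omega> c q u v) p = 0)"

definition cohomologous ::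
  "('a, 'm::finite) chart set \<Rightarrow> ('a, 'm) form2 \<Rightarrow> ('a, 'm) form2 \<Rightarrow> bool" where
  "cohomologous A \<omega>1 \<omega>2 \<longleftrightarrow>
     (\<exists>\<eta>. smooth_form1 A \<eta> \<and>
        (\<forall>c\<in>A. \<forall>p\<in>fst c. \<forall>u v. \<omega>1 c p u v - \<omega>2 c p u v = ext_deriv1 \<eta> c p u v))"

subsection \<open>Kaehler metrics\<close>

(* Entry (alpha, beta) of a tensor in the chart c is its component with indices alpha, beta-bar. *)
type_synonym ('a, 'm) tensor11 = "('a, 'm) chart \<Rightarrow> 'a \<Rightarrow> complex^'m^'m"

(* The form i h_{alpha beta-bar} dz^alpha wedge dzbar^beta. For hermitian h the sum below is
   real, so that Re only adjusts the type. *)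
definition form_of :: "('a, 'm::finite) tensor11 \<Rightarrow> ('a, 'm) form2" where
  "form_of h c p u v =
     Re (\<i> * (\<Sum>\<alpha>\<in>UNIV. \<Sum>\<beta>\<in>UNIV.
           h c p $ \<alpha> $ \<beta> * (u $ \<alpha> * cnj (v $ \<beta>) - v $ \<alpha> * cnj (u $ \<beta>))))"

definition hermitian_metric :: "('a, 'm::finite) chart set \<Rightarrow> ('a, 'm) tensor11 \<Rightarrow> bool" where
  "hermitian_metric A g \<longleftrightarrow>
     (\<forall>c\<in>A. smooth_on (snd c ` fst c) (g c \<circ> coord_inv c)) \<and>
     (\<forall>c\<in>A. \<forall>p\<in>fst c. \<forall>\<alpha> \<beta>. g c p $ \<beta> $ \<alpha> = cnj (g c p $ \<alpha> $ \<beta>)) \<and>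
     (\<forall>c\<in>A. \<forall>p\<in>fst c. \<forall>v. v \<noteq> 0 \<longrightarrow>
        Re (\<Sum>\<alpha>\<in>UNIV. \<Sum>\<beta>\<in>UNIV. g c p $ \<alpha> $ \<beta> * v $ \<alpha> * cnj (v $ \<beta>)) > 0) \<and>
     (\<forall>c\<in>A. \<forall>d\<in>A. \<forall>p\<in>fst c \<inter> fst d. \<forall>\<alpha> \<beta>.
        g c p $ \<alpha> $ \<beta> =
          (\<Sum>\<gamma>\<in>UNIV. \<Sum>\<delta>\<in>UNIV.
             trans_jac c d p $ \<gamma> $ \<alpha> * cnj (trans_jac c d p $ \<delta> $ \<beta>) * g d p $ \<gamma> $ \<delta>))"

definition kaehler_metric :: "('a, 'm::finite) chart set \<Rightarrow> ('a, 'm) tensor11 \<Rightarrow> bool" where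
  "kaehler_metric A g \<longleftrightarrow> hermitian_metric A g \<and> closed_form2 A (form_of g)"

(* The determinant of a positive definite hermitian matrix is a positive real number. *)
definition ricci :: "('a, 'm::finite) tensor11 \<Rightarrow> ('a, 'm) tensor11" where
  "ricci g c p = - hess c (\<lambda>q. ln (Re (det (g c q)))) p"

(* As g_{gamma beta-bar} is the entry (gamma, beta), the component g^{alpha beta-bar} of the
   inverse metric is the entry (beta, alpha) of the inverse matrix. *)
definition grad_norm2 ::
  "('a, 'm::finite) tensor11 \<Rightarrow> ('a, 'm) chart \<Rightarrow> ('a \<Rightarrow> real) \<Rightarrow> 'a \<Rightarrow> real" where
  "grad_norm2 g c h p =
     Re (\<Sum>\<alpha>\<in>UNIV. \<Sum>\<beta>\<in>UNIV. matrix_inv (g c p) $ \<beta> $ \<alpha> *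
           dz c \<alpha> (\<lambda>q. complex_of_real (h q)) p * dzbar c \<beta> (\<lambda>q. complex_of_real (h q)) p)"

(* The real first Chern class is the de Rham class of the Ricci form of a Kaehler metric divided
   by 2 pi; this class does not depend on the metric. *)
definition represents_c1 :: "('a, 'm::finite) chart set \<Rightarrow> ('a, 'm) form2 \<Rightarrow> bool" where
  "represents_c1 A \<omega> \<longleftrightarrow>
     (\<exists>h. kaehler_metric A h \<and>
        cohomologous A \<omega> (\<lambda>c p u v. form_of (ricci h) c p u v / (2 * pi)))"

(* A closed positive (1,1)-form is the same as the form of a Kaehler metric. *)
definition c1_positive :: "('a, 'm::finite) chart set \<Rightarrow> bool" where
  "c1_positive A \<longleftrightarrow> (\<exists>h. kaehler_metric A h \<and> represents_c1 A (form_of h))"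

end

theory Submission
  imports Defs
begin

text \<open>Differentiating the flow in time gives \<open>w\<^sub>t = \<Delta>w + w\<close>, so the claim says that
  \<open>F = w\<^sub>t - w - |\<nabla>w|\<^sup>2 / w\<close>, which is \<open>w \<Delta> log w\<close>, is at least \<open>- m w / t\<close>. For \<open>\<epsilon> > 0\<close> the minimum of
  \<open>exp (- t) ((t - \<epsilon>) F + m w)\<close> over \<open>M \<times> [\<epsilon>, T]\<close> is shown to be nonnegative; then \<open>\<epsilon>\<close> tends to 0.
  At a negative minimum \<open>F\<close> is compared with \<open>F\<^sub>V = w\<^sub>t - w - 2 Re V(w) + w |V|\<^sup>2\<close>, where \<open>V\<close> is a
  time-independent holomorphic vector field near the minimum point. Completing the square gives
  \<open>F\<^sub>V \<ge> F\<close>, with equality where \<open>V\<close> is the gradient of \<open>log w\<close>. Choosing \<open>V\<close> affine in the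
  coordinates, with value \<open>\<nabla> log w\<close> and covariant derivative \<open>\<partial>\<partial>bar log w\<close> at the point, yields there
  \<open>(\<partial>\<^sub>t - \<Delta>) F\<^sub>V = |\<partial>\<partial>bar w|\<^sup>2 + \<Delta>w + w |\<partial>\<partial>bar log w|\<^sup>2 \<ge> F + F\<^sup>2 / (m w)\<close>, because the curvature terms cancel
  by \<open>\<partial>\<^sub>t g = - \<partial>\<partial>bar w\<close> and \<open>Ric = g + \<partial>\<partial>bar w\<close>. This contradicts the maximum principle.\<close>

subsection \<open>Functions of class C^k on an open set\<close>

text \<open>The auxiliary field \<open>V\<close> avoids differentiating |grad w|^2 / w twice, and
  with it second derivatives of the inverse metric and the pure Hessian of w. For a fixed
  holomorphic \<open>V\<close> the function F_V is affine in the metric, so curvature enters only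
  through the Laplacian of the components of g contracted with V and its conjugate, that is, through
  the Ricci tensor, which the flow determines. The frame used at the minimum point is unitary there
  but consists of constant vectors; no normal coordinates are introduced, so first derivatives of g
  survive and are absorbed in the derivative of V. The factor exp(-t) removes a zero-order term:
  with tau = t - epsilon, the heat operator applied to tau F_V + m w gives at the point at least tau
  F + m w plus F (m w + tau F) / (m w), and this last term is positive where tau F + m w < 0, since
  there F < 0 as well. Starting at epsilon > 0 keeps all derivatives in the open region t > 0 and
  makes the function equal to exp(-t) m w > 0 at the initial time.\<close>

lemma frechet_derivative_eqI:
  "(h has_derivative h') (at x) \<Longrightarrow> frechet_derivative h (at x) = h'"
  by (rule frechet_derivative_at[symmetric])

lemma Ck_on_SucD:
  assumes "Ck_on (Suc k) U h"
  shows "Ck_on k U h"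
  using assms
proof (induction k arbitrary: h)
  case 0
  then show ?case
    by (auto intro!: continuous_at_imp_continuous_on differentiable_imp_continuous_within)
next
  case (Suc k)
  then show ?case by (metis Ck_on.simps(2))
qed

lemma Ck_on_cong:
  assumes "open U" "\<And>x. x \<in> U \<Longrightarrow> h x = h' x" "Ck_on k U h"
  shows "Ck_on k U h'"
  using assms(2,3)
proof (induction k arbitrary: h h')
  case 0
  then show ?case by (simp cong: continuous_on_cong)
next
  case (Suc k)
  have d: "h differentiable (at x)" if "x \<in> U" for x
    using Suc.prems that by simp
  have "h' differentiable (at x)" if "x \<in> U" for x
    using has_derivative_transform_within_open[where f=h and g=h', OF _ assms(1) that] Suc.prems(1) d[OF that]
    unfolding differentiable_def by blast
  moreover have "frechet_derivative h (at x) = frechet_derivative h' (at x)" if "x \<in> U" for x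
    using frechet_derivative_transform_within_open[OF d[OF that] assms(1) that] Suc.prems(1)
    by blast
  ultimately show ?case
    using Suc.IH[of "\<lambda>x. frechet_derivative h (at x) v" for v] Suc.prems by auto
qed

lemma Ck_on_subset:
  assumes "V \<subseteq> U" "Ck_on k U h"
  shows "Ck_on k V h"
  using assms(2)
  by (induction k arbitrary: h) (use assms(1) in \<open>auto intro: continuous_on_subset\<close>)

lemma Ck_on_local:
  assumes "\<And>x. x \<in> U \<Longrightarrow> \<exists>V. open V \<and> x \<in> V \<and> Ck_on k V h"
  shows "Ck_on k U h"
  using assms
proof (induction k arbitrary: h)
  case 0
  have "continuous (at x) h" if x: "x \<in> U" for x
  proof -
    obtain V where "open V" "x \<in> V" "Ck_on 0 V h" using 0[OF x] by blast
    then show ?thesis by (metis Ck_on.simps(1) continuous_on_eq_continuous_at)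
  qed
  then show ?case by (metis Ck_on.simps(1) continuous_at_imp_continuous_on)
next
  case (Suc k)
  have "h differentiable (at x)" if "x \<in> U" for x
    using Suc.prems[OF that] by auto
  moreover have "Ck_on k U (\<lambda>x. frechet_derivative h (at x) v)" for v
  proof (rule Suc.IH)
    fix x assume "x \<in> U"
    then obtain V where "open V" "x \<in> V" "Ck_on (Suc k) V h" using Suc.prems[of x] by blast
    then show "\<exists>V. open V \<and> x \<in> V \<and> Ck_on k V (\<lambda>x. frechet_derivative h (at x) v)" by auto
  qed
  ultimately show ?case by simp
qed

lemma Ck_on_const: "Ck_on k U (\<lambda>x. c)"
  by (induction k arbitrary: c) auto

lemma Ck_on_bounded_linear:
  assumes "bounded_linear L"
  shows "Ck_on k U L"
proof (cases k)
  case 0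
  then show ?thesis using assms by (simp add: linear_continuous_on)
next
  case (Suc n)
  have "(L has_derivative L) (at x)" for x
    using assms by (rule bounded_linear.has_derivative) simp
  then have "frechet_derivative L (at x) = L" "L differentiable (at x)" for x
    by (auto intro: frechet_derivative_eqI simp: differentiable_def)
  then show ?thesis using Suc by (simp add: Ck_on_const)
qed

text \<open>Lets the inductions on \<open>k\<close> below use the derivative formula of a calculus
  rule in place of \<open>frechet_derivative\<close>, which agrees with it only on
  \<open>U\<close>.\<close>

lemma Ck_on_SucI:
  assumes U: "open U"
    and d: "\<And>x. x \<in> U \<Longrightarrow> (h has_derivative h' x) (at x)"
    and c: "\<And>v. Ck_on k U (\<lambda>x. h' x v)"
  shows "Ck_on (Suc k) U h"
proof -
  have "frechet_derivative h (at x) = h' x" if "x \<in> U" for x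
    using d[OF that] by (rule frechet_derivative_eqI)
  then have "Ck_on k U (\<lambda>x. frechet_derivative h (at x) v)" for v
    by (intro Ck_on_cong[OF U _ c]) auto
  then show ?thesis using d by (auto simp: differentiable_def)
qed

lemma Ck_on_has_derivative:
  "Ck_on (Suc k) U h \<Longrightarrow> x \<in> U \<Longrightarrow> (h has_derivative frechet_derivative h (at x)) (at x)"
  by (simp add: frechet_derivative_works)

lemma Ck_on_bounded_linear_compose:
  assumes U: "open U" and L: "bounded_linear L" and "Ck_on k U h"
  shows "Ck_on k U (\<lambda>x. L (h x))"
  using assms(3)
proof (induction k arbitrary: h)
  case 0
  then show ?case using L by (auto intro: bounded_linear.continuous_on)
next
  case (Suc k)
  show ?case
    by (rule Ck_on_SucI[OF U bounded_linear.has_derivative[OF L Ck_on_has_derivative[OF Suc.prems]]],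
        assumption)
      (rule Suc.IH, use Suc.prems in simp)
qed

lemma Ck_on_compose_bounded_linear:
  assumes V: "open V" and L: "bounded_linear L" and "Ck_on k V h"
  shows "Ck_on k (L -` V) (\<lambda>x. h (L x))"
  using assms(3)
proof (induction k arbitrary: h)
  case 0
  then show ?case
    using continuous_on_compose2[of V h "L -` V" L] linear_continuous_on[OF L] by auto
next
  case (Suc k)
  have op: "open (L -` V)"
    using L V by (simp add: bounded_linear.continuous continuous_open_vimage linear_continuous_at)
  have "((\<lambda>x. h (L x)) has_derivative (\<lambda>v. frechet_derivative h (at (L x)) (L v))) (at x)"
    if "x \<in> L -` V" for x
    using Ck_on_has_derivative[OF Suc.prems, of "L x"] that bounded_linear.has_derivative[OF L has_derivative_ident]
    by (auto intro: has_derivative_compose)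
  then show ?case
    by (rule Ck_on_SucI[OF op]) (use Suc.prems in \<open>auto intro: Suc.IH\<close>)
qed

lemma Ck_on_add:
  assumes U: "open U" and "Ck_on k U h1" "Ck_on k U h2"
  shows "Ck_on k U (\<lambda>x. h1 x + h2 x)"
  using assms(2,3)
proof (induction k arbitrary: h1 h2)
  case 0
  then show ?case by (auto intro: continuous_on_add)
next
  case (Suc k)
  show ?case
    by (rule Ck_on_SucI[OF U has_derivative_add[OF Suc.prems[THEN Ck_on_has_derivative]]],
        assumption, assumption)
      (rule Suc.IH; use Suc.prems in simp)
qed

lemma Ck_on_mult:
  fixes h1 h2 :: "'a::euclidean_space \<Rightarrow> 'b::real_normed_algebra"
  assumes U: "open U" and "Ck_on k U h1" "Ck_on k U h2"
  shows "Ck_on k U (\<lambda>x. h1 x * h2 x)"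
  using assms(2,3)
proof (induction k arbitrary: h1 h2)
  case 0
  then show ?case by (auto intro: continuous_on_mult)
next
  case (Suc k)
  show ?case
    by (rule Ck_on_SucI[OF U has_derivative_mult[OF Suc.prems[THEN Ck_on_has_derivative]]],
        assumption, assumption)
      (intro Ck_on_add[OF U] Suc.IH; use Suc.prems Suc.prems[THEN Ck_on_SucD] in simp)
qed

lemma Ck_on_inverse:
  fixes h :: "'a::euclidean_space \<Rightarrow> 'b::real_normed_div_algebra"
  assumes U: "open U" and "Ck_on k U h" and nz: "\<And>x. x \<in> U \<Longrightarrow> h x \<noteq> 0"
  shows "Ck_on k U (\<lambda>x. inverse (h x))"
  using assms(2)
proof (induction k)
  case 0
  then show ?case using nz by (auto intro: continuous_on_inverse)
next
  case (Suc k)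
  have m: "Ck_on k U (\<lambda>x. - h' x)" if "Ck_on k U h'" for h' :: "'a \<Rightarrow> 'b"
    by (rule Ck_on_bounded_linear_compose[OF U _ that]) (simp add: bounded_linear_minus bounded_linear_ident)
  \<comment> \<open>The derivative contains the inverse itself, to which the induction hypothesis
    applies at the lower order.\<close>
  have "((\<lambda>x. inverse (h x)) has_derivative
     (\<lambda>v. - (inverse (h x) * frechet_derivative h (at x) v * inverse (h x)))) (at x)" if "x \<in> U" for x
    using nz[OF that] Ck_on_has_derivative[OF Suc.prems that] by (rule Deriv.has_derivative_inverse)
  then show ?case
    by (rule Ck_on_SucI[OF U])
      (use Suc.prems in \<open>auto intro!: m Ck_on_mult[OF U] Suc.IH Ck_on_SucD[OF Suc.prems]\<close>)
qed

subsection \<open>Symmetry of second derivatives\<close>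

lemma has_real_derivative_along_line:
  fixes h :: "'a::euclidean_space \<Rightarrow> real"
  assumes "h differentiable (at (x + r *\<^sub>R u))"
  shows "((\<lambda>r. h (x + r *\<^sub>R u)) has_real_derivative frechet_derivative h (at (x + r *\<^sub>R u)) u) (at r)"
proof -
  have h: "(h has_derivative frechet_derivative h (at (x + r *\<^sub>R u))) (at (x + r *\<^sub>R u))"
    using assms by (simp add: frechet_derivative_works)
  have "((\<lambda>r. x + r *\<^sub>R u) has_derivative (\<lambda>s. s *\<^sub>R u)) (at r)"
    by (auto intro!: derivative_eq_intros)
  from has_derivative_compose[OF this h]
  have "((\<lambda>r. h (x + r *\<^sub>R u)) has_derivative (\<lambda>s. frechet_derivative h (at (x + r *\<^sub>R u)) (s *\<^sub>R u))) (at r)" .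
  moreover have "frechet_derivative h (at (x + r *\<^sub>R u)) (s *\<^sub>R u) = frechet_derivative h (at (x + r *\<^sub>R u)) u * s" for s
    using linear_frechet_derivative[OF assms] by (simp add: linear_cmul)
  ultimately show ?thesis by (simp add: has_field_derivative_def)
qed

text \<open>Two uses of the mean value theorem: in direction \<open>u\<close> for the difference of
  \<open>h\<close> between two parallel sides, then in direction \<open>v\<close> for the resulting
  difference of first derivatives.\<close>

lemma double_difference:
  fixes h :: "'a::euclidean_space \<Rightarrow> real"
  assumes h: "Ck_on 2 U h" and s: "s > 0"
    and U: "\<And>r q. 0 \<le> r \<Longrightarrow> r \<le> s \<Longrightarrow> 0 \<le> q \<Longrightarrow> q \<le> s \<Longrightarrow> x + r *\<^sub>R u + q *\<^sub>R v \<in> U"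
  shows "\<exists>r q. 0 < r \<and> r < s \<and> 0 < q \<and> q < s \<and>
     h (x + s *\<^sub>R u + s *\<^sub>R v) - h (x + s *\<^sub>R u) - h (x + s *\<^sub>R v) + h x =
     s\<^sup>2 * frechet_derivative (\<lambda>y. frechet_derivative h (at y) u) (at (x + r *\<^sub>R u + q *\<^sub>R v)) v"
proof -
  have h1: "h differentiable (at y)" "(\<lambda>y. frechet_derivative h (at y) u) differentiable (at y)"
    if "y \<in> U" for y
    using h that by (simp_all add: numeral_2_eq_2)
  let ?D = "\<lambda>y. frechet_derivative h (at y) u"
  have "\<exists>r>0. r < s \<and> (h (x + s *\<^sub>R v + s *\<^sub>R u) - h (x + s *\<^sub>R u)) - (h (x + s *\<^sub>R v + 0 *\<^sub>R u) - h (x + 0 *\<^sub>R u))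
      = (s - 0) * (?D (x + s *\<^sub>R v + r *\<^sub>R u) - ?D (x + r *\<^sub>R u))"
  proof (rule MVT2[OF s])
    fix r assume r: "0 \<le> r" "r \<le> s"
    show "((\<lambda>r. h (x + s *\<^sub>R v + r *\<^sub>R u) - h (x + r *\<^sub>R u)) has_real_derivative
       ?D (x + s *\<^sub>R v + r *\<^sub>R u) - ?D (x + r *\<^sub>R u)) (at r)"
      using U[OF r, of s] U[OF r, of 0] s
      by (intro DERIV_diff has_real_derivative_along_line h1(1)) (auto simp: algebra_simps)
  qed
  then obtain r where r: "0 < r" "r < s"
    and 1: "(h (x + s *\<^sub>R v + s *\<^sub>R u) - h (x + s *\<^sub>R u)) - (h (x + s *\<^sub>R v) - h x)
      = s * (?D (x + r *\<^sub>R u + s *\<^sub>R v) - ?D (x + r *\<^sub>R u))"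
    by (auto simp: algebra_simps)
  have "\<exists>q>0. q < s \<and> ?D (x + r *\<^sub>R u + s *\<^sub>R v) - ?D (x + r *\<^sub>R u + 0 *\<^sub>R v)
      = (s - 0) * frechet_derivative ?D (at (x + r *\<^sub>R u + q *\<^sub>R v)) v"
    by (rule MVT2[OF s]) (use U[of r] r in \<open>intro has_real_derivative_along_line h1(2); auto\<close>)
  then obtain q where q: "0 < q" "q < s"
    and 2: "?D (x + r *\<^sub>R u + s *\<^sub>R v) - ?D (x + r *\<^sub>R u)
      = s * frechet_derivative ?D (at (x + r *\<^sub>R u + q *\<^sub>R v)) v"
    by auto
  show ?thesis
    by (rule exI[of _ r], rule exI[of _ q]) (use r q 1 2 in \<open>auto simp: power2_eq_square algebra_simps\<close>)
qed

text \<open>The double difference over a parallelogram is symmetric in its sides. It is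
  \<open>s\<^sup>2\<close> times either mixed derivative at some nearby point, and continuity of
  both at \<open>x\<close> forces them to agree there.\<close>

lemma frechet_derivative_commute_real:
  fixes h :: "'a::euclidean_space \<Rightarrow> real"
  assumes U: "open U" and h: "Ck_on 2 U h" and x: "x \<in> U"
  shows "frechet_derivative (\<lambda>y. frechet_derivative h (at y) u) (at x) v =
         frechet_derivative (\<lambda>y. frechet_derivative h (at y) v) (at x) u"
proof -
  define A where "A u v y = frechet_derivative (\<lambda>y. frechet_derivative h (at y) u) (at y) v" for u v y
  have cont: "continuous (at x) (A u v)" for u v
    using h x U unfolding A_def by (simp add: numeral_2_eq_2 continuous_on_eq_continuous_at)
  have "\<bar>A u v x - A v u x\<bar> \<le> e" if "e > 0" for e
  proof -
    obtain d1 where d1: "d1 > 0" "\<And>y. dist y x < d1 \<Longrightarrow> dist (A u v y) (A u v x) < e/2"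
      using cont[of u v] \<open>e > 0\<close> unfolding continuous_at_eps_delta by (meson half_gt_zero)
    obtain d2 where d2: "d2 > 0" "\<And>y. dist y x < d2 \<Longrightarrow> dist (A v u y) (A v u x) < e/2"
      using cont[of v u] \<open>e > 0\<close> unfolding continuous_at_eps_delta by (meson half_gt_zero)
    obtain d3 where d3: "d3 > 0" "ball x d3 \<subseteq> U" using U x openE by blast
    define d where "d = min d1 (min d2 d3)"
    have d: "d > 0" using d1 d2 d3 by (simp add: d_def)
    \<comment> \<open>Small enough to keep the parallelogram inside the ball of radius
      \<open>d\<close>; the summand 1 covers \<open>u = v = 0\<close>.\<close>
    define s where "s = d / (2 * (norm u + norm v + 1))"
    have n: "norm u + norm v + 1 > 0" by (smt (verit) norm_ge_zero)
    have s: "s > 0" using d n by (simp add: s_def)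
    have sd: "s * (norm u + norm v) < d"
    proof -
      have "s * (norm u + norm v) \<le> s * (norm u + norm v + 1)" using s by simp
      also have "\<dots> = d / 2" using n by (simp add: s_def divide_simps)
      finally show ?thesis using d by simp
    qed
    have near: "dist (x + r *\<^sub>R u' + q *\<^sub>R v') x < d"
      if "0 \<le> r" "r \<le> s" "0 \<le> q" "q \<le> s" "norm u' + norm v' = norm u + norm v" for r q u' v'
    proof -
      have "dist (x + r *\<^sub>R u' + q *\<^sub>R v') x = norm (r *\<^sub>R u' + q *\<^sub>R v')" by (simp add: dist_norm)
      also have "\<dots> \<le> r * norm u' + q * norm v'"
        using norm_triangle_ineq[of "r *\<^sub>R u'" "q *\<^sub>R v'"] that by simp
      also have "\<dots> \<le> s * norm u' + s * norm v'"
        using that by (intro add_mono mult_right_mono) auto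
      also have "\<dots> = s * (norm u + norm v)" using that(5) by (metis distrib_left)
      finally show ?thesis using sd by simp
    qed
    then have inU: "x + r *\<^sub>R u' + q *\<^sub>R v' \<in> U"
      if "0 \<le> r" "r \<le> s" "0 \<le> q" "q \<le> s" "norm u' + norm v' = norm u + norm v" for r q u' v'
      using near[OF that] d3(2) by (auto simp: d_def dist_commute subset_iff)
    obtain r q where rq: "0 < r" "r < s" "0 < q" "q < s"
      and 1: "h (x + s *\<^sub>R u + s *\<^sub>R v) - h (x + s *\<^sub>R u) - h (x + s *\<^sub>R v) + h x
         = s\<^sup>2 * A u v (x + r *\<^sub>R u + q *\<^sub>R v)"
      using double_difference[OF h s, of x u v] inU unfolding A_def by auto
    obtain r' q' where rq': "0 < r'" "r' < s" "0 < q'" "q' < s"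
      and 2: "h (x + s *\<^sub>R v + s *\<^sub>R u) - h (x + s *\<^sub>R v) - h (x + s *\<^sub>R u) + h x
         = s\<^sup>2 * A v u (x + r' *\<^sub>R v + q' *\<^sub>R u)"
      using double_difference[OF h s, of x v u] inU unfolding A_def by (auto simp: add.commute)
    have "s\<^sup>2 * A u v (x + r *\<^sub>R u + q *\<^sub>R v) = s\<^sup>2 * A v u (x + r' *\<^sub>R v + q' *\<^sub>R u)"
      using 1 2 by (simp add: algebra_simps)
    then have eq: "A u v (x + r *\<^sub>R u + q *\<^sub>R v) = A v u (x + r' *\<^sub>R v + q' *\<^sub>R u)"
      using s by simp
    have "dist (A u v (x + r *\<^sub>R u + q *\<^sub>R v)) (A u v x) < e/2"
      using near[of r q u v] rq by (intro d1(2)) (auto simp: d_def)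
    moreover have "dist (A v u (x + r' *\<^sub>R v + q' *\<^sub>R u)) (A v u x) < e/2"
      using near[of r' q' v u] rq' by (intro d2(2)) (auto simp: d_def)
    ultimately show ?thesis using eq by (simp add: dist_real_def abs_if split: if_splits)
  qed
  then have "\<bar>A u v x - A v u x\<bar> \<le> 0" by (rule field_le_epsilon) auto
  then show ?thesis by (simp add: A_def)
qed

lemma frechet_derivative_bounded_linear_compose:
  assumes "bounded_linear L" "h differentiable (at x)"
  shows "frechet_derivative (\<lambda>x. L (h x)) (at x) v = L (frechet_derivative h (at x) v)"
  using frechet_derivative_eqI[OF bounded_linear.has_derivative[OF assms(1)
      assms(2)[unfolded frechet_derivative_works]]] by simp

text \<open>The mean value theorem behind the real case fails for vector values, hence the passage
  to components.\<close>

lemma frechet_derivative_commute: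
  fixes h :: "'a::euclidean_space \<Rightarrow> 'b::euclidean_space"
  assumes U: "open U" and h: "Ck_on 2 U h" and x: "x \<in> U"
  shows "frechet_derivative (\<lambda>y. frechet_derivative h (at y) u) (at x) v =
         frechet_derivative (\<lambda>y. frechet_derivative h (at y) v) (at x) u"
proof (rule euclidean_eqI)
  fix b :: 'b assume "b \<in> Basis"
  let ?L = "\<lambda>y::'b. y \<bullet> b"
  have L: "bounded_linear ?L" by (rule bounded_linear_inner_left)
  have dd: "h differentiable (at y)" "(\<lambda>y. frechet_derivative h (at y) w) differentiable (at y)"
    if "y \<in> U" for y w
    using h that by (simp_all add: numeral_2_eq_2)
  have eq: "frechet_derivative (\<lambda>y. frechet_derivative (\<lambda>z. ?L (h z)) (at y) w) (at x) w' =
      ?L (frechet_derivative (\<lambda>y. frechet_derivative h (at y) w) (at x) w')" for w w'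
  proof -
    have "frechet_derivative (\<lambda>y. ?L (frechet_derivative h (at y) w)) (at x) =
          frechet_derivative (\<lambda>y. frechet_derivative (\<lambda>z. ?L (h z)) (at y) w) (at x)"
    proof (rule frechet_derivative_transform_within_open[OF _ U x])
      show "(\<lambda>y. ?L (frechet_derivative h (at y) w)) differentiable (at x)"
        by (rule differentiable_compose[of ?L, OF bounded_linear_imp_differentiable[OF L] dd(2)[OF x]])
    qed (simp add: frechet_derivative_bounded_linear_compose[OF L] dd)
    from fun_cong[OF this, of w', symmetric] frechet_derivative_bounded_linear_compose[OF L dd(2)[OF x]]
    show ?thesis by (rule trans)
  qed
  have "Ck_on 2 U (\<lambda>z. ?L (h z))" by (rule Ck_on_bounded_linear_compose[OF U L h])
  from frechet_derivative_commute_real[OF U this x]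
  show "?L (frechet_derivative (\<lambda>y. frechet_derivative h (at y) u) (at x) v) =
        ?L (frechet_derivative (\<lambda>y. frechet_derivative h (at y) v) (at x) u)"
    by (simp add: eq)
qed

subsection \<open>Complexified derivations\<close>

definition Cinf_on :: "'a::euclidean_space set \<Rightarrow> ('a \<Rightarrow> 'b::real_normed_vector) \<Rightarrow> bool" where
  "Cinf_on U h \<longleftrightarrow> (\<forall>k. Ck_on k U h)"

lemma Cinf_on_differentiable: "Cinf_on U h \<Longrightarrow> x \<in> U \<Longrightarrow> h differentiable (at x)"
  unfolding Cinf_on_def by (metis Ck_on.simps(2))

lemma Cinf_on_has_derivative:
  "Cinf_on U h \<Longrightarrow> x \<in> U \<Longrightarrow> (h has_derivative frechet_derivative h (at x)) (at x)"
  using Cinf_on_differentiable frechet_derivative_works by blast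

lemma Cinf_on_frechet_derivative: "Cinf_on U h \<Longrightarrow> Cinf_on U (\<lambda>x. frechet_derivative h (at x) v)"
  unfolding Cinf_on_def by (metis Ck_on.simps(2))

lemma Cinf_on_continuous: "Cinf_on U h \<Longrightarrow> continuous_on U h"
  unfolding Cinf_on_def by (metis Ck_on.simps(1))

lemma Cinf_on_cong:
  "open U \<Longrightarrow> (\<And>x. x \<in> U \<Longrightarrow> h x = h' x) \<Longrightarrow> Cinf_on U h \<Longrightarrow> Cinf_on U h'"
  unfolding Cinf_on_def using Ck_on_cong by blast

lemma Cinf_on_I:
  assumes "open U" "\<And>x. x \<in> U \<Longrightarrow> (h has_derivative h' x) (at x)" "\<And>v. Cinf_on U (\<lambda>x. h' x v)"
  shows "Cinf_on U h"
  unfolding Cinf_on_def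
proof
  fix k show "Ck_on k U h"
    using Ck_on_SucI[OF assms(1,2)] assms(3) unfolding Cinf_on_def by (blast intro: Ck_on_SucD)
qed

lemma Cinf_on_const: "Cinf_on U (\<lambda>x. c)"
  by (simp add: Cinf_on_def Ck_on_const)

lemma Cinf_on_bounded_linear: "bounded_linear L \<Longrightarrow> Cinf_on U L"
  by (simp add: Cinf_on_def Ck_on_bounded_linear)

lemma Cinf_on_bounded_linear_compose:
  "open U \<Longrightarrow> bounded_linear L \<Longrightarrow> Cinf_on U h \<Longrightarrow> Cinf_on U (\<lambda>x. L (h x))"
  by (simp add: Cinf_on_def Ck_on_bounded_linear_compose)

text \<open>No differentiability is assumed: both sides choose from the same set of derivatives,
  even if that set is empty.\<close>

lemma frechet_derivative_local:
  assumes "open U" "x \<in> U" "\<And>y. y \<in> U \<Longrightarrow> h y = h' y"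
  shows "frechet_derivative h (at x) = frechet_derivative h' (at x)"
proof -
  have "(h has_derivative D) (at x) \<longleftrightarrow> (h' has_derivative D) (at x)" for D
    using has_derivative_transform_within_open[of h D x UNIV U h']
      has_derivative_transform_within_open[of h' D x UNIV U h] assms by auto
  then show ?thesis by (simp add: frechet_derivative_def)
qed

text \<open>A pair \<open>(u, v)\<close> of real vectors stands for the complexified vector \<open>u + i v\<close>.\<close>

definition cder :: "'a::real_normed_vector \<times> 'a \<Rightarrow> ('a \<Rightarrow> complex) \<Rightarrow> 'a \<Rightarrow> complex" where
  "cder X h x = frechet_derivative h (at x) (fst X) + \<i> * frechet_derivative h (at x) (snd X)"

lemma cder_has_derivative:
  "(h has_derivative h') (at x) \<Longrightarrow> cder X h x = h' (fst X) + \<i> * h' (snd X)"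
  by (simp add: cder_def frechet_derivative_eqI)

lemma cder_const [simp]: "cder X (\<lambda>x. c) x = 0"
  by (simp add: cder_def)

text \<open>With one fixed open set, smoothness and the derivation rules can act as conditional
  rewrite rules. They are proved once for \<open>cder\<close> and then serve the Wirtinger
  derivatives and the time derivative alike.\<close>

locale open_domain =
  fixes W :: "'a::euclidean_space set"
  assumes open_W: "open W"
begin

lemma Cinf_add [simp]: "Cinf_on W h \<Longrightarrow> Cinf_on W k \<Longrightarrow> Cinf_on W (\<lambda>x. h x + k x)"
  by (simp add: Cinf_on_def Ck_on_add open_W)

lemma Cinf_mult [simp]:
  fixes h k :: "'a \<Rightarrow> complex"
  shows "Cinf_on W h \<Longrightarrow> Cinf_on W k \<Longrightarrow> Cinf_on W (\<lambda>x. h x * k x)"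
  by (simp add: Cinf_on_def Ck_on_mult open_W)

lemma Cinf_const [simp]: "Cinf_on W (\<lambda>x. c)"
  by (rule Cinf_on_const)

lemma Cinf_minus [simp]: "Cinf_on W h \<Longrightarrow> Cinf_on W (\<lambda>x. - h x)"
  by (rule Cinf_on_bounded_linear_compose[OF open_W]) (simp_all add: bounded_linear_minus bounded_linear_ident)

lemma Cinf_diff [simp]: "Cinf_on W h \<Longrightarrow> Cinf_on W k \<Longrightarrow> Cinf_on W (\<lambda>x. h x - k x)"
  using Cinf_add[of h "\<lambda>x. - k x"] by simp

lemma Cinf_cnj [simp]: "Cinf_on W h \<Longrightarrow> Cinf_on W (\<lambda>x. cnj (h x))"
  by (rule Cinf_on_bounded_linear_compose[OF open_W bounded_linear_cnj])

lemma Cinf_sum [simp]: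
  "(\<And>i. i \<in> I \<Longrightarrow> Cinf_on W (h i)) \<Longrightarrow> Cinf_on W (\<lambda>x. \<Sum>i\<in>I. h i x)"
  by (induction I rule: infinite_finite_induct) auto

lemma Cinf_prod:
  fixes h :: "'i \<Rightarrow> 'a \<Rightarrow> complex"
  shows "(\<And>i. i \<in> I \<Longrightarrow> Cinf_on W (h i)) \<Longrightarrow> Cinf_on W (\<lambda>x. \<Prod>i\<in>I. h i x)"
  by (induction I rule: infinite_finite_induct) auto

lemma Cinf_divide:
  fixes h k :: "'a \<Rightarrow> complex"
  assumes "Cinf_on W h" "Cinf_on W k" "\<And>x. x \<in> W \<Longrightarrow> k x \<noteq> 0"
  shows "Cinf_on W (\<lambda>x. h x / k x)"
proof -
  have "Cinf_on W (\<lambda>x. inverse (k x))"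
    using assms by (simp add: Cinf_on_def Ck_on_inverse open_W)
  then show ?thesis using assms(1) by (simp add: divide_inverse)
qed

lemma Cinf_cder [simp]: "Cinf_on W h \<Longrightarrow> Cinf_on W (cder X h)"
  unfolding cder_def by (simp add: Cinf_on_frechet_derivative)

lemma cder_cong: "x \<in> W \<Longrightarrow> (\<And>y. y \<in> W \<Longrightarrow> h y = k y) \<Longrightarrow> cder X h x = cder X k x"
  by (simp add: cder_def frechet_derivative_local[OF open_W, of x h k])

lemma cder_add [simp]:
  assumes "Cinf_on W h" "Cinf_on W k" "x \<in> W"
  shows "cder X (\<lambda>x. h x + k x) x = cder X h x + cder X k x"
  using cder_has_derivative[OF has_derivative_add[OF assms(1,2)[THEN Cinf_on_has_derivative, OF assms(3)]]]
  by (simp add: cder_def algebra_simps)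

lemma cder_minus [simp]:
  assumes "Cinf_on W h" "x \<in> W"
  shows "cder X (\<lambda>x. - h x) x = - cder X h x"
  using cder_has_derivative[OF has_derivative_minus[OF Cinf_on_has_derivative[OF assms]]]
  by (simp add: cder_def)

lemma cder_diff [simp]:
  assumes "Cinf_on W h" "Cinf_on W k" "x \<in> W"
  shows "cder X (\<lambda>x. h x - k x) x = cder X h x - cder X k x"
  using cder_has_derivative[OF has_derivative_diff[OF assms(1,2)[THEN Cinf_on_has_derivative, OF assms(3)]]]
  by (simp add: cder_def algebra_simps)

lemma cder_mult [simp]:
  assumes "Cinf_on W h" "Cinf_on W k" "x \<in> W"
  shows "cder X (\<lambda>x. h x * k x) x = cder X h x * k x + h x * cder X k x"
  using cder_has_derivative[OF has_derivative_mult[OF assms(1,2)[THEN Cinf_on_has_derivative, OF assms(3)]]]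
  by (simp add: cder_def algebra_simps)

text \<open>Conjugation turns u + i v into u - i v, so the field changes; for Wirtinger fields this
  exchanges the holomorphic and the antiholomorphic one.\<close>

lemma cder_cnj [simp]:
  assumes "Cinf_on W h" "x \<in> W"
  shows "cder X (\<lambda>x. cnj (h x)) x = cnj (cder (fst X, - snd X) h x)"
proof -
  have D: "(h has_derivative frechet_derivative h (at x)) (at x)"
    using assms by (rule Cinf_on_has_derivative)
  then have "linear (frechet_derivative h (at x))" by (rule has_derivative_linear)
  then show ?thesis
    using cder_has_derivative[OF bounded_linear.has_derivative[OF bounded_linear_cnj D], of X]
    by (simp add: cder_def linear_neg)
qed

lemma cder_sum [simp]:
  assumes "\<And>i. i \<in> I \<Longrightarrow> Cinf_on W (h i)" "x \<in> W"
  shows "cder X (\<lambda>x. \<Sum>i\<in>I. h i x) x = (\<Sum>i\<in>I. cder X (h i) x)"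
  using assms(1) by (induction I rule: infinite_finite_induct) (simp_all add: assms(2))

text \<open>Both fields have constant coefficients, so the symmetry of second directional
  derivatives is all that is needed.\<close>

lemma cder_commute:
  assumes h: "Cinf_on W h" and x: "x \<in> W"
  shows "cder X (cder Y h) x = cder Y (cder X h) x"
proof -
  have 1: "cder A (cder B h) x =
      frechet_derivative (\<lambda>y. frechet_derivative h (at y) (fst B)) (at x) (fst A)
      + \<i> * frechet_derivative (\<lambda>y. frechet_derivative h (at y) (snd B)) (at x) (fst A)
      + \<i> * (frechet_derivative (\<lambda>y. frechet_derivative h (at y) (fst B)) (at x) (snd A)
      + \<i> * frechet_derivative (\<lambda>y. frechet_derivative h (at y) (snd B)) (at x) (snd A))" for A B
  proof -
    let ?F = "\<lambda>v y. frechet_derivative h (at y) v"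
    have D: "(?F v has_derivative frechet_derivative (?F v) (at x)) (at x)" for v
      using Cinf_on_has_derivative[OF Cinf_on_frechet_derivative[OF h] x] .
    have "(cder B h has_derivative (\<lambda>u. frechet_derivative (?F (fst B)) (at x) u
        + \<i> * frechet_derivative (?F (snd B)) (at x) u)) (at x)"
      unfolding cder_def by (intro has_derivative_add has_derivative_mult_right D)
    from cder_has_derivative[OF this] show ?thesis by (simp add: algebra_simps)
  qed
  have "frechet_derivative (\<lambda>y. frechet_derivative h (at y) u) (at x) v =
        frechet_derivative (\<lambda>y. frechet_derivative h (at y) v) (at x) u" for u v
    by (rule frechet_derivative_commute[OF open_W _ x]) (use h in \<open>simp add: Cinf_on_def\<close>)
  then show ?thesis by (simp only: 1) (simp add: algebra_simps)
qed

text \<open>The pair in the second claim is the product (a + i b)(u + i v): \<open>cder\<close> is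
  complex linear in its field.\<close>

lemma cder_linear:
  assumes "Cinf_on W h" "x \<in> W"
  shows "cder (fst X + fst Y, snd X + snd Y) h x = cder X h x + cder Y h x"
    and "cder (a *\<^sub>R fst X - b *\<^sub>R snd X, b *\<^sub>R fst X + a *\<^sub>R snd X) h x = Complex a b * cder X h x"
proof -
  have "linear (frechet_derivative h (at x))"
    using Cinf_on_has_derivative[OF assms] by (rule has_derivative_linear)
  note lin = linear_add[OF this] linear_diff[OF this] linear_scale[OF this]
  show "cder (fst X + fst Y, snd X + snd Y) h x = cder X h x + cder Y h x"
    by (simp add: cder_def lin algebra_simps)
  show "cder (a *\<^sub>R fst X - b *\<^sub>R snd X, b *\<^sub>R fst X + a *\<^sub>R snd X) h x = Complex a b * cder X h x"
    by (simp add: cder_def lin complex_eq_iff algebra_simps)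
qed

end

subsection \<open>Positive definite hermitian matrices\<close>

definition sesq :: "complex^'m^'m \<Rightarrow> complex^'m \<Rightarrow> complex^'m::finite \<Rightarrow> complex" where
  "sesq A u v = (\<Sum>\<alpha>\<in>UNIV. \<Sum>\<beta>\<in>UNIV. A $ \<alpha> $ \<beta> * u $ \<alpha> * cnj (v $ \<beta>))"

definition hermitian_pd :: "complex^'m^'m::finite \<Rightarrow> bool" where
  "hermitian_pd A \<longleftrightarrow> (\<forall>\<alpha> \<beta>. A $ \<beta> $ \<alpha> = cnj (A $ \<alpha> $ \<beta>)) \<and> (\<forall>v. v \<noteq> 0 \<longrightarrow> Re (sesq A v v) > 0)"

lemma sesq_add_left: "sesq A (u + v) w = sesq A u w + sesq A v w"
  and sesq_add_right: "sesq A w (u + v) = sesq A w u + sesq A w v"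
  and sesq_diff_left: "sesq A (u - v) w = sesq A u w - sesq A v w"
  and sesq_diff_right: "sesq A w (u - v) = sesq A w u - sesq A w v"
  and sesq_scale_left: "sesq A (c *s u) w = c * sesq A u w"
  and sesq_scale_right: "sesq A w (c *s u) = cnj c * sesq A w u"
  by (simp_all add: sesq_def algebra_simps sum.distrib sum_subtractf sum_distrib_left)

lemma sesq_0_left [simp]: "sesq A 0 v = 0" and sesq_0_right [simp]: "sesq A v 0 = 0"
  by (simp_all add: sesq_def)

lemma sesq_sum_left: "sesq A (\<Sum>i\<in>I. u i) v = (\<Sum>i\<in>I. sesq A (u i) v)"
  by (induction I rule: infinite_finite_induct) (simp_all add: sesq_add_left)

lemma sesq_sum_right: "sesq A v (\<Sum>i\<in>I. u i) = (\<Sum>i\<in>I. sesq A v (u i))"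
  by (induction I rule: infinite_finite_induct) (simp_all add: sesq_add_right)

lemma sesq_axis:
  fixes A :: "complex^'m^'m::finite"
  shows "sesq A (axis \<alpha> 1) (axis \<beta> 1) = A $ \<alpha> $ \<beta>"
proof -
  have "A $ i $ j * (axis \<alpha> 1 :: complex^'m) $ i * cnj ((axis \<beta> 1 :: complex^'m) $ j)
      = (if j = \<beta> then if i = \<alpha> then A $ i $ j else 0 else 0)" for i j
    by (simp add: axis_def)
  then show ?thesis by (simp add: sesq_def)
qed

lemma sesq_cnj:
  assumes "\<And>\<alpha> \<beta>. A $ \<beta> $ \<alpha> = cnj (A $ \<alpha> $ \<beta>)"
  shows "cnj (sesq A u v) = sesq A v u"
proof -
  have "cnj (sesq A u v) = (\<Sum>\<alpha>\<in>UNIV. \<Sum>\<beta>\<in>UNIV. A $ \<beta> $ \<alpha> * v $ \<beta> * cnj (u $ \<alpha>))"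
    by (simp add: sesq_def assms[symmetric] mult_ac)
  also have "\<dots> = sesq A v u" unfolding sesq_def by (rule sum.swap)
  finally show ?thesis .
qed

lemma sesq_eq_mult: "sesq A u v = (\<Sum>\<alpha>\<in>UNIV. u $ \<alpha> * (A *v (\<chi> \<beta>. cnj (v $ \<beta>))) $ \<alpha>)"
  by (simp add: sesq_def matrix_vector_mult_def sum_distrib_left mult_ac)

lemma ker_nontrivial:
  fixes A :: "'a::field^'n^'n::finite"
  assumes "det A = 0"
  shows "\<exists>v. v \<noteq> 0 \<and> A *v v = 0"
  using assms by (metis invertible_det_nz invertible_left_inverse matrix_left_invertible_ker)

lemma hermitian_pd_det_nonzero:
  assumes "hermitian_pd A"
  shows "det A \<noteq> 0"
proof
  assume "det A = 0"
  then obtain v where v: "v \<noteq> 0" "A *v v = 0" using ker_nontrivial by blast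
  \<comment> \<open>\<open>sesq\<close> conjugates its second argument, so the null vector is
    conjugated beforehand.\<close>
  define u where "u = (\<chi> \<beta>. cnj (v $ \<beta>))"
  have "(\<chi> \<beta>. cnj (u $ \<beta>)) = v" by (simp add: u_def vec_eq_iff)
  then have "sesq A u u = 0" by (simp add: sesq_eq_mult v)
  moreover have "u \<noteq> 0" using v(1) by (auto simp: u_def vec_eq_iff)
  ultimately show False using assms by (auto simp: hermitian_pd_def)
qed

lemma hermitian_det_real:
  assumes "\<And>\<alpha> \<beta>. A $ \<beta> $ \<alpha> = cnj (A $ \<alpha> $ \<beta>)"
  shows "det A \<in> \<real>"
proof -
  have "cnj (det A) = det (\<chi> i j. cnj (A $ i $ j))"
    by (simp add: det_def)
  also have "(\<chi> i j. cnj (A $ i $ j)) = transpose A"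
    by (simp add: transpose_def vec_eq_iff assms[symmetric])
  finally show ?thesis by (simp add: complex_is_Real_iff complex_eq_iff)
qed

text \<open>The segment from the identity to \<open>A\<close> consists of positive definite
  matrices. Their determinants are real and nonzero, so the sign at the identity persists.\<close>

lemma hermitian_pd_det_pos:
  assumes A: "hermitian_pd A"
  shows "Re (det A) > 0"
proof (rule ccontr)
  define B where "B s = (\<chi> i j. of_real (1 - s) * (mat 1 :: complex^'a^'a) $ i $ j + of_real s * A $ i $ j)"
    for s :: real
  have sB: "sesq (B s) u v = of_real (1 - s) * sesq (mat 1) u v + of_real s * sesq A u v" for s u v
    by (simp add: B_def sesq_def algebra_simps sum.distrib sum_distrib_left sum_subtractf)
  have one: "Re (sesq (mat 1) v v) > 0" if "v \<noteq> 0" for v :: "complex^'a"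
  proof -
    have "(mat 1 :: complex^'a^'a) $ i $ j * v $ i * cnj (v $ j) = (if j = i then v $ i * cnj (v $ i) else 0)" for i j
      by (simp add: mat_def)
    then have "sesq (mat 1) v v = (\<Sum>i\<in>UNIV. v $ i * cnj (v $ i))"
      by (simp add: sesq_def)
    then have "Re (sesq (mat 1) v v) = (\<Sum>i\<in>UNIV. (cmod (v $ i))\<^sup>2)"
      by (simp add: complex_mult_cnj cmod_power2)
    moreover have "(\<Sum>i\<in>UNIV. (cmod (v $ i))\<^sup>2) > 0"
    proof -
      obtain i where "v $ i \<noteq> 0" using \<open>v \<noteq> 0\<close> by (auto simp: vec_eq_iff)
      then show ?thesis by (intro sum_pos2[of UNIV i]) auto
    qed
    ultimately show ?thesis by simp
  qed
  have pd: "hermitian_pd (B s)" if "0 \<le> s" "s \<le> 1" for s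
    unfolding hermitian_pd_def
  proof (intro conjI allI impI)
    show "B s $ \<beta> $ \<alpha> = cnj (B s $ \<alpha> $ \<beta>)" for \<alpha> \<beta>
    proof -
      have "A $ \<beta> $ \<alpha> = cnj (A $ \<alpha> $ \<beta>)" using A unfolding hermitian_pd_def by blast
      then show ?thesis by (simp add: B_def mat_def)
    qed
    fix v :: "complex^'a" assume v: "v \<noteq> 0"
    have "Re (sesq A v v) > 0" using A v by (simp add: hermitian_pd_def)
    then show "0 < Re (sesq (B s) v v)"
      using one[OF v] that
      by (cases "s = 0") (auto simp: sB intro!: add_nonneg_pos)
  qed
  assume "\<not> Re (det A) > 0"
  moreover have "continuous_on {0..1} (\<lambda>s. Re (det (B s)))"
    unfolding det_def B_def by (intro continuous_intros)
  moreover have "Re (det (B 0)) = 1"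
  proof -
    have "B 0 = mat 1" by (simp add: B_def vec_eq_iff)
    then show ?thesis by simp
  qed
  moreover have "B 1 = A" by (simp add: B_def vec_eq_iff)
  ultimately obtain s where s: "0 \<le> s" "s \<le> 1" "Re (det (B s)) = 0"
    using IVT2'[of "\<lambda>s. Re (det (B s))" 1 0 0] by fastforce
  have "det (B s) \<in> \<real>"
    using pd[OF s(1,2)] unfolding hermitian_pd_def by (intro hermitian_det_real) blast
  then show False
    using s(3) hermitian_pd_det_nonzero[OF pd[OF s(1,2)]] by (auto simp: complex_is_Real_iff complex_eq_iff)
qed

text \<open>Gram-Schmidt without projections: each new vector is found as a kernel vector of the
  orthogonality conditions and then normalized.\<close>

lemma unitary_frame_exists:
  assumes A: "hermitian_pd (A :: complex^'m^'m::finite)"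
  shows "\<exists>e :: 'm \<Rightarrow> complex^'m. \<forall>a b. sesq A (e a) (e b) = (if a = b then 1 else 0)"
proof -
  have herm: "A $ \<beta> $ \<alpha> = cnj (A $ \<alpha> $ \<beta>)" for \<alpha> \<beta>
    using A unfolding hermitian_pd_def by blast
  have "\<exists>e :: 'm \<Rightarrow> complex^'m. \<forall>a\<in>I. \<forall>b\<in>I. sesq A (e a) (e b) = (if a = b then 1 else 0)" for I :: "'m set"
  proof (induction I rule: finite_induct[OF finite])
    case 1
    then show ?case by simp
  next
    case (2 k I)
    then obtain e :: "'m \<Rightarrow> complex^'m" where e: "\<And>a b. a \<in> I \<Longrightarrow> b \<in> I \<Longrightarrow> sesq A (e a) (e b) = (if a = b then 1 else 0)"
      by blast
    \<comment> \<open>The rows in \<open>I\<close> express orthogonality to the vectors already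
      chosen. The new row \<open>k\<close> is zero, so the determinant vanishes and there is a
      kernel vector.\<close>
    define B where "B = (\<chi> i j. if i \<in> I then \<Sum>\<beta>\<in>UNIV. A $ j $ \<beta> * cnj (e i $ \<beta>) else 0)"
    have Bv: "(B *v v) $ i = sesq A v (e i)" if "i \<in> I" for v i
      using that by (simp add: B_def matrix_vector_mult_def sesq_def sum_distrib_left mult_ac)
    have "row k B = 0" using 2(2) by (simp add: B_def row_def vec_eq_iff)
    then obtain v where v: "v \<noteq> 0" "B *v v = 0" using ker_nontrivial det_zero_row(2) by blast
    define r where "r = sqrt (Re (sesq A v v))"
    have pos: "Re (sesq A v v) > 0" using A v(1) by (simp add: hermitian_pd_def)
    have r: "r > 0" "r * r = Re (sesq A v v)" using pos by (simp_all add: r_def)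
    have "sesq A v v \<in> \<real>" using sesq_cnj[OF herm, of v v] by (simp add: complex_is_Real_iff complex_eq_iff)
    then have vv: "sesq A v v = of_real (r * r)" by (simp add: r(2) complex_is_Real_iff complex_eq_iff)
    have v0: "sesq A v (e i) = 0" if "i \<in> I" for i using Bv[OF that, of v] v(2) by simp
    have v1: "sesq A (e i) v = 0" if "i \<in> I" for i
      using sesq_cnj[OF herm, of v "e i"] v0[OF that] by simp
    define e' where "e' = e(k := of_real (1/r) *s v)"
    have "sesq A (e' k) (e' k) = 1" using r(1) by (simp add: e'_def sesq_scale_left sesq_scale_right vv)
    moreover have "sesq A (e' k) (e' i) = 0" "sesq A (e' i) (e' k) = 0" if "i \<in> I" for i
      using that 2(2) v0[OF that] v1[OF that] by (auto simp: e'_def sesq_scale_left sesq_scale_right)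
    moreover have "sesq A (e' i) (e' j) = sesq A (e i) (e j)" if "i \<in> I" "j \<in> I" for i j
      using that 2(2) by (auto simp: e'_def)
    ultimately have "\<forall>a\<in>insert k I. \<forall>b\<in>insert k I. sesq A (e' a) (e' b) = (if a = b then 1 else 0)"
      using 2(2) e by auto
    then show ?case by blast
  qed
  from this[of UNIV] show ?thesis by (simp only: ball_UNIV)
qed

subsection \<open>Inverse matrices and traces\<close>

lemma matrix_inv_eqI:
  fixes A B :: "'a::field^'n^'n::finite"
  assumes "A ** B = mat 1"
  shows "matrix_inv A = B"
proof -
  have BA: "B ** A = mat 1" using assms matrix_left_right_inverse by blast
  then have "\<exists>C. A ** C = mat 1 \<and> C ** A = mat 1" using assms by blast
  then have "A ** matrix_inv A = mat 1" unfolding matrix_inv_def by (metis (mono_tags, lifting) someI_ex)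
  then have "B ** A ** matrix_inv A = B ** mat 1" by (metis matrix_mul_assoc)
  then show ?thesis by (simp add: BA)
qed

lemma matrix_inv_mult:
  fixes A :: "'a::field^'n^'n::finite"
  assumes "det A \<noteq> 0"
  shows "A ** matrix_inv A = mat 1" "matrix_inv A ** A = mat 1"
proof -
  obtain B where B: "A ** B = mat 1" "B ** A = mat 1"
    using assms by (metis invertible_det_nz invertible_def)
  then show "A ** matrix_inv A = mat 1" "matrix_inv A ** A = mat 1"
    using matrix_inv_eqI by metis+
qed

text \<open>Cramer's rule; it exhibits the entries of the inverse as quotients of polynomials, from
  which their smoothness follows.\<close>

lemma matrix_inv_entry:
  fixes A :: "'a::field^'n^'n::finite"
  assumes "det A \<noteq> 0"
  shows "matrix_inv A $ k $ j = det (\<chi> i l. if l = k then axis j 1 $ i else A $ i $ l) / det A"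
proof -
  have "A *v (matrix_inv A *v axis j 1) = axis j 1"
    by (simp add: matrix_vector_mul_assoc matrix_inv_mult[OF assms])
  then have "(matrix_inv A *v axis j 1) $ k = det (\<chi> i l. if l = k then axis j 1 $ i else A $ i $ l) / det A"
    using arg_cong[where f = "\<lambda>x. x $ k", OF iffD1[OF cramer[OF assms]]] by (simp only: vec_lambda_beta)
  moreover have "(matrix_inv A *v axis j 1) $ k = matrix_inv A $ k $ j"
    by (simp add: matrix_vector_mult_def axis_def if_distrib[of "\<lambda>x. _ * x"] cong: if_cong)
  ultimately show ?thesis by (simp only:)
qed

text \<open>Expansion along row \<open>i\<close>, with the cofactors written as \<open>det A\<close>
  times entries of the inverse; prepares Jacobi's formula.\<close>

lemma det_replace_row:
  fixes A :: "'a::field^'n^'n::finite"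
  assumes "det A \<noteq> 0"
  shows "det (\<chi> k j. if k = i then r $ j else A $ k $ j) = (\<Sum>j\<in>UNIV. r $ j * matrix_inv A $ j $ i) * det A"
proof -
  define x where "x = r v* matrix_inv A"
  have "x v* A = r"
    by (simp add: x_def vector_matrix_mul_assoc matrix_inv_mult[OF assms])
  then have "(\<Sum>l\<in>UNIV. x $ l *s row l A) = r"
    by (simp add: vec_eq_iff vector_matrix_mult_def row_def mult.commute)
  then have "det (\<chi> k. if k = i then r else row k A) = x $ i * det A"
    using cramer_lemma_transpose[of i x A] by (simp only:)
  moreover have "(\<chi> k. if k = i then r else row k A) = (\<chi> k j. if k = i then r $ j else A $ k $ j)"
    by (simp add: vec_eq_iff row_def)
  ultimately show ?thesis by (simp add: x_def vector_matrix_mult_def mult.commute)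
qed

lemma trace_mult_sum: "trace (A ** B) = (\<Sum>i\<in>UNIV. \<Sum>j\<in>UNIV. A $ i $ j * B $ j $ i)"
  by (simp add: trace_def matrix_matrix_mult_def)

text \<open>If the rows of E are the frame vectors and F is its conjugate transpose, then E A F = 1.
  Hence the inverse of A is F E, and cyclicity of the trace moves E and F around the other
  factors.\<close>

lemma trace_unitary_frame:
  fixes A :: "complex^'m^'m::finite" and e :: "'m \<Rightarrow> complex^'m"
  assumes e: "\<And>a b. sesq A (e a) (e b) = (if a = b then 1 else 0)"
  shows "trace (matrix_inv A ** B) = (\<Sum>a\<in>UNIV. sesq B (e a) (e a))"
    and "trace (matrix_inv A ** C ** matrix_inv A ** B) =
      (\<Sum>a\<in>UNIV. \<Sum>b\<in>UNIV. sesq C (e a) (e b) * sesq B (e b) (e a))"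
proof -
  define E where "E = (\<chi> a \<alpha>. e a $ \<alpha>)"
  define F where "F = (\<chi> \<alpha> a. cnj (e a $ \<alpha>))"
  have EBF: "(E ** B ** F) $ a $ b = sesq B (e a) (e b)" for B a b
  proof -
    have "(E ** B ** F) $ a $ b = (\<Sum>\<beta>\<in>UNIV. \<Sum>\<alpha>\<in>UNIV. e a $ \<alpha> * B $ \<alpha> $ \<beta> * cnj (e b $ \<beta>))"
      by (simp add: E_def F_def matrix_matrix_mult_def sum_distrib_right)
    also have "\<dots> = sesq B (e a) (e b)"
      by (subst sum.swap) (simp add: sesq_def mult_ac)
    finally show ?thesis .
  qed
  have "E ** A ** F = mat 1" by (simp add: vec_eq_iff EBF e mat_def)
  then have "A ** F ** E = mat 1"
    by (metis matrix_left_right_inverse matrix_mul_assoc)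
  then have N: "matrix_inv A = F ** E" by (intro matrix_inv_eqI) (simp add: matrix_mul_assoc)
  have "trace (matrix_inv A ** B) = trace (E ** B ** F)"
    by (metis N matrix_mul_assoc trace_mul_sym)
  then show "trace (matrix_inv A ** B) = (\<Sum>a\<in>UNIV. sesq B (e a) (e a))"
    by (simp add: trace_def EBF)
  have "trace (matrix_inv A ** C ** matrix_inv A ** B) = trace (F ** (E ** C ** F ** E ** B))"
    by (simp add: N matrix_mul_assoc)
  also have "\<dots> = trace ((E ** C ** F ** E ** B) ** F)" by (rule trace_mul_sym)
  also have "\<dots> = trace ((E ** C ** F) ** (E ** B ** F))"
    by (simp add: matrix_mul_assoc)
  also have "\<dots> = (\<Sum>a\<in>UNIV. \<Sum>b\<in>UNIV. sesq C (e a) (e b) * sesq B (e b) (e a))"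
    by (simp add: trace_mult_sum EBF)
  finally show "trace (matrix_inv A ** C ** matrix_inv A ** B) =
      (\<Sum>a\<in>UNIV. \<Sum>b\<in>UNIV. sesq C (e a) (e b) * sesq B (e b) (e a))" .
qed

subsection \<open>Derivatives of determinants and inverse matrices\<close>

definition mder :: "'a::real_normed_vector \<times> 'a \<Rightarrow> ('a \<Rightarrow> complex^'m^'m) \<Rightarrow> 'a \<Rightarrow> complex^'m^'m::finite" where
  "mder X G x = (\<chi> i j. cder X (\<lambda>y. G y $ i $ j) x)"

definition mCinf_on :: "'a::euclidean_space set \<Rightarrow> ('a \<Rightarrow> complex^'m^'m::finite) \<Rightarrow> bool" where
  "mCinf_on U G \<longleftrightarrow> (\<forall>i j. Cinf_on U (\<lambda>x. G x $ i $ j))"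

lemma mCinf_on_entry: "mCinf_on U G \<Longrightarrow> Cinf_on U (\<lambda>x. G x $ i $ j)"
  by (simp add: mCinf_on_def)

context open_domain
begin

lemma cder_prod:
  assumes "finite I" "\<And>i. i \<in> I \<Longrightarrow> Cinf_on W (h i)" "x \<in> W"
  shows "cder X (\<lambda>x. \<Prod>i\<in>I. h i x) x = (\<Sum>i\<in>I. cder X (h i) x * (\<Prod>j\<in>I - {i}. h j x))"
  using assms(1,2)
proof (induction I rule: finite_induct)
  case empty
  then show ?case by simp
next
  case (insert k I)
  have "(\<Sum>i\<in>I. cder X (h i) x * (\<Prod>j\<in>insert k I - {i}. h j x))
      = (\<Sum>i\<in>I. h k x * (cder X (h i) x * (\<Prod>j\<in>I - {i}. h j x)))"
  proof (rule sum.cong[OF refl])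
    fix i assume "i \<in> I"
    then have "insert k I - {i} = insert k (I - {i})" using insert(2) by auto
    then show "cder X (h i) x * (\<Prod>j\<in>insert k I - {i}. h j x)
      = h k x * (cder X (h i) x * (\<Prod>j\<in>I - {i}. h j x))"
      using insert(1,2) by simp
  qed
  moreover have "cder X (\<lambda>x. h k x * (\<Prod>i\<in>I. h i x)) x
      = cder X (h k) x * (\<Prod>i\<in>I. h i x) + h k x * cder X (\<lambda>x. \<Prod>i\<in>I. h i x) x"
    using insert(4) assms(3) by (intro cder_mult) (auto intro: Cinf_prod)
  moreover have "insert k I - {k} = I" using insert(2) by auto
  ultimately show ?case using insert by (simp add: sum_distrib_left)
qed

lemma Cinf_det:
  assumes "mCinf_on W G"
  shows "Cinf_on W (\<lambda>x. det (G x))"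
  unfolding det_def using assms by (auto intro!: Cinf_sum Cinf_mult Cinf_prod simp: mCinf_on_entry)

lemma mCinf_matrix_inv:
  assumes G: "mCinf_on W G" and nz: "\<And>x. x \<in> W \<Longrightarrow> det (G x) \<noteq> 0"
  shows "mCinf_on W (\<lambda>x. matrix_inv (G x))"
  unfolding mCinf_on_def
proof (intro allI)
  fix k j
  have "mCinf_on W (\<lambda>x. \<chi> i l. if l = k then axis j 1 $ i else G x $ i $ l)"
    unfolding mCinf_on_def
  proof (intro allI)
    fix i l
    show "Cinf_on W (\<lambda>x. (\<chi> i l. if l = k then axis j 1 $ i else G x $ i $ l) $ i $ l)"
      using G by (cases "l = k") (simp_all add: mCinf_on_def)
  qed
  then have "Cinf_on W (\<lambda>x. det (\<chi> i l. if l = k then axis j 1 $ i else G x $ i $ l) / det (G x))"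
    using G nz by (intro Cinf_divide Cinf_det)
  then show "Cinf_on W (\<lambda>x. matrix_inv (G x) $ k $ j)"
    by (rule Cinf_on_cong[OF open_W, rotated]) (simp add: matrix_inv_entry nz)
qed

text \<open>Jacobi's formula. In the Leibniz expansion the terms whose factor from row
  \<open>i\<close> is differentiated sum to the determinant with that row replaced by its
  derivative.\<close>

lemma cder_det:
  assumes G: "mCinf_on W G" and nz: "det (G x) \<noteq> 0" and x: "x \<in> W"
  shows "cder X (\<lambda>x. det (G x)) x = det (G x) * trace (matrix_inv (G x) ** mder X G x)"
proof -
  let ?P = "{p. p permutes (UNIV :: 'b set)}"
  have "cder X (\<lambda>x. det (G x)) x
     = (\<Sum>p\<in>?P. of_int (sign p) * (\<Sum>i\<in>UNIV. mder X G x $ i $ p i * (\<Prod>j\<in>UNIV - {i}. G x $ j $ p j)))"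
  proof -
    have "cder X (\<lambda>x. of_int (sign p) * (\<Prod>i\<in>UNIV. G x $ i $ p i)) x
      = of_int (sign p) * (\<Sum>i\<in>UNIV. mder X G x $ i $ p i * (\<Prod>j\<in>UNIV - {i}. G x $ j $ p j))" for p
      by (subst cder_mult) (auto simp: cder_prod mder_def x mCinf_on_entry[OF G] intro!: Cinf_prod)
    then show ?thesis
      unfolding det_def using x by (subst cder_sum) (auto intro!: Cinf_mult Cinf_prod simp: mCinf_on_entry[OF G])
  qed
  also have "\<dots> = (\<Sum>i\<in>UNIV. \<Sum>p\<in>?P. of_int (sign p) * (mder X G x $ i $ p i * (\<Prod>j\<in>UNIV - {i}. G x $ j $ p j)))"
    unfolding sum_distrib_left by (rule sum.swap)
  also have "\<dots> = (\<Sum>i\<in>UNIV. det (\<chi> k j. if k = i then mder X G x $ i $ j else G x $ k $ j))"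
  proof (rule sum.cong[OF refl])
    fix i :: 'b
    have "(\<Prod>k\<in>UNIV. (\<chi> k j. if k = i then mder X G x $ i $ j else G x $ k $ j) $ k $ p k)
        = mder X G x $ i $ p i * (\<Prod>j\<in>UNIV - {i}. G x $ j $ p j)" for p
      by (subst prod.remove[of UNIV i]) (auto intro!: prod.cong)
    then show "(\<Sum>p\<in>?P. of_int (sign p) * (mder X G x $ i $ p i * (\<Prod>j\<in>UNIV - {i}. G x $ j $ p j)))
        = det (\<chi> k j. if k = i then mder X G x $ i $ j else G x $ k $ j)"
      by (simp add: det_def)
  qed
  also have "\<dots> = (\<Sum>i\<in>UNIV. (\<Sum>j\<in>UNIV. mder X G x $ i $ j * matrix_inv (G x) $ j $ i) * det (G x))"
    by (simp add: det_replace_row[OF nz])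
  also have "\<dots> = det (G x) * trace (mder X G x ** matrix_inv (G x))"
    by (simp add: trace_mult_sum sum_distrib_left mult.commute)
  finally show ?thesis by (simp only: trace_mul_sym[of _ "matrix_inv (G x)"])
qed

lemma mder_mult:
  assumes "mCinf_on W G" "mCinf_on W H" "x \<in> W"
  shows "mder X (\<lambda>x. G x ** H x) x = mder X G x ** H x + G x ** mder X H x"
  using assms by (simp add: mder_def matrix_matrix_mult_def vec_eq_iff mCinf_on_entry sum.distrib)

lemma mder_cong: "x \<in> W \<Longrightarrow> (\<And>y. y \<in> W \<Longrightarrow> G y = H y) \<Longrightarrow> mder X G x = mder X H x"
  unfolding mder_def vec_eq_iff vec_lambda_beta by (intro allI cder_cong) simp_all

text \<open>Obtained by differentiating the identity that the inverse times \<open>G\<close> is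
  constant.\<close>

lemma mder_matrix_inv:
  assumes G: "mCinf_on W G" and nz: "\<And>x. x \<in> W \<Longrightarrow> det (G x) \<noteq> 0" and x: "x \<in> W"
  shows "mder X (\<lambda>x. matrix_inv (G x)) x = - (matrix_inv (G x) ** mder X G x ** matrix_inv (G x))"
proof -
  let ?N = "\<lambda>x. matrix_inv (G x)"
  have "mder X (\<lambda>x. ?N x ** G x) x = mder X (\<lambda>x. mat 1) x"
    using nz by (intro mder_cong[OF x]) (simp add: matrix_inv_mult)
  also have "\<dots> = 0" by (simp add: mder_def vec_eq_iff)
  finally have "mder X ?N x ** G x + ?N x ** mder X G x = 0"
    using G nz x by (simp add: mder_mult mCinf_matrix_inv)
  then have "mder X ?N x ** G x = - (?N x ** mder X G x)" by (simp add: add_eq_0_iff2)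
  then have "mder X ?N x ** G x ** ?N x = - (?N x ** mder X G x) ** ?N x" by simp
  moreover have "mder X ?N x ** G x ** ?N x = mder X ?N x"
    by (simp add: matrix_mul_assoc[symmetric] matrix_inv_mult nz x)
  moreover have "- (?N x ** mder X G x) ** ?N x = - (?N x ** mder X G x ** ?N x)"
    by (simp add: matrix_matrix_mult_def vec_eq_iff sum_negf)
  ultimately show ?thesis by simp
qed

lemma cder_trace_inv:
  assumes G: "mCinf_on W G" and nz: "\<And>x. x \<in> W \<Longrightarrow> det (G x) \<noteq> 0" and H: "mCinf_on W H" and x: "x \<in> W"
  shows "cder X (\<lambda>x. trace (matrix_inv (G x) ** H x)) x =
    trace (matrix_inv (G x) ** mder X H x)
    - trace (matrix_inv (G x) ** mder X G x ** matrix_inv (G x) ** H x)"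
proof -
  have N: "mCinf_on W (\<lambda>x. matrix_inv (G x))" using G nz by (rule mCinf_matrix_inv)
  have "cder X (\<lambda>x. trace (matrix_inv (G x) ** H x)) x = trace (mder X (\<lambda>x. matrix_inv (G x) ** H x) x)"
    using N H x by (simp add: trace_def mder_def matrix_matrix_mult_def mCinf_on_entry)
  also have "\<dots> = trace (mder X (\<lambda>x. matrix_inv (G x)) x ** H x) + trace (matrix_inv (G x) ** mder X H x)"
    using N H x by (simp add: mder_mult trace_add)
  finally show ?thesis
    using G nz x
    by (simp add: mder_matrix_inv trace_def matrix_matrix_mult_def sum_negf)
qed

lemma Cinf_trace_inv:
  assumes G: "mCinf_on W G" and nz: "\<And>x. x \<in> W \<Longrightarrow> det (G x) \<noteq> 0" and H: "mCinf_on W H"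
  shows "Cinf_on W (\<lambda>x. trace (matrix_inv (G x) ** H x))"
  using mCinf_matrix_inv[OF G nz] H by (simp add: trace_mult_sum mCinf_on_entry)

end

subsection \<open>Wirtinger derivatives on space-time\<close>

text \<open>Under the convention for pairs these two fields are (v - i J v)/2 and (v + i J v)/2,
  with J the multiplication by the imaginary unit: the (1,0) and (0,1) parts of the spatial vector
  v. Accordingly \<open>pd v\<close> is linear and \<open>pdb v\<close> conjugate linear in
  \<open>v\<close>.\<close>

definition wirt :: "complex^'m \<Rightarrow> ((complex^'m::finite) \<times> real) \<times> ((complex^'m) \<times> real)" where
  "wirt v = (((1/2) *\<^sub>R v, 0), (- (1/2) *\<^sub>R (\<i> *s v), 0))"

definition wirtbar :: "complex^'m \<Rightarrow> ((complex^'m::finite) \<times> real) \<times> ((complex^'m) \<times> real)" where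
  "wirtbar v = (((1/2) *\<^sub>R v, 0), ((1/2) *\<^sub>R (\<i> *s v), 0))"

definition tvec :: "((complex^'m::finite) \<times> real) \<times> ((complex^'m) \<times> real)" where
  "tvec = ((0, 1), 0)"

abbreviation "pd v \<equiv> cder (wirt v)"
abbreviation "pdb v \<equiv> cder (wirtbar v)"
abbreviation "pt \<equiv> cder tvec"

lemma wirt_conj [simp]: "(fst (wirt v), - snd (wirt v)) = wirtbar v" "(fst (wirtbar v), - snd (wirtbar v)) = wirt v"
  "(fst tvec, - snd tvec) = tvec"
  by (simp_all add: wirt_def wirtbar_def tvec_def)

context open_domain
begin

lemma Cinf_divide_const [simp]: "Cinf_on W h \<Longrightarrow> Cinf_on W (\<lambda>x. h x / (c::complex))"
  by (simp add: divide_inverse)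

lemma cder_divide_const [simp]: "Cinf_on W h \<Longrightarrow> x \<in> W \<Longrightarrow> cder X (\<lambda>x. h x / c) x = cder X h x / c"
  by (simp add: divide_inverse)

end

locale spacetime = open_domain W for W :: "((complex^'m::finite) \<times> real) set"
begin

lemma
  assumes h: "Cinf_on W h" and x: "x \<in> W"
  shows pd_frechet: "pd v h x =
      (frechet_derivative h (at x) (v, 0) - \<i> * frechet_derivative h (at x) (\<i> *s v, 0)) / 2"
    and pdb_frechet: "pdb v h x =
      (frechet_derivative h (at x) (v, 0) + \<i> * frechet_derivative h (at x) (\<i> *s v, 0)) / 2"
proof -
  have "linear (frechet_derivative h (at x))"
    using has_derivative_linear[OF Cinf_on_has_derivative[OF h x]] .
  from linear_scale[OF this]
  have l: "frechet_derivative h (at x) (r *\<^sub>R u, 0) = of_real r * frechet_derivative h (at x) (u, 0)" for r u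
    by (metis scaleR_Pair scaleR_conv_of_real scaleR_zero_right)
  show "pd v h x = (frechet_derivative h (at x) (v, 0) - \<i> * frechet_derivative h (at x) (\<i> *s v, 0)) / 2"
    "pdb v h x = (frechet_derivative h (at x) (v, 0) + \<i> * frechet_derivative h (at x) (\<i> *s v, 0)) / 2"
    unfolding cder_def wirt_def wirtbar_def fst_conv snd_conv l by (simp_all add: field_simps)
qed

lemma pd_add: "Cinf_on W h \<Longrightarrow> x \<in> W \<Longrightarrow> pd (u + v) h x = pd u h x + pd v h x"
  using cder_linear(1)[of h x "wirt u" "wirt v"]
  by (simp add: wirt_def scaleR_add_right vector_add_ldistrib)

lemma pdb_add: "Cinf_on W h \<Longrightarrow> x \<in> W \<Longrightarrow> pdb (u + v) h x = pdb u h x + pdb v h x"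
  using cder_linear(1)[of h x "wirtbar u" "wirtbar v"]
  by (simp add: wirtbar_def scaleR_add_right vector_add_ldistrib)

lemma pd_scale:
  assumes "Cinf_on W h" "x \<in> W"
  shows "pd (c *s v) h x = c * pd v h x"
proof -
  have "wirt (c *s v) = (Re c *\<^sub>R fst (wirt v) - Im c *\<^sub>R snd (wirt v), Im c *\<^sub>R fst (wirt v) + Re c *\<^sub>R snd (wirt v))"
    by (simp add: wirt_def vec_eq_iff complex_eq_iff algebra_simps)
  then show ?thesis using cder_linear(2)[OF assms, of "Re c" "wirt v" "Im c"] by simp
qed

lemma pdb_scale:
  assumes "Cinf_on W h" "x \<in> W"
  shows "pdb (c *s v) h x = cnj c * pdb v h x"
proof -
  have "wirtbar (c *s v) = (Re c *\<^sub>R fst (wirtbar v) - (- Im c) *\<^sub>R snd (wirtbar v), (- Im c) *\<^sub>R fst (wirtbar v) + Re c *\<^sub>R snd (wirtbar v))"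
    by (simp add: wirtbar_def vec_eq_iff complex_eq_iff algebra_simps)
  moreover have "Complex (Re c) (- Im c) = cnj c" by (simp add: complex_eq_iff)
  ultimately show ?thesis using cder_linear(2)[OF assms, of "Re c" "wirtbar v" "- Im c"] by simp
qed

lemma pd_0: "Cinf_on W h \<Longrightarrow> x \<in> W \<Longrightarrow> pd 0 h x = 0" and pdb_0: "Cinf_on W h \<Longrightarrow> x \<in> W \<Longrightarrow> pdb 0 h x = 0"
  using pd_scale[of h x 0 0] pdb_scale[of h x 0 0] by simp_all

lemma pd_sum: "Cinf_on W h \<Longrightarrow> x \<in> W \<Longrightarrow> pd (\<Sum>i\<in>I. v i) h x = (\<Sum>i\<in>I. pd (v i) h x)"
  by (induction I rule: infinite_finite_induct) (simp_all add: pd_0 pd_add)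

lemma pdb_sum: "Cinf_on W h \<Longrightarrow> x \<in> W \<Longrightarrow> pdb (\<Sum>i\<in>I. v i) h x = (\<Sum>i\<in>I. pdb (v i) h x)"
  by (induction I rule: infinite_finite_induct) (simp_all add: pdb_0 pdb_add)

lemma pd_expand: "Cinf_on W h \<Longrightarrow> x \<in> W \<Longrightarrow> pd v h x = (\<Sum>\<alpha>\<in>UNIV. v $ \<alpha> * pd (axis \<alpha> 1) h x)"
  using pd_sum[of h x "\<lambda>\<alpha>. v $ \<alpha> *s axis \<alpha> 1" UNIV] by (simp add: basis_expansion pd_scale)

lemma pdb_expand: "Cinf_on W h \<Longrightarrow> x \<in> W \<Longrightarrow> pdb v h x = (\<Sum>\<alpha>\<in>UNIV. cnj (v $ \<alpha>) * pdb (axis \<alpha> 1) h x)"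
  using pdb_sum[of h x "\<lambda>\<alpha>. v $ \<alpha> *s axis \<alpha> 1" UNIV] by (simp add: basis_expansion pdb_scale)

end

section \<open>The minimum principle on space-time\<close>

lemma second_derivative_test:
  fixes h :: "'a::euclidean_space \<Rightarrow> real"
  assumes U: "open U" and h: "Cinf_on U h" and p: "p \<in> U"
    and min: "\<And>s. p + s *\<^sub>R u \<in> U \<Longrightarrow> h (p + s *\<^sub>R u) \<ge> h p"
  shows "frechet_derivative (\<lambda>y. frechet_derivative h (at y) u) (at p) u \<ge> 0"
proof (rule ccontr)
  define k where "k s = h (p + s *\<^sub>R u)" for s
  define k' where "k' s = frechet_derivative h (at (p + s *\<^sub>R u)) u" for s
  have d: "h differentiable (at y)" "(\<lambda>y. frechet_derivative h (at y) u) differentiable (at y)" if "y \<in> U" for y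
    using Cinf_on_differentiable[OF h that] Cinf_on_differentiable[OF Cinf_on_frechet_derivative[OF h] that] .
  have dk: "(k has_real_derivative k' s) (at s)" if "p + s *\<^sub>R u \<in> U" for s
    unfolding k_def k'_def by (rule has_real_derivative_along_line[OF d(1)[OF that]])
  have dk': "(k' has_real_derivative frechet_derivative (\<lambda>y. frechet_derivative h (at y) u) (at p) u) (at 0)"
    using has_real_derivative_along_line[of "\<lambda>y. frechet_derivative h (at y) u" p 0 u] d(2)[OF p]
    unfolding k'_def by simp
  have "open ((\<lambda>s. p + s *\<^sub>R u) -` U)"
    by (intro open_vimage U continuous_intros)
  moreover have "0 \<in> (\<lambda>s. p + s *\<^sub>R u) -` U" using p by simp
  ultimately obtain r where r: "r > 0" "ball 0 r \<subseteq> (\<lambda>s. p + s *\<^sub>R u) -` U" by (meson openE)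
  have inU: "p + s *\<^sub>R u \<in> U" if "\<bar>s\<bar> < r" for s using r(2) that by (auto simp: subset_iff)
  have "k 0 \<le> k s" if "\<bar>0 - s\<bar> < r" for s using min[OF inU] that by (simp add: k_def)
  then have k0: "k' 0 = 0" using DERIV_local_min[OF dk r(1)] p by auto
  assume "\<not> frechet_derivative (\<lambda>y. frechet_derivative h (at y) u) (at p) u \<ge> 0"
  \<comment> \<open>As k'(0) = 0, a negative second derivative makes k' negative just to the right
    of 0 and pushes k below its minimum.\<close>
  then obtain d where d: "d > 0" "\<And>s. s > 0 \<Longrightarrow> s < d \<Longrightarrow> k' s < 0"
    using DERIV_neg_dec_right[OF dk'] k0 by auto
  define s where "s = min d r / 2"
  have s: "s > 0" "s < d" "s < r" using d(1) r(1) by (auto simp: s_def min_def)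
  obtain q where q: "0 < q" "q < s" "k s - k 0 = (s - 0) * k' q"
    using MVT2[OF s(1), of k k'] dk inU s by auto
  have "k' q < 0" using d(2) q s by simp
  then have "k s < k 0" using q(3) s(1) mult_pos_neg[of s "k' q"] by simp
  moreover have "k s \<ge> k 0" using min[OF inU, of s] s by (simp add: k_def)
  ultimately show False by simp
qed

text \<open>Comparison with earlier times makes the time derivative of exp(-t) h nonpositive at the
  point, which reads h_t <= h once the exponential is divided out. In space the ordinary second
  derivative test suffices, since the weight is constant there.\<close>

lemma (in spacetime) weighted_minimum_principle:
  assumes h: "Cinf_on W h" and p: "(z0, t0) \<in> W"
    and min: "\<And>z t. (z, t) \<in> W \<Longrightarrow> t \<le> t0 \<Longrightarrow> exp (- t) * Re (h (z, t)) \<ge> exp (- t0) * Re (h (z0, t0))"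
  shows "Re (pt h (z0, t0)) \<le> Re (h (z0, t0))" and "Re (pd v (pdb v h) (z0, t0)) \<ge> 0"
proof -
  define k where "k y = Re (h y)" for y
  let ?F = "\<lambda>u y. frechet_derivative h (at y) u"
  have k: "Cinf_on W k" unfolding k_def by (rule Cinf_on_bounded_linear_compose[OF open_W bounded_linear_Re h])
  have Fk: "frechet_derivative k (at y) u = Re (?F u y)" if "y \<in> W" for y u
    unfolding k_def using bounded_linear_Re Cinf_on_differentiable[OF h that]
    by (rule frechet_derivative_bounded_linear_compose)
  have FFk: "frechet_derivative (\<lambda>y. frechet_derivative k (at y) u) (at (z0, t0)) v = Re (frechet_derivative (?F u) (at (z0, t0)) v)" for u v
  proof -
    have "frechet_derivative (\<lambda>y. frechet_derivative k (at y) u) (at (z0, t0))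
        = frechet_derivative (\<lambda>y. Re (?F u y)) (at (z0, t0))"
      by (rule frechet_derivative_local[OF open_W p]) (rule Fk)
    then show ?thesis
      using frechet_derivative_bounded_linear_compose[OF bounded_linear_Re
          Cinf_on_differentiable[OF Cinf_on_frechet_derivative[OF h] p]] by simp
  qed
  show "Re (pt h (z0, t0)) \<le> Re (h (z0, t0))"
  proof (rule ccontr)
    assume neg: "\<not> ?thesis"
    have line: "(z0, t0) + r *\<^sub>R (0, 1) = (z0, t0 + r)" for r by simp
    have "((\<lambda>r. k ((z0, t0) + r *\<^sub>R (0, 1))) has_real_derivative frechet_derivative k (at ((z0, t0) + 0 *\<^sub>R (0, 1))) (0, 1)) (at 0)"
      by (rule has_real_derivative_along_line) (use Cinf_on_differentiable[OF k p] in simp)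
    then have dk: "((\<lambda>r. k (z0, t0 + r)) has_real_derivative Re (pt h (z0, t0))) (at 0)"
      using Fk[OF p, of "(0, 1)"] linear_0[OF has_derivative_linear[OF Cinf_on_has_derivative[OF h p]]]
      by (simp add: cder_def tvec_def)
    have "((\<lambda>r. exp (- (t0 + r))) has_real_derivative - exp (- t0)) (at 0)"
      by (auto intro!: derivative_eq_intros)
    from DERIV_mult[OF this dk]
    have "((\<lambda>r. exp (- (t0 + r)) * k (z0, t0 + r)) has_real_derivative exp (- t0) * (Re (pt h (z0, t0)) - k (z0, t0))) (at 0)"
      by (simp add: algebra_simps)
    moreover have "exp (- t0) * (Re (pt h (z0, t0)) - k (z0, t0)) > 0"
      using neg by (simp add: k_def)
    ultimately obtain d where d: "d > 0"
      "\<And>s. s > 0 \<Longrightarrow> s < d \<Longrightarrow> exp (- (t0 - s)) * k (z0, t0 - s) < exp (- t0) * k (z0, t0)"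
      using DERIV_pos_inc_left by fastforce
    have "open ((\<lambda>s. (z0, t0 - s)) -` W)" by (intro open_vimage open_W continuous_intros)
    moreover have "0 \<in> (\<lambda>s. (z0, t0 - s)) -` W" using p by simp
    ultimately obtain r where r: "r > 0" "ball 0 r \<subseteq> (\<lambda>s. (z0, t0 - s)) -` W" by (meson openE)
    define s where "s = min d r / 2"
    have s: "s > 0" "s < d" "s < r" using d(1) r(1) by (auto simp: s_def min_def)
    have "(z0, t0 - s) \<in> W" using r(2) s by (auto simp: subset_iff)
    from min[OF this] d(2)[OF s(1,2)] s(1) show False by (simp add: k_def)
  qed
  have test: "Re (frechet_derivative (?F (u, 0)) (at (z0, t0)) (u, 0)) \<ge> 0" for u
  proof -
    have "frechet_derivative (\<lambda>y. frechet_derivative k (at y) (u, 0)) (at (z0, t0)) (u, 0) \<ge> 0"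
    proof (rule second_derivative_test[OF open_W k p])
      fix s assume "(z0, t0) + s *\<^sub>R (u, 0) \<in> W"
      then show "k (z0, t0) \<le> k ((z0, t0) + s *\<^sub>R (u, 0))"
        using min[of "z0 + s *\<^sub>R u" t0] by (simp add: k_def)
    qed
    then show ?thesis by (simp add: FFk)
  qed
  \<comment> \<open>The mixed derivative is a quarter of the Laplacian on the complex line through
    \<open>v\<close>.\<close>
  have "pd v (pdb v h) (z0, t0) = (frechet_derivative (?F (v, 0)) (at (z0, t0)) (v, 0)
      + frechet_derivative (?F (\<i> *s v, 0)) (at (z0, t0)) (\<i> *s v, 0)) / 4"
  proof -
    let ?X = "((v, 0), 0) :: ((complex^'m) \<times> real) \<times> ((complex^'m) \<times> real)"
    let ?Y = "((\<i> *s v, 0), 0) :: ((complex^'m) \<times> real) \<times> ((complex^'m) \<times> real)"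
    have c1: "cder ((u, 0), 0) g y = frechet_derivative g (at y) (u, 0)" if "Cinf_on W g" "y \<in> W" for u g y
      using has_derivative_linear[OF Cinf_on_has_derivative[OF that]] by (simp add: cder_def linear_0)
    have b: "pdb v g y = (cder ?X g y + \<i> * cder ?Y g y) / 2" and
      a: "pd v g y = (cder ?X g y - \<i> * cder ?Y g y) / 2" if "Cinf_on W g" "y \<in> W" for g y
      using that by (simp_all add: c1 pd_frechet pdb_frechet)
    have "pd v (pdb v h) (z0, t0) = pd v (\<lambda>y. (1/2) * (cder ?X h y + \<i> * cder ?Y h y)) (z0, t0)"
      by (rule cder_cong[OF p]) (simp add: b h)
    also have "\<dots> = (1/2) * (pd v (cder ?X h) (z0, t0) + \<i> * pd v (cder ?Y h) (z0, t0))"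
      using h p by simp
    also have "\<dots> = (cder ?X (cder ?X h) (z0, t0) + cder ?Y (cder ?Y h) (z0, t0)) / 4"
      using h p cder_commute[OF h p, of ?X ?Y] by (simp add: a add_divide_distrib diff_divide_distrib algebra_simps)
    also have "cder ?X (cder ?X h) (z0, t0) = frechet_derivative (?F (v, 0)) (at (z0, t0)) (v, 0)"
      using h p c1 frechet_derivative_local[OF open_W p, of "cder ?X h" "?F (v, 0)"] by simp
    also have "cder ?Y (cder ?Y h) (z0, t0) = frechet_derivative (?F (\<i> *s v, 0)) (at (z0, t0)) (\<i> *s v, 0)"
      using h p c1 frechet_derivative_local[OF open_W p, of "cder ?Y h" "?F (\<i> *s v, 0)"] by simp
    finally show ?thesis .
  qed
  from arg_cong[OF this, of Re] show "Re (pd v (pdb v h) (z0, t0)) \<ge> 0"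
    using test[of v] test[of "\<i> *s v"] by simp
qed

subsection \<open>Pointwise algebra\<close>

text \<open>Let u be the vector with A(z, u) = q(z) for all z. The claim is A(r v - u, r v - u) >=
  0, expanded and divided by r; the trace is the squared norm of q, equal to A(u, u).\<close>

lemma complete_square:
  fixes A :: "complex^'m^'m::finite"
  assumes A: "hermitian_pd A" and r: "r > 0"
  shows "r * Re (sesq A v v) - 2 * Re (\<Sum>\<alpha>\<in>UNIV. v $ \<alpha> * q \<alpha>)
    \<ge> - Re (trace (matrix_inv A ** (\<chi> \<alpha> \<beta>. q \<alpha> * cnj (q \<beta>)))) / r"
proof -
  have herm: "A $ \<beta> $ \<alpha> = cnj (A $ \<alpha> $ \<beta>)" for \<alpha> \<beta>
    using A unfolding hermitian_pd_def by blast
  have nz: "det A \<noteq> 0" by (rule hermitian_pd_det_nonzero[OF A])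
  define y where "y = matrix_inv A *v (\<chi> \<alpha>. q \<alpha>)"
  define u where "u = (\<chi> \<beta>. cnj (y $ \<beta>))"
  have Ay: "A *v y = (\<chi> \<alpha>. q \<alpha>)"
    by (simp add: y_def matrix_vector_mul_assoc matrix_inv_mult[OF nz])
  have "(\<chi> \<beta>. cnj (u $ \<beta>)) = y" by (simp add: u_def vec_eq_iff)
  then have Au: "sesq A z u = (\<Sum>\<alpha>\<in>UNIV. z $ \<alpha> * q \<alpha>)" for z
    by (simp add: sesq_eq_mult Ay)
  have uu: "trace (matrix_inv A ** (\<chi> \<alpha> \<beta>. q \<alpha> * cnj (q \<beta>))) = cnj (sesq A u u)"
    unfolding Au by (simp add: trace_mult_sum u_def y_def matrix_vector_mult_def sum_distrib_left sum_distrib_right mult_ac)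
  have vu: "sesq A u v = cnj (sesq A v u)" by (rule sesq_cnj[OF herm, symmetric])
  let ?z = "of_real r *s v - u"
  have "Re (sesq A ?z ?z) \<ge> 0"
  proof (cases "?z = 0")
    case True
    then show ?thesis by (metis order_refl sesq_0_left zero_complex.sel(1))
  next
    case False
    then show ?thesis using A unfolding hermitian_pd_def by (simp add: less_imp_le)
  qed
  also have "Re (sesq A ?z ?z) = r * (r * Re (sesq A v v) - 2 * Re (sesq A v u) + Re (sesq A u u) / r)"
    using r by (simp add: sesq_diff_left sesq_diff_right sesq_scale_left sesq_scale_right vu field_simps)
  finally have "r * Re (sesq A v v) - 2 * Re (sesq A v u) + Re (sesq A u u) / r \<ge> 0"
    using r by (simp add: zero_le_mult_iff)
  then show ?thesis unfolding Au[of v] uu by simp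
qed

text \<open>Cauchy-Schwarz on the diagonal. This is where the dimension enters, and with it the
  constant m in the final inequality.\<close>

lemma trace_square_bound:
  fixes B :: "'m::finite \<Rightarrow> 'm \<Rightarrow> complex"
  shows "(\<Sum>a\<in>UNIV. Re (B a a))\<^sup>2 \<le> real CARD('m) * (\<Sum>a\<in>UNIV. \<Sum>c\<in>UNIV. (cmod (B a c))\<^sup>2)"
proof -
  have "(\<Sum>a\<in>UNIV. Re (B a a))\<^sup>2 \<le> (\<Sum>a\<in>(UNIV::'m set). 1\<^sup>2) * (\<Sum>a\<in>UNIV. (Re (B a a))\<^sup>2)"
    using Cauchy_Schwarz_ineq_sum[of "\<lambda>_. 1" "\<lambda>a. Re (B a a)" UNIV] by simp
  also have "\<dots> \<le> real CARD('m) * (\<Sum>a\<in>UNIV. \<Sum>c\<in>UNIV. (cmod (B a c))\<^sup>2)"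
  proof -
    have "(Re (B a a))\<^sup>2 \<le> (\<Sum>c\<in>UNIV. (cmod (B a c))\<^sup>2)" for a
    proof -
      have "(Re (B a a))\<^sup>2 \<le> (cmod (B a a))\<^sup>2"
        using abs_Re_le_cmod[of "B a a"] by (metis abs_le_square_iff abs_norm_cancel)
      also have "\<dots> \<le> (\<Sum>c\<in>UNIV. (cmod (B a c))\<^sup>2)" by (rule member_le_sum) auto
      finally show ?thesis .
    qed
    then show ?thesis by (simp add: sum_mono)
  qed
  finally show ?thesis .
qed

text \<open>With \<open>V\<close> the gradient of \<open>log w\<close>, \<open>M\<close> its covariant derivative and \<open>B = w M\<close> the mixed Hessian
  of \<open>log w\<close> times \<open>w\<close>, all terms containing \<open>M\<close> or \<open>V\<close> combine to \<open>|B|\<^sup>2 / w\<close>.\<close>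

lemma pointwise_bound:
  fixes w1 :: "'m::finite \<Rightarrow> complex" and w2 M :: "'m \<Rightarrow> 'm \<Rightarrow> complex" and r :: real
  assumes r: "r > 0" and herm: "\<And>a b. cnj (w2 a b) = w2 b a"
    and V: "\<And>c. V c = cnj (w1 c) / of_real r"
    and M: "\<And>a c. M a c = (w2 a c - w1 a * cnj (w1 c) / of_real r) / of_real r"
    and wt: "wt = (\<Sum>a\<in>UNIV. w2 a a) + of_real r"
    and F: "F = (\<Sum>a\<in>UNIV. Re (w2 a a)) - (\<Sum>a\<in>UNIV. (cmod (w1 a))\<^sup>2) / r"
  defines "Q \<equiv> (\<Sum>c\<in>UNIV. V c * cnj (V c))"
  shows "Re (((\<Sum>a\<in>UNIV. \<Sum>b\<in>UNIV. w2 a b * w2 b a) + wt) - of_real r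
      - 2 * ((\<Sum>c\<in>UNIV. V c * w1 c) - (\<Sum>a\<in>UNIV. \<Sum>c\<in>UNIV. M a c * w2 c a))
      + of_real r * Q + of_real r * (Q - (\<Sum>a\<in>UNIV. \<Sum>c\<in>UNIV. M a c * cnj (M a c)))
      - (\<Sum>a\<in>UNIV. cnj (w1 a) * (\<Sum>c\<in>UNIV. M a c * cnj (V c)) + w1 a * (\<Sum>c\<in>UNIV. V c * cnj (M a c))))
    \<ge> (\<Sum>a\<in>UNIV. Re (w2 a a)) + F\<^sup>2 / (real CARD('m) * r)"
proof -
  define B where "B a c = w2 a c - w1 a * cnj (w1 c) / of_real r" for a c
  have MB: "M a c = B a c / of_real r" for a c by (simp add: M B_def)
  have r0: "complex_of_real r \<noteq> 0" using r by simp
  \<comment> \<open>With this identity the terms in \<open>V\<close> that are free of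
    \<open>M\<close>, namely -2 V(w) and twice w |V|^2, cancel.\<close>
  have rQ: "of_real r * Q = (\<Sum>c\<in>UNIV. V c * w1 c)"
    unfolding Q_def sum_distrib_left using r0 by (intro sum.cong refl) (simp add: V)
  have summand: "Re (2 * (M a c * w2 c a) - of_real r * (M a c * cnj (M a c))
      - (cnj (w1 a) * (M a c * cnj (V c)) + w1 a * (V c * cnj (M a c)))) = (cmod (B a c))\<^sup>2 / r" for a c
  proof -
    let ?x = "w1 a * cnj (w1 c) / of_real r"
    \<comment> \<open>Substituting this leaves |B|^2 and a number minus its own conjugate, which has
      no real part.\<close>
    have eq: "w2 c a = cnj (B a c) + cnj ?x" by (simp add: B_def herm)
    have "2 * (M a c * w2 c a) - of_real r * (M a c * cnj (M a c))
      - (cnj (w1 a) * (M a c * cnj (V c)) + w1 a * (V c * cnj (M a c)))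
      = (B a c * cnj (B a c) + (B a c * cnj ?x - cnj (B a c * cnj ?x))) / of_real r"
      unfolding eq MB V using r0 by (simp add: field_simps)
    moreover have "Re (z - cnj z) = 0" for z by simp
    moreover have "Re (B a c * cnj (B a c)) = (cmod (B a c))\<^sup>2"
      unfolding complex_mult_cnj by (simp add: cmod_power2)
    ultimately show ?thesis by (simp only: Re_divide_of_real plus_complex.sel add_0_right)
  qed
  have "Re (2 * (\<Sum>a\<in>UNIV. \<Sum>c\<in>UNIV. M a c * w2 c a) - of_real r * (\<Sum>a\<in>UNIV. \<Sum>c\<in>UNIV. M a c * cnj (M a c))
      - (\<Sum>a\<in>UNIV. cnj (w1 a) * (\<Sum>c\<in>UNIV. M a c * cnj (V c)) + w1 a * (\<Sum>c\<in>UNIV. V c * cnj (M a c))))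
     = (\<Sum>a\<in>UNIV. \<Sum>c\<in>UNIV. Re (2 * (M a c * w2 c a) - of_real r * (M a c * cnj (M a c))
      - (cnj (w1 a) * (M a c * cnj (V c)) + w1 a * (V c * cnj (M a c)))))"
    by (simp only: sum_distrib_left sum_subtractf sum.distrib Re_sum minus_complex.sel plus_complex.sel)
  also have "\<dots> = (\<Sum>a\<in>UNIV. \<Sum>c\<in>UNIV. (cmod (B a c))\<^sup>2) / r"
    by (simp only: summand sum_divide_distrib)
  finally have main: "Re (2 * (\<Sum>a\<in>UNIV. \<Sum>c\<in>UNIV. M a c * w2 c a) - of_real r * (\<Sum>a\<in>UNIV. \<Sum>c\<in>UNIV. M a c * cnj (M a c))
      - (\<Sum>a\<in>UNIV. cnj (w1 a) * (\<Sum>c\<in>UNIV. M a c * cnj (V c)) + w1 a * (\<Sum>c\<in>UNIV. V c * cnj (M a c))))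
      = (\<Sum>a\<in>UNIV. \<Sum>c\<in>UNIV. (cmod (B a c))\<^sup>2) / r" .
  \<comment> \<open>The squared norm of the mixed Hessian of w is simply discarded as
    nonnegative.\<close>
  have "Re (w2 a b * w2 b a) \<ge> 0" for a b
    unfolding herm[of a b, symmetric] complex_mult_cnj by simp
  then have sq: "Re (\<Sum>a\<in>UNIV. \<Sum>b\<in>UNIV. w2 a b * w2 b a) \<ge> 0" by (simp only: Re_sum sum_nonneg)
  have "F = (\<Sum>a\<in>UNIV. Re (B a a))"
  proof -
    have "Re (w1 a * cnj (w1 a) / of_real r) = (cmod (w1 a))\<^sup>2 / r" for a
      unfolding complex_mult_cnj Re_divide_of_real by (simp add: cmod_power2)
    then show ?thesis by (simp only: F B_def sum_subtractf sum_divide_distrib minus_complex.sel)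
  qed
  then have "F\<^sup>2 / real CARD('m) \<le> (\<Sum>a\<in>UNIV. \<Sum>c\<in>UNIV. (cmod (B a c))\<^sup>2)"
    using trace_square_bound[of B] by (simp add: divide_le_eq mult.commute)
  then have "F\<^sup>2 / real CARD('m) / r \<le> (\<Sum>a\<in>UNIV. \<Sum>c\<in>UNIV. (cmod (B a c))\<^sup>2) / r"
    using r by (intro divide_right_mono) simp_all
  then have bound: "F\<^sup>2 / (real CARD('m) * r) \<le> (\<Sum>a\<in>UNIV. \<Sum>c\<in>UNIV. (cmod (B a c))\<^sup>2) / r" by simp
  let ?S = "\<Sum>a\<in>UNIV. \<Sum>b\<in>UNIV. w2 a b * w2 b a"
  let ?D = "2 * (\<Sum>a\<in>UNIV. \<Sum>c\<in>UNIV. M a c * w2 c a) - of_real r * (\<Sum>a\<in>UNIV. \<Sum>c\<in>UNIV. M a c * cnj (M a c))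
      - (\<Sum>a\<in>UNIV. cnj (w1 a) * (\<Sum>c\<in>UNIV. M a c * cnj (V c)) + w1 a * (\<Sum>c\<in>UNIV. V c * cnj (M a c)))"
  have eq: "(?S + wt) - of_real r
      - 2 * ((\<Sum>c\<in>UNIV. V c * w1 c) - (\<Sum>a\<in>UNIV. \<Sum>c\<in>UNIV. M a c * w2 c a))
      + of_real r * Q + of_real r * (Q - (\<Sum>a\<in>UNIV. \<Sum>c\<in>UNIV. M a c * cnj (M a c)))
      - (\<Sum>a\<in>UNIV. cnj (w1 a) * (\<Sum>c\<in>UNIV. M a c * cnj (V c)) + w1 a * (\<Sum>c\<in>UNIV. V c * cnj (M a c)))
     = ?S + (\<Sum>a\<in>UNIV. w2 a a) + ?D"
    by (simp only: wt right_diff_distrib rQ) (simp add: algebra_simps)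
  have "Re (?S + (\<Sum>a\<in>UNIV. w2 a a) + ?D) = Re ?S + (\<Sum>a\<in>UNIV. Re (w2 a a)) + Re ?D"
    by (simp only: plus_complex.sel Re_sum[of "\<lambda>a. w2 a a"])
  then show ?thesis unfolding eq using main sq bound by linarith
qed

subsection \<open>The evolution inequality\<close>

context spacetime
begin

lemma sesq_mder:
  assumes "mCinf_on W H" "x \<in> W"
  shows "sesq (mder X H x) u v = cder X (\<lambda>y. sesq (H y) u v) x"
  using assms by (simp add: sesq_def mder_def mCinf_on_entry)

lemma Cinf_sesq [simp]: "mCinf_on W H \<Longrightarrow> Cinf_on W (\<lambda>y. sesq (H y) u v)"
  by (simp add: sesq_def mCinf_on_entry)

definition chess :: "((complex^'m) \<times> real \<Rightarrow> complex) \<Rightarrow> (complex^'m) \<times> real \<Rightarrow> complex^'m^'m" where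
  "chess h x = (\<chi> \<alpha> \<beta>. pd (axis \<alpha> 1) (pdb (axis \<beta> 1) h) x)"

lemma mCinf_chess: "Cinf_on W h \<Longrightarrow> mCinf_on W (chess h)"
  by (simp add: mCinf_on_def chess_def)

lemma sesq_chess:
  assumes h: "Cinf_on W h" and x: "x \<in> W"
  shows "sesq (chess h x) u v = pd u (pdb v h) x"
proof -
  have "pd u (pdb v h) x = pd u (\<lambda>y. \<Sum>\<beta>\<in>UNIV. cnj (v $ \<beta>) * pdb (axis \<beta> 1) h y) x"
    by (rule cder_cong[OF x]) (rule pdb_expand[OF h])
  also have "\<dots> = (\<Sum>\<beta>\<in>UNIV. cnj (v $ \<beta>) * pd u (pdb (axis \<beta> 1) h) x)"
    using h x by simp
  also have "\<dots> = (\<Sum>\<beta>\<in>UNIV. \<Sum>\<alpha>\<in>UNIV. chess h x $ \<alpha> $ \<beta> * u $ \<alpha> * cnj (v $ \<beta>))"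
    using h x by (simp add: pd_expand[of _ _ u] chess_def sum_distrib_left mult_ac)
  also have "\<dots> = sesq (chess h x) u v" unfolding sesq_def by (rule sum.swap)
  finally show ?thesis by simp
qed

text \<open>The building blocks of the field \<open>V\<close>: functions that are holomorphic in
  space and constant in time.\<close>

lemma complex_linear_coordinate:
  assumes L: "\<And>u v. L (u + v) = L u + L v" and "\<And>c v. L (c *s v) = c * L v"
  shows "Cinf_on W (\<lambda>x. L (fst x) - c)"
    and "pd v (\<lambda>x. L (fst x) - c) x = L v"
    and "pdb v (\<lambda>x. L (fst x) - c) x = 0"
    and "pt (\<lambda>x. L (fst x) - c) x = 0"
proof -
  have vsc: "r *\<^sub>R v = of_real r *s v" for r and v :: "complex^'m"
  proof (subst vec_eq_iff, intro allI)
    fix i show "(r *\<^sub>R v) $ i = (of_real r *s v) $ i"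
      unfolding vector_scaleR_component vector_smult_component by (rule scaleR_conv_of_real)
  qed
  have sc: "L (r *\<^sub>R v) = of_real r * L v" for r v
    unfolding vsc by (rule assms(2))
  have "linear L" using L sc by (intro linearI) (simp_all add: scaleR_conv_of_real)
  then have "bounded_linear L" by (rule linear_conv_bounded_linear[THEN iffD1])
  then have bl: "bounded_linear (\<lambda>x::(complex^'m) \<times> real. L (fst x))"
    by (rule bounded_linear_compose) (rule bounded_linear_fst)
  show "Cinf_on W (\<lambda>x. L (fst x) - c)"
    using Cinf_on_bounded_linear[OF bl] by simp
  have D: "((\<lambda>x. L (fst x) - c) has_derivative (\<lambda>y. L (fst y))) (at x)"
    using has_derivative_diff[OF bounded_linear.has_derivative[OF bl has_derivative_ident] has_derivative_const[of c]]
    by simp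
  have L0: "L 0 = 0" using assms(2)[of 0 0] by simp
  show "pd v (\<lambda>x. L (fst x) - c) x = L v" "pdb v (\<lambda>x. L (fst x) - c) x = 0" "pt (\<lambda>x. L (fst x) - c) x = 0"
    unfolding cder_has_derivative[OF D] wirt_def wirtbar_def tvec_def fst_conv snd_conv sc
    by (simp_all add: L0 assms(2))
qed

end

text \<open>The flow in one chart, stripped of manifold notions. \<open>ricci_axis\<close> is Ric =
  g + hess w with a minus sign on both sides: the trace inside is the first derivative of log det g
  by Jacobi's formula, and one more derivative gives minus the Ricci tensor.\<close>

locale evolving_metric = spacetime W for W :: "((complex^'m::finite) \<times> real) set" +
  fixes G :: "(complex^'m) \<times> real \<Rightarrow> complex^'m^'m"
    and w :: "(complex^'m) \<times> real \<Rightarrow> complex"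
  assumes G_smooth: "mCinf_on W G"
    and w_smooth: "Cinf_on W w"
    and w_real: "x \<in> W \<Longrightarrow> w x \<in> \<real>"
    and w_pos: "x \<in> W \<Longrightarrow> Re (w x) > 0"
    and G_pd: "x \<in> W \<Longrightarrow> hermitian_pd (G x)"
    and kaehler_axis: "x \<in> W \<Longrightarrow>
      pd (axis \<gamma> 1) (\<lambda>y. G y $ \<alpha> $ \<beta>) x = pd (axis \<alpha> 1) (\<lambda>y. G y $ \<gamma> $ \<beta>) x"
    and G_t_axis: "x \<in> W \<Longrightarrow> pt (\<lambda>y. G y $ \<alpha> $ \<beta>) x = - chess w x $ \<alpha> $ \<beta>"
    and w_t: "x \<in> W \<Longrightarrow> pt w x = trace (matrix_inv (G x) ** chess w x) + w x"
    and ricci_axis: "x \<in> W \<Longrightarrow>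
      pd (axis \<alpha> 1) (\<lambda>y. trace (matrix_inv (G y) ** mder (wirtbar (axis \<beta> 1)) G y)) x =
        - G x $ \<alpha> $ \<beta> - chess w x $ \<alpha> $ \<beta>"
begin

definition grad2 :: "(complex^'m) \<times> real \<Rightarrow> real" where
  "grad2 x = Re (trace (matrix_inv (G x) ** (\<chi> \<alpha> \<beta>. pd (axis \<alpha> 1) w x * pdb (axis \<beta> 1) w x)))"

definition harnack :: "(complex^'m) \<times> real \<Rightarrow> real" where
  "harnack x = Re (pt w x) - Re (w x) - grad2 x / Re (w x)"

lemmas smooths [simp] = G_smooth w_smooth mCinf_on_entry[OF G_smooth] mCinf_chess[OF w_smooth]

lemma det_nz: "x \<in> W \<Longrightarrow> det (G x) \<noteq> 0"
  by (rule hermitian_pd_det_nonzero[OF G_pd])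

lemma w_of_real: "x \<in> W \<Longrightarrow> w x = of_real (Re (w x))"
  using w_real by simp

lemma cnj_w: "x \<in> W \<Longrightarrow> cnj (w x) = w x"
  using w_real by (simp add: Reals_cnj_iff)

lemma pdb_w: "x \<in> W \<Longrightarrow> pdb v w x = cnj (pd v w x)"
  using cder_cong[of x "\<lambda>y. cnj (w y)" w "wirtbar v"] by (simp add: cnj_w)

lemma cnj_pdb_w: "x \<in> W \<Longrightarrow> cnj (pdb v w x) = pd v w x"
  by (simp add: pdb_w)

lemma hess_herm:
  assumes "x \<in> W"
  shows "cnj (pd u (pdb v w) x) = pd v (pdb u w) x"
proof -
  have "cnj (pd u (pdb v w) x) = pdb u (\<lambda>y. cnj (pdb v w y)) x"
    using assms by simp
  also have "\<dots> = pdb u (pd v w) x" by (rule cder_cong[OF assms]) (rule cnj_pdb_w)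
  also have "\<dots> = pd v (pdb u w) x" using assms by (intro cder_commute) simp_all
  finally show ?thesis .
qed

definition gg :: "complex^'m \<Rightarrow> complex^'m \<Rightarrow> (complex^'m) \<times> real \<Rightarrow> complex" where
  "gg u v x = sesq (G x) u v"

lemma gg_smooth [simp]: "Cinf_on W (gg u v)"
  unfolding gg_def by simp

lemma cnj_gg: "x \<in> W \<Longrightarrow> cnj (gg u v x) = gg v u x"
  unfolding gg_def using G_pd[of x] sesq_cnj[of "G x"] unfolding hermitian_pd_def by blast

lemma sesq_mder_G: "x \<in> W \<Longrightarrow> sesq (mder X G x) u v = cder X (gg u v) x"
  unfolding gg_def by (rule sesq_mder) simp_all

text \<open>Passes from coordinate vectors to arbitrary constant vectors, because the frame chosen
  at the minimum point need not be a coordinate frame.\<close>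

lemma kaehler:
  assumes x: "x \<in> W"
  shows "pd c (gg a b) x = pd a (gg c b) x"
proof -
  have D: "pd c (gg a b) x = (\<Sum>\<alpha>\<in>UNIV. \<Sum>\<beta>\<in>UNIV. \<Sum>\<gamma>\<in>UNIV.
      c $ \<gamma> * a $ \<alpha> * cnj (b $ \<beta>) * pd (axis \<gamma> 1) (\<lambda>y. G y $ \<alpha> $ \<beta>) x)" for a c
    unfolding sesq_mder_G[OF x, symmetric] sesq_def mder_def using x
    by (simp add: pd_expand[of _ _ c] sum_distrib_left sum_distrib_right mult_ac)
  have "pd c (gg a b) x = (\<Sum>\<alpha>\<in>UNIV. \<Sum>\<gamma>\<in>UNIV. \<Sum>\<beta>\<in>UNIV.
      c $ \<gamma> * a $ \<alpha> * cnj (b $ \<beta>) * pd (axis \<gamma> 1) (\<lambda>y. G y $ \<alpha> $ \<beta>) x)"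
    unfolding D by (intro sum.cong[OF refl] sum.swap)
  also have "\<dots> = (\<Sum>\<gamma>\<in>UNIV. \<Sum>\<alpha>\<in>UNIV. \<Sum>\<beta>\<in>UNIV.
      c $ \<gamma> * a $ \<alpha> * cnj (b $ \<beta>) * pd (axis \<gamma> 1) (\<lambda>y. G y $ \<alpha> $ \<beta>) x)"
    by (rule sum.swap)
  also have "\<dots> = (\<Sum>\<gamma>\<in>UNIV. \<Sum>\<beta>\<in>UNIV. \<Sum>\<alpha>\<in>UNIV.
      c $ \<gamma> * a $ \<alpha> * cnj (b $ \<beta>) * pd (axis \<gamma> 1) (\<lambda>y. G y $ \<alpha> $ \<beta>) x)"
    by (intro sum.cong[OF refl] sum.swap)
  also have "\<dots> = pd a (gg c b) x"
    unfolding D by (intro sum.cong refl) (simp add: kaehler_axis[OF x] mult_ac)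
  finally show ?thesis .
qed

lemma pdb_gg:
  assumes x: "x \<in> W"
  shows "pdb c (gg a b) x = cnj (pd c (gg b a) x)"
proof -
  have "pdb c (gg a b) x = pdb c (\<lambda>y. cnj (gg b a y)) x"
    by (rule cder_cong[OF x]) (simp add: cnj_gg)
  then show ?thesis using x by simp
qed

lemma kaehler_bar: "x \<in> W \<Longrightarrow> pdb c (gg a b) x = pdb b (gg a c) x"
  by (simp add: pdb_gg kaehler)

lemma pt_gg: 
  assumes x: "x \<in> W"
  shows "pt (gg a b) x = - pd a (pdb b w) x"
proof -
  have "mder tvec G x = - chess w x" by (simp add: mder_def vec_eq_iff G_t_axis[OF x])
  then have "pt (gg a b) x = sesq (- chess w x) a b" using sesq_mder_G[OF x, of tvec a b] by simp
  also have "\<dots> = - sesq (chess w x) a b" by (simp add: sesq_def sum_negf)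
  finally show ?thesis by (simp add: sesq_chess x)
qed

text \<open>Both sides are linear in \<open>a\<close> and conjugate linear in \<open>b\<close>, so
  the coordinate version \<open>ricci_axis\<close> determines them.\<close>

lemma ricci_frame:
  assumes x: "x \<in> W"
  shows "pd a (\<lambda>y. trace (matrix_inv (G y) ** mder (wirtbar b) G y)) x = - gg a b x - pd a (pdb b w) x"
proof -
  let ?T = "\<lambda>b y. trace (matrix_inv (G y) ** mder (wirtbar b) G y)"
  have mG: "mCinf_on W (mder X G)" for X by (simp add: mCinf_on_def mder_def)
  have T: "Cinf_on W (?T b)" for b by (rule Cinf_trace_inv[OF G_smooth det_nz mG])
  have "pd a (?T b) x = pd a (\<lambda>y. \<Sum>\<beta>\<in>UNIV. cnj (b $ \<beta>) * ?T (axis \<beta> 1) y) x"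
  proof (rule cder_cong[OF x])
    fix y assume y: "y \<in> W"
    have "?T b y = (\<Sum>i\<in>UNIV. \<Sum>j\<in>UNIV. \<Sum>\<beta>\<in>UNIV.
        cnj (b $ \<beta>) * (matrix_inv (G y) $ i $ j * mder (wirtbar (axis \<beta> 1)) G y $ j $ i))"
      using y by (simp add: trace_mult_sum mder_def pdb_expand[of _ _ b] sum_distrib_left mult_ac)
    also have "\<dots> = (\<Sum>i\<in>UNIV. \<Sum>\<beta>\<in>UNIV. \<Sum>j\<in>UNIV.
        cnj (b $ \<beta>) * (matrix_inv (G y) $ i $ j * mder (wirtbar (axis \<beta> 1)) G y $ j $ i))"
      by (intro sum.cong[OF refl] sum.swap)
    also have "\<dots> = (\<Sum>\<beta>\<in>UNIV. \<Sum>i\<in>UNIV. \<Sum>j\<in>UNIV.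
        cnj (b $ \<beta>) * (matrix_inv (G y) $ i $ j * mder (wirtbar (axis \<beta> 1)) G y $ j $ i))"
      by (rule sum.swap)
    finally show "?T b y = (\<Sum>\<beta>\<in>UNIV. cnj (b $ \<beta>) * ?T (axis \<beta> 1) y)"
      by (simp add: trace_mult_sum sum_distrib_left)
  qed
  also have "\<dots> = (\<Sum>\<beta>\<in>UNIV. cnj (b $ \<beta>) * pd a (?T (axis \<beta> 1)) x)"
    using T x by simp
  also have "\<dots> = (\<Sum>\<beta>\<in>UNIV. \<Sum>\<alpha>\<in>UNIV. (- G x $ \<alpha> $ \<beta> - chess w x $ \<alpha> $ \<beta>) * a $ \<alpha> * cnj (b $ \<beta>))"
    using T x by (simp add: pd_expand[of _ _ a] ricci_axis sum_distrib_left mult_ac)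
  also have "\<dots> = sesq (- G x - chess w x) a b"
    unfolding sesq_def by (subst sum.swap) simp
  also have "\<dots> = - gg a b x - sesq (chess w x) a b"
    by (simp add: gg_def sesq_def left_diff_distrib sum_subtractf sum_negf)
  finally show ?thesis by (simp add: sesq_chess x)
qed

end

section \<open>Computation at a minimum point, in a constant frame that is unitary there\<close>

context evolving_metric
begin

text \<open>The frame is unitary at \<open>p\<close> only; the second sum accounts for the change of
  the inverse metric near \<open>p\<close>.\<close>

lemma cder_trace_frame:
  fixes e :: "'m \<Rightarrow> complex^'m"
  assumes p: "p \<in> W" and e: "\<And>a b. sesq (G p) (e a) (e b) = (if a = b then 1 else 0)"
    and H: "mCinf_on W H"
  shows "cder X (\<lambda>x. trace (matrix_inv (G x) ** H x)) p =
    (\<Sum>a\<in>UNIV. cder X (\<lambda>y. sesq (H y) (e a) (e a)) p)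
    - (\<Sum>a\<in>UNIV. \<Sum>b\<in>UNIV. cder X (gg (e a) (e b)) p * sesq (H p) (e b) (e a))"
  using cder_trace_inv[OF G_smooth det_nz H p, of X]
  by (simp add: trace_unitary_frame[OF e] sesq_mder[OF H p] sesq_mder_G[OF p])

text \<open>The comparison F_V >= F. It is pointwise, so a constant vector suffices: it will be the
  value of \<open>V\<close> at the point.\<close>

lemma test_function_bound:
  assumes x: "x \<in> W"
  shows "Re (pt w x - w x - 2 * pd v w x + w x * gg v v x) \<ge> harnack x"
proof -
  have "Re (w x) * Re (sesq (G x) v v) - 2 * Re (\<Sum>\<alpha>\<in>UNIV. v $ \<alpha> * pd (axis \<alpha> 1) w x) \<ge> - grad2 x / Re (w x)"
    using complete_square[OF G_pd[OF x] w_pos[OF x], where v = v and q = "\<lambda>\<alpha>. pd (axis \<alpha> 1) w x"]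
    by (simp add: grad2_def pdb_w[OF x])
  moreover have "(\<Sum>\<alpha>\<in>UNIV. v $ \<alpha> * pd (axis \<alpha> 1) w x) = pd v w x"
    by (rule pd_expand[symmetric, OF w_smooth x])
  moreover have "Re (w x * gg v v x) = Re (w x) * Re (sesq (G x) v v)"
    unfolding gg_def by (subst w_of_real[OF x]) (simp del: of_real_Re)
  ultimately show ?thesis by (simp only: harnack_def) simp
qed

lemma grad2_frame:
  fixes e :: "'m \<Rightarrow> complex^'m"
  assumes p: "p \<in> W" and e: "\<And>a b. sesq (G p) (e a) (e b) = (if a = b then 1 else 0)"
  shows "grad2 p = (\<Sum>a\<in>UNIV. (cmod (pd (e a) w p))\<^sup>2)"
proof -
  have "sesq (\<chi> \<alpha> \<beta>. pd (axis \<alpha> 1) w p * pdb (axis \<beta> 1) w p) u v = pd u w p * pdb v w p" for u v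
    using p by (simp add: sesq_def pd_expand[of _ _ u] pdb_expand[of _ _ v] sum_product mult_ac)
  moreover have "Re (z * cnj z) = (cmod z)\<^sup>2" for z
    unfolding complex_mult_cnj by (simp add: cmod_power2)
  ultimately show ?thesis
    unfolding grad2_def trace_unitary_frame[OF e] by (simp only: pdb_w[OF p] Re_sum)
qed

text \<open>The maximum principle of the overview within one chart. Since \<open>min\<close>
  compares only with times up to \<open>t0\<close>, the point may lie at the last time of the
  minimization, while openness of \<open>W\<close> still provides two-sided derivatives
  there.\<close>

theorem harnack_minimum:
  assumes p: "(z0, t0) \<in> W" and after: "\<And>z t. (z, t) \<in> W \<Longrightarrow> \<epsilon> < t"
    and min: "\<And>z t. (z, t) \<in> W \<Longrightarrow> t \<le> t0 \<Longrightarrow>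
      exp (- t) * ((t - \<epsilon>) * harnack (z, t) + real CARD('m) * Re (w (z, t)))
      \<ge> exp (- t0) * ((t0 - \<epsilon>) * harnack (z0, t0) + real CARD('m) * Re (w (z0, t0)))"
  shows "(t0 - \<epsilon>) * harnack (z0, t0) + real CARD('m) * Re (w (z0, t0)) \<ge> 0"
proof -
  define p where "p = (z0, t0)"
  have pW: "p \<in> W" using p by (simp add: p_def)
  obtain e :: "'m \<Rightarrow> complex^'m" where e: "\<And>a b. sesq (G p) (e a) (e b) = (if a = b then 1 else 0)"
    using unitary_frame_exists[OF G_pd[OF pW]] by blast
  define r where "r = Re (w p)"
  have wp: "w p = of_real r" using w_of_real[OF pW] by (simp add: r_def)
  have r: "r > 0" using w_pos[OF pW] by (simp add: r_def)
  have gp: "gg (e a) (e b) p = (if a = b then 1 else 0)" for a b by (simp add: gg_def e)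
  define w1 where "w1 a = pd (e a) w p" for a
  define w2 where "w2 a b = pd (e a) (pdb (e b) w) p" for a b
  define w3 where "w3 c a = pd (e c) (pd (e a) (pdb (e a) w)) p" for c a
  \<comment> \<open>For a constant frame unitary at \<open>p\<close> these are the Christoffel
    symbols at \<open>p\<close>.\<close>
  define \<Gamma> where "\<Gamma> c a b = pd (e c) (gg (e a) (e b)) p" for c a b
  have \<Gamma>_sym: "\<Gamma> c a b = \<Gamma> a c b" for a b c unfolding \<Gamma>_def by (rule kaehler[OF pW])
  have \<Gamma>_bar: "pdb (e c) (gg (e a) (e b)) p = cnj (\<Gamma> c b a)" for a b c
    unfolding \<Gamma>_def by (rule pdb_gg[OF pW])
  \<comment> \<open>Components of the gradient of log w; raising the index in a unitary frame
    amounts to a conjugation, as w is real.\<close>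
  define V0 where "V0 c = cnj (w1 c) / of_real r" for c
  define M where "M a c = (w2 a c - w1 a * cnj (w1 c) / of_real r) / of_real r" for a c
  define \<Theta> where "\<Theta> a c = (\<Sum>d\<in>UNIV. V0 d * \<Gamma> a d c)" for a c
  \<comment> \<open>\<open>\<Theta>\<close> is the Christoffel term of the covariant derivative of \<open>V\<close>, so \<open>U\<close> makes that derivative equal to \<open>M\<close>.\<close>
  define U where "U a c = M a c - \<Theta> a c" for a c
  \<comment> \<open>Linear coordinates dual to the frame and centred at \<open>z0\<close>. With them
    \<open>V c\<close> below has value \<open>V0 c\<close> at \<open>p\<close> and derivative
    \<open>U a c\<close> along \<open>e a\<close>.\<close>
  define \<zeta> where "\<zeta> b x = sesq (G p) (fst x) (e b) - sesq (G p) z0 (e b)" for b and x :: "(complex^'m) \<times> real"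
  have \<zeta>: "Cinf_on W (\<zeta> b)" "pd (e a) (\<zeta> b) x = (if a = b then 1 else 0)" "pdb (e a) (\<zeta> b) x = 0"
    "pt (\<zeta> b) x = 0" "\<zeta> b p = 0" for a b x
    unfolding \<zeta>_def
    using complex_linear_coordinate[where L = "\<lambda>u. sesq (G p) u (e b)", OF sesq_add_left sesq_scale_left]
    by (simp_all add: e[unfolded p_def] p_def)
  define V where "V c x = V0 c + (\<Sum>b\<in>UNIV. U b c * \<zeta> b x)" for c x
  have V: "Cinf_on W (V c)" "V c p = V0 c" for c
    unfolding V_def using \<zeta> by simp_all
  have dV: "pd (e a) (V c) x = U a c" "pdb (e a) (V c) x = 0" "pt (V c) x = 0" if "x \<in> W" for a c x
    unfolding V_def using \<zeta> that by (simp_all add: if_distrib[of "\<lambda>y. _ * y"] cong: if_cong)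
  note [simp] = V

  have w_t_p: "pt w p = (\<Sum>a\<in>UNIV. w2 a a) + of_real r"
    unfolding w_t[OF pW] trace_unitary_frame[OF e] w2_def by (simp add: sesq_chess pW wp)
  \<comment> \<open>The differentiated equation for w, for any field \<open>X\<close>: it is needed
    along each frame vector and in time.\<close>
  have DW: "cder X (pt w) p = (\<Sum>a\<in>UNIV. cder X (pd (e a) (pdb (e a) w)) p)
      - (\<Sum>a\<in>UNIV. \<Sum>b\<in>UNIV. cder X (gg (e a) (e b)) p * w2 b a) + cder X w p" for X
  proof -
    have "cder X (pt w) p = cder X (\<lambda>x. trace (matrix_inv (G x) ** chess w x) + w x) p"
      by (rule cder_cong[OF pW]) (rule w_t)
    also have "\<dots> = cder X (\<lambda>x. trace (matrix_inv (G x) ** chess w x)) p + cder X w p"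
      by (rule cder_add[OF Cinf_trace_inv[OF G_smooth det_nz] _ pW]) simp_all
    also have "cder X (\<lambda>x. trace (matrix_inv (G x) ** chess w x)) p =
        (\<Sum>a\<in>UNIV. cder X (\<lambda>y. sesq (chess w y) (e a) (e a)) p)
      - (\<Sum>a\<in>UNIV. \<Sum>b\<in>UNIV. cder X (gg (e a) (e b)) p * w2 b a)"
      by (subst cder_trace_frame[OF pW e]) (simp_all add: sesq_chess pW w2_def)
    also have "(\<Sum>a\<in>UNIV. cder X (\<lambda>y. sesq (chess w y) (e a) (e a)) p)
      = (\<Sum>a\<in>UNIV. cder X (pd (e a) (pdb (e a) w)) p)"
      by (intro sum.cong refl cder_cong[OF pW]) (simp add: sesq_chess)
    finally show ?thesis .
  qed
  have wc: "pd (e c) (pt w) p = (\<Sum>a\<in>UNIV. w3 c a) - (\<Sum>a\<in>UNIV. \<Sum>b\<in>UNIV. \<Gamma> c a b * w2 b a) + w1 c" for c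
    unfolding DW w3_def \<Gamma>_def w1_def ..
  \<comment> \<open>As g moves by minus the Hessian of w, differentiating the inverse metric in the
    Laplacian adds the squared norm of that Hessian.\<close>
  have wtt: "pt (pt w) p = (\<Sum>a\<in>UNIV. pd (e a) (pdb (e a) (pt w)) p) + (\<Sum>a\<in>UNIV. \<Sum>b\<in>UNIV. w2 a b * w2 b a) + pt w p"
  proof -
    have "pt (pd (e a) (pdb (e a) w)) p = pd (e a) (pdb (e a) (pt w)) p" for a
    proof -
      have "pt (pd (e a) (pdb (e a) w)) p = pd (e a) (pt (pdb (e a) w)) p"
        using pW by (intro cder_commute) simp_all
      also have "\<dots> = pd (e a) (pdb (e a) (pt w)) p"
        by (rule cder_cong[OF pW]) (rule cder_commute[OF w_smooth])
      finally show ?thesis .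
    qed
    moreover have "pt (gg (e a) (e b)) p = - w2 a b" for a b by (simp add: pt_gg pW w2_def)
    ultimately show ?thesis unfolding DW by (simp add: sum_negf)
  qed

  \<comment> \<open>This is V(w), and \<open>Q\<close> below is the squared norm of V.\<close>
  define Y where "Y x = (\<Sum>c\<in>UNIV. V c x * pd (e c) w x)" for x
  have Y [simp]: "Cinf_on W Y" unfolding Y_def by simp
  have Y_t: "pt Y p = (\<Sum>c\<in>UNIV. V0 c * pd (e c) (pt w) p)"
    unfolding Y_def using pW by (simp add: dV cder_commute[OF w_smooth pW, of tvec])
  \<comment> \<open>Since V is holomorphic, the antiholomorphic derivative falls on w alone; neither
    second derivatives of V nor the pure Hessian of w appear.\<close>
  have Y_2: "pd (e a) (pdb (e a) Y) p = (\<Sum>c\<in>UNIV. U a c * w2 c a + V0 c * w3 c a)" for a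
  proof -
    have eq: "pd (e a) (pd (e c) (pdb (e a) w)) p = w3 c a" for c
      unfolding w3_def using pW by (intro cder_commute) simp_all
    have "pd (e a) (pdb (e a) Y) p = pd (e a) (\<lambda>x. \<Sum>c\<in>UNIV. V c x * pd (e c) (pdb (e a) w) x) p"
      unfolding Y_def
      by (rule cder_cong[OF pW]) (simp add: dV cder_commute[OF w_smooth, of _ "wirtbar (e a)"])
    also have "\<dots> = (\<Sum>c\<in>UNIV. U a c * w2 c a + V0 c * pd (e a) (pd (e c) (pdb (e a) w)) p)"
      using pW by (simp add: dV w2_def)
    finally show ?thesis by (simp only: eq)
  qed
  \<comment> \<open>The third derivatives of w cancel. The Christoffel term from differentiating the
    Laplacian completes \<open>U\<close> to \<open>M\<close>.\<close>
  have heat_Y: "pt Y p - (\<Sum>a\<in>UNIV. pd (e a) (pdb (e a) Y) p)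
      = (\<Sum>c\<in>UNIV. V0 c * w1 c) - (\<Sum>a\<in>UNIV. \<Sum>c\<in>UNIV. M a c * w2 c a)"
  proof -
    have 1: "(\<Sum>c\<in>UNIV. V0 c * (\<Sum>a\<in>UNIV. \<Sum>b\<in>UNIV. \<Gamma> c a b * w2 b a)) = (\<Sum>a\<in>UNIV. \<Sum>b\<in>UNIV. \<Theta> a b * w2 b a)"
    proof -
      have "(\<Sum>c\<in>UNIV. V0 c * (\<Sum>a\<in>UNIV. \<Sum>b\<in>UNIV. \<Gamma> c a b * w2 b a))
          = (\<Sum>c\<in>UNIV. \<Sum>a\<in>UNIV. \<Sum>b\<in>UNIV. V0 c * \<Gamma> a c b * w2 b a)"
        by (simp add: sum_distrib_left \<Gamma>_sym mult_ac)
      also have "\<dots> = (\<Sum>a\<in>UNIV. \<Sum>c\<in>UNIV. \<Sum>b\<in>UNIV. V0 c * \<Gamma> a c b * w2 b a)" by (rule sum.swap)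
      also have "\<dots> = (\<Sum>a\<in>UNIV. \<Sum>b\<in>UNIV. \<Sum>c\<in>UNIV. V0 c * \<Gamma> a c b * w2 b a)"
        by (intro sum.cong[OF refl] sum.swap)
      finally show ?thesis by (simp add: \<Theta>_def sum_distrib_right)
    qed
    have 2: "(\<Sum>c\<in>UNIV. V0 c * (\<Sum>a\<in>UNIV. w3 c a)) = (\<Sum>a\<in>UNIV. \<Sum>c\<in>UNIV. V0 c * w3 c a)"
      by (simp add: sum_distrib_left) (rule sum.swap)
    have "pt Y p = (\<Sum>a\<in>UNIV. \<Sum>c\<in>UNIV. V0 c * w3 c a) - (\<Sum>a\<in>UNIV. \<Sum>b\<in>UNIV. \<Theta> a b * w2 b a) + (\<Sum>c\<in>UNIV. V0 c * w1 c)"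
      unfolding Y_t wc by (simp only: distrib_left right_diff_distrib sum.distrib sum_subtractf 1 2)
    then show ?thesis
      by (simp add: Y_2 U_def left_diff_distrib sum.distrib sum_subtractf)
  qed

  define Q where "Q x = (\<Sum>b\<in>UNIV. \<Sum>c\<in>UNIV. gg (e b) (e c) x * V b x * cnj (V c x))" for x
  have Q [simp]: "Cinf_on W Q" unfolding Q_def by simp
  have Q_p: "Q p = (\<Sum>c\<in>UNIV. V0 c * cnj (V0 c))"
    unfolding Q_def by (simp add: gp if_distrib[of "\<lambda>y. y * _"] cong: if_cong)
  have Q_t: "pt Q p = - (\<Sum>b\<in>UNIV. \<Sum>c\<in>UNIV. w2 b c * V0 b * cnj (V0 c))"
    unfolding Q_def using pW by (simp add: dV pt_gg w2_def sum_negf)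
  \<comment> \<open>Metric compatibility: the derivatives of g and V combine into the covariant
    derivative \<open>M\<close>, and the conjugate of V is not affected by a holomorphic
    derivative.\<close>
  have Q_1: "pd (e a) Q p = (\<Sum>c\<in>UNIV. M a c * cnj (V0 c))" for a
  proof -
    have "pd (e a) Q p = (\<Sum>b\<in>UNIV. \<Sum>c\<in>UNIV. \<Gamma> a b c * V0 b * cnj (V0 c)) + (\<Sum>b\<in>UNIV. \<Sum>c\<in>UNIV. gg (e b) (e c) p * U a b * cnj (V0 c))"
      unfolding Q_def using pW by (simp add: dV \<Gamma>_def algebra_simps sum.distrib)
    also have "(\<Sum>b\<in>UNIV. \<Sum>c\<in>UNIV. \<Gamma> a b c * V0 b * cnj (V0 c)) = (\<Sum>c\<in>UNIV. \<Theta> a c * cnj (V0 c))"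
      by (subst sum.swap) (simp add: \<Theta>_def sum_distrib_left sum_distrib_right mult_ac)
    also have "(\<Sum>b\<in>UNIV. \<Sum>c\<in>UNIV. gg (e b) (e c) p * U a b * cnj (V0 c)) = (\<Sum>c\<in>UNIV. U a c * cnj (V0 c))"
      by (simp add: gp if_distrib[of "\<lambda>y. y * _"] cong: if_cong)
    finally show ?thesis by (simp add: U_def left_diff_distrib sum_subtractf)
  qed
  have Q_bar: "pdb (e a) Q x = (\<Sum>b\<in>UNIV. \<Sum>c\<in>UNIV. pdb (e a) (gg (e b) (e c)) x * V b x * cnj (V c x))
      + (\<Sum>b\<in>UNIV. \<Sum>c\<in>UNIV. gg (e b) (e c) x * V b x * cnj (U a c))" if "x \<in> W" for a x
    unfolding Q_def using that by (simp add: dV algebra_simps sum.distrib)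
  have Q_1bar: "pdb (e a) Q p = (\<Sum>c\<in>UNIV. V0 c * cnj (M a c))" for a
  proof -
    have "(\<Sum>b\<in>UNIV. \<Sum>c\<in>UNIV. pdb (e a) (gg (e b) (e c)) p * V b p * cnj (V c p)) = (\<Sum>b\<in>UNIV. V0 b * cnj (\<Theta> a b))"
      by (simp add: \<Gamma>_bar \<Theta>_def sum_distrib_left sum_distrib_right mult_ac)
    moreover have "(\<Sum>b\<in>UNIV. \<Sum>c\<in>UNIV. gg (e b) (e c) p * V b p * cnj (U a c)) = (\<Sum>b\<in>UNIV. V0 b * cnj (U a b))"
      by (simp add: gp if_distrib[of "\<lambda>y. y * _"] cong: if_cong)
    ultimately show ?thesis unfolding Q_bar[OF pW] by (simp add: U_def right_diff_distrib sum_subtractf)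
  qed
  \<comment> \<open>The Kaehler symmetry exchanges the pairs of indices, so the Laplacian of a
    component of g becomes second derivatives of diagonal components; these give minus the Ricci
    tensor plus a quadratic term in \<open>\<Gamma>\<close>.\<close>
  have ric: "(\<Sum>a\<in>UNIV. pd (e a) (pdb (e a) (gg (e b) (e c))) p)
      = (\<Sum>a\<in>UNIV. \<Sum>d\<in>UNIV. \<Gamma> a b d * cnj (\<Gamma> a c d)) - (if b = c then 1 else 0) - w2 b c" for b c
  proof -
    have mG: "mCinf_on W (mder X G)" for X by (simp add: mCinf_on_def mder_def)
    have eq: "pd (e b) (\<lambda>y. sesq (mder (wirtbar (e c)) G y) (e a) (e a)) p = pd (e a) (pdb (e a) (gg (e b) (e c))) p" for a
    proof -
      have "pd (e b) (\<lambda>y. sesq (mder (wirtbar (e c)) G y) (e a) (e a)) p = pd (e b) (pdb (e a) (gg (e a) (e c))) p"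
        by (rule cder_cong[OF pW]) (simp add: sesq_mder_G kaehler_bar[of _ "e c" "e a" "e a"])
      also have "\<dots> = pdb (e a) (pd (e b) (gg (e a) (e c))) p" by (rule cder_commute[OF gg_smooth pW])
      also have "\<dots> = pdb (e a) (pd (e a) (gg (e b) (e c))) p" by (rule cder_cong[OF pW]) (rule kaehler)
      also have "\<dots> = pd (e a) (pdb (e a) (gg (e b) (e c))) p" by (rule cder_commute[OF gg_smooth pW])
      finally show ?thesis .
    qed
    have "(\<Sum>a\<in>UNIV. pd (e a) (pdb (e a) (gg (e b) (e c))) p)
      - (\<Sum>a\<in>UNIV. \<Sum>d\<in>UNIV. \<Gamma> b a d * cnj (\<Gamma> c a d)) = - (if b = c then 1 else 0) - w2 b c"
      using ricci_frame[OF pW, of "e b" "e c"] cder_trace_frame[OF pW e mG, of "wirt (e b)" "wirtbar (e c)"]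
      by (simp only: eq sesq_mder_G[OF pW] \<Gamma>_bar \<Gamma>_def[symmetric] gp w2_def)
    then show ?thesis by (simp add: \<Gamma>_sym[of b] \<Gamma>_sym[of c] algebra_simps)
  qed
  have Q_2: "pd (e a) (pdb (e a) Q) p = (\<Sum>b\<in>UNIV. \<Sum>c\<in>UNIV. pd (e a) (pdb (e a) (gg (e b) (e c))) p * (V0 b * cnj (V0 c)))
      + (\<Sum>c\<in>UNIV. U a c * cnj (\<Theta> a c)) + (\<Sum>c\<in>UNIV. \<Theta> a c * cnj (U a c)) + (\<Sum>c\<in>UNIV. U a c * cnj (U a c))" for a
  proof -
    have "pd (e a) (pdb (e a) Q) p = pd (e a) (\<lambda>x. (\<Sum>b\<in>UNIV. \<Sum>c\<in>UNIV. pdb (e a) (gg (e b) (e c)) x * V b x * cnj (V c x))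
      + (\<Sum>b\<in>UNIV. \<Sum>c\<in>UNIV. gg (e b) (e c) x * V b x * cnj (U a c))) p"
      by (rule cder_cong[OF pW]) (rule Q_bar)
    also have "\<dots> = (\<Sum>b\<in>UNIV. \<Sum>c\<in>UNIV. pd (e a) (pdb (e a) (gg (e b) (e c))) p * (V0 b * cnj (V0 c)))
      + (\<Sum>b\<in>UNIV. \<Sum>c\<in>UNIV. cnj (\<Gamma> a c b) * U a b * cnj (V0 c))
      + (\<Sum>b\<in>UNIV. \<Sum>c\<in>UNIV. \<Gamma> a b c * V0 b * cnj (U a c))
      + (\<Sum>b\<in>UNIV. \<Sum>c\<in>UNIV. gg (e b) (e c) p * U a b * cnj (U a c))"
      using pW by (simp add: dV \<Gamma>_bar \<Gamma>_def[symmetric] algebra_simps sum.distrib)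
    also have "(\<Sum>b\<in>UNIV. \<Sum>c\<in>UNIV. cnj (\<Gamma> a c b) * U a b * cnj (V0 c)) = (\<Sum>b\<in>UNIV. U a b * cnj (\<Theta> a b))"
      by (simp add: \<Theta>_def sum_distrib_left sum_distrib_right mult_ac)
    also have "(\<Sum>b\<in>UNIV. \<Sum>c\<in>UNIV. \<Gamma> a b c * V0 b * cnj (U a c)) = (\<Sum>c\<in>UNIV. \<Theta> a c * cnj (U a c))"
      by (subst sum.swap) (simp add: \<Theta>_def sum_distrib_left sum_distrib_right mult_ac)
    also have "(\<Sum>b\<in>UNIV. \<Sum>c\<in>UNIV. gg (e b) (e c) p * U a b * cnj (U a c)) = (\<Sum>c\<in>UNIV. U a c * cnj (U a c))"
      by (simp add: gp if_distrib[of "\<lambda>y. y * _"] cong: if_cong)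
    finally show ?thesis .
  qed
  \<comment> \<open>The Hessian of w enters through the moving metric and through the Ricci tensor
    with opposite signs and drops out. The quadratic terms in \<open>\<Theta>\<close> and
    \<open>U\<close> assemble to the square of \<open>\<Theta> + U = M\<close>.\<close>
  have heat_Q: "pt Q p - (\<Sum>a\<in>UNIV. pd (e a) (pdb (e a) Q) p)
      = (\<Sum>c\<in>UNIV. V0 c * cnj (V0 c)) - (\<Sum>a\<in>UNIV. \<Sum>c\<in>UNIV. M a c * cnj (M a c))"
  proof -
    have "(\<Sum>a\<in>UNIV. \<Sum>b\<in>UNIV. \<Sum>c\<in>UNIV. pd (e a) (pdb (e a) (gg (e b) (e c))) p * (V0 b * cnj (V0 c)))
       = (\<Sum>b\<in>UNIV. \<Sum>a\<in>UNIV. \<Sum>c\<in>UNIV. pd (e a) (pdb (e a) (gg (e b) (e c))) p * (V0 b * cnj (V0 c)))"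
      by (rule sum.swap)
    also have "\<dots> = (\<Sum>b\<in>UNIV. \<Sum>c\<in>UNIV. \<Sum>a\<in>UNIV. pd (e a) (pdb (e a) (gg (e b) (e c))) p * (V0 b * cnj (V0 c)))"
      by (intro sum.cong[OF refl] sum.swap)
    also have "\<dots> = (\<Sum>b\<in>UNIV. \<Sum>c\<in>UNIV. (\<Sum>a\<in>UNIV. \<Sum>d\<in>UNIV. \<Gamma> a b d * cnj (\<Gamma> a c d)) * (V0 b * cnj (V0 c)))
       - (\<Sum>b\<in>UNIV. \<Sum>c\<in>UNIV. (if b = c then 1 else 0) * (V0 b * cnj (V0 c)))
       - (\<Sum>b\<in>UNIV. \<Sum>c\<in>UNIV. w2 b c * (V0 b * cnj (V0 c)))"
      by (simp only: sum_distrib_right[symmetric] ric left_diff_distrib sum_subtractf)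
    also have "(\<Sum>b\<in>UNIV. \<Sum>c\<in>UNIV. (if b = c then 1 else 0) * (V0 b * cnj (V0 c))) = (\<Sum>c\<in>UNIV. V0 c * cnj (V0 c))"
      by (simp add: if_distrib[of "\<lambda>y. y * _"] cong: if_cong)
    also have "(\<Sum>b\<in>UNIV. \<Sum>c\<in>UNIV. (\<Sum>a\<in>UNIV. \<Sum>d\<in>UNIV. \<Gamma> a b d * cnj (\<Gamma> a c d)) * (V0 b * cnj (V0 c)))
       = (\<Sum>a\<in>UNIV. \<Sum>d\<in>UNIV. \<Theta> a d * cnj (\<Theta> a d))"
    proof -
      let ?f = "\<lambda>a b c d. \<Gamma> a b d * cnj (\<Gamma> a c d) * (V0 b * cnj (V0 c))"
      have "(\<Sum>b\<in>UNIV. \<Sum>c\<in>UNIV. (\<Sum>a\<in>UNIV. \<Sum>d\<in>UNIV. \<Gamma> a b d * cnj (\<Gamma> a c d)) * (V0 b * cnj (V0 c)))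
         = (\<Sum>b\<in>UNIV. \<Sum>c\<in>UNIV. \<Sum>a\<in>UNIV. \<Sum>d\<in>UNIV. ?f a b c d)"
        by (simp only: sum_distrib_right)
      also have "\<dots> = (\<Sum>b\<in>UNIV. \<Sum>a\<in>UNIV. \<Sum>c\<in>UNIV. \<Sum>d\<in>UNIV. ?f a b c d)"
        by (intro sum.cong[OF refl] sum.swap)
      also have "\<dots> = (\<Sum>a\<in>UNIV. \<Sum>b\<in>UNIV. \<Sum>c\<in>UNIV. \<Sum>d\<in>UNIV. ?f a b c d)"
        by (rule sum.swap)
      also have "\<dots> = (\<Sum>a\<in>UNIV. \<Sum>b\<in>UNIV. \<Sum>d\<in>UNIV. \<Sum>c\<in>UNIV. ?f a b c d)"
        by (rule sum.cong[OF refl], rule sum.cong[OF refl], rule sum.swap)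
      also have "\<dots> = (\<Sum>a\<in>UNIV. \<Sum>d\<in>UNIV. \<Sum>b\<in>UNIV. \<Sum>c\<in>UNIV. ?f a b c d)"
        by (rule sum.cong[OF refl], rule sum.swap)
      finally show ?thesis
        by (simp add: \<Theta>_def sum_product mult_ac)
    qed
    finally have "(\<Sum>a\<in>UNIV. \<Sum>b\<in>UNIV. \<Sum>c\<in>UNIV. pd (e a) (pdb (e a) (gg (e b) (e c))) p * (V0 b * cnj (V0 c)))
      = (\<Sum>a\<in>UNIV. \<Sum>d\<in>UNIV. \<Theta> a d * cnj (\<Theta> a d)) - (\<Sum>c\<in>UNIV. V0 c * cnj (V0 c))
        - (\<Sum>b\<in>UNIV. \<Sum>c\<in>UNIV. w2 b c * (V0 b * cnj (V0 c)))" .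
    moreover have "(\<Sum>a\<in>UNIV. \<Sum>c\<in>UNIV. M a c * cnj (M a c)) = (\<Sum>a\<in>UNIV. \<Sum>c\<in>UNIV. \<Theta> a c * cnj (\<Theta> a c))
      + (\<Sum>a\<in>UNIV. \<Sum>c\<in>UNIV. U a c * cnj (\<Theta> a c)) + (\<Sum>a\<in>UNIV. \<Sum>c\<in>UNIV. \<Theta> a c * cnj (U a c)) + (\<Sum>a\<in>UNIV. \<Sum>c\<in>UNIV. U a c * cnj (U a c))"
    proof -
      have "M a c = \<Theta> a c + U a c" for a c by (simp add: U_def)
      then show ?thesis by (simp add: algebra_simps sum.distrib)
    qed
    ultimately show ?thesis by (simp add: Q_t Q_2 sum.distrib mult.assoc)
  qed

  \<comment> \<open>This is F_V of the overview, whereas F of the overview is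
    \<open>harnack\<close>. The real part of \<open>Y\<close> is taken only at the end, which keeps
    \<open>F\<close> within the complex calculus.\<close>
  define F where "F x = pt w x - w x - 2 * Y x + w x * Q x" for x
  have F [simp]: "Cinf_on W F" unfolding F_def by simp
  have F_t: "pt F p = pt (pt w) p - pt w p - 2 * pt Y p + pt w p * Q p + of_real r * pt Q p"
    unfolding F_def using pW by (simp add: wp)
  have F_2: "pd (e a) (pdb (e a) F) p = pd (e a) (pdb (e a) (pt w)) p - w2 a a - 2 * pd (e a) (pdb (e a) Y) p
      + w2 a a * Q p + of_real r * pd (e a) (pdb (e a) Q) p + (cnj (w1 a) * pd (e a) Q p + w1 a * pdb (e a) Q p)" for a
  proof -
    have "pd (e a) (pdb (e a) F) p = pd (e a) (\<lambda>x. pdb (e a) (pt w) x - pdb (e a) w x - 2 * pdb (e a) Y x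
       + (pdb (e a) w x * Q x + w x * pdb (e a) Q x)) p"
      unfolding F_def by (rule cder_cong[OF pW]) simp
    then show ?thesis using pW by (simp add: w2_def w1_def pdb_w[OF pW] wp)
  qed
  have heat_F: "pt F p - (\<Sum>a\<in>UNIV. pd (e a) (pdb (e a) F) p) =
      ((\<Sum>a\<in>UNIV. \<Sum>b\<in>UNIV. w2 a b * w2 b a) + pt w p) - of_real r
      - 2 * ((\<Sum>c\<in>UNIV. V0 c * w1 c) - (\<Sum>a\<in>UNIV. \<Sum>c\<in>UNIV. M a c * w2 c a))
      + of_real r * (\<Sum>c\<in>UNIV. V0 c * cnj (V0 c))
      + of_real r * ((\<Sum>c\<in>UNIV. V0 c * cnj (V0 c)) - (\<Sum>a\<in>UNIV. \<Sum>c\<in>UNIV. M a c * cnj (M a c)))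
      - (\<Sum>a\<in>UNIV. cnj (w1 a) * (\<Sum>c\<in>UNIV. M a c * cnj (V0 c)) + w1 a * (\<Sum>c\<in>UNIV. V0 c * cnj (M a c)))"
  proof -
    have "(\<Sum>a\<in>UNIV. pd (e a) (pdb (e a) F) p) = (\<Sum>a\<in>UNIV. pd (e a) (pdb (e a) (pt w)) p) - (\<Sum>a\<in>UNIV. w2 a a)
      - 2 * (\<Sum>a\<in>UNIV. pd (e a) (pdb (e a) Y) p) + (\<Sum>a\<in>UNIV. w2 a a) * Q p + of_real r * (\<Sum>a\<in>UNIV. pd (e a) (pdb (e a) Q) p)
      + (\<Sum>a\<in>UNIV. cnj (w1 a) * pd (e a) Q p + w1 a * pdb (e a) Q p)"
      unfolding F_2 by (simp only: sum.distrib sum_subtractf sum_distrib_left sum_distrib_right)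
    then have "pt F p - (\<Sum>a\<in>UNIV. pd (e a) (pdb (e a) F) p) =
      (pt (pt w) p - (\<Sum>a\<in>UNIV. pd (e a) (pdb (e a) (pt w)) p)) - (pt w p - (\<Sum>a\<in>UNIV. w2 a a))
      - 2 * (pt Y p - (\<Sum>a\<in>UNIV. pd (e a) (pdb (e a) Y) p)) + (pt w p - (\<Sum>a\<in>UNIV. w2 a a)) * Q p
      + of_real r * (pt Q p - (\<Sum>a\<in>UNIV. pd (e a) (pdb (e a) Q) p))
      - (\<Sum>a\<in>UNIV. cnj (w1 a) * pd (e a) Q p + w1 a * pdb (e a) Q p)"
      unfolding F_t by (simp add: algebra_simps)
    then show ?thesis
      unfolding heat_Y heat_Q Q_1 Q_1bar by (simp add: wtt w_t_p Q_p)
  qed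
  have gradp: "grad2 p = (\<Sum>a\<in>UNIV. (cmod (w1 a))\<^sup>2)"
    unfolding w1_def by (rule grad2_frame[OF pW e])
  have harn_p: "harnack p = (\<Sum>a\<in>UNIV. Re (w2 a a)) - (\<Sum>a\<in>UNIV. (cmod (w1 a))\<^sup>2) / r"
    unfolding harnack_def gradp w_t_p by (simp add: wp)
  have F_p: "Re (F p) = harnack p"
  proof -
    have "V0 c * w1 c = of_real ((cmod (w1 c))\<^sup>2 / r)" for c
      using complex_norm_square[of "w1 c"] by (simp add: V0_def mult.commute)
    then have 1: "Y p = of_real ((\<Sum>a\<in>UNIV. (cmod (w1 a))\<^sup>2) / r)"
      by (simp add: Y_def w1_def[symmetric] sum_divide_distrib)
    have "of_real r * (V0 c * cnj (V0 c)) = of_real ((cmod (w1 c))\<^sup>2 / r)" for c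
      using complex_norm_square[of "w1 c"] r by (simp add: V0_def mult.commute)
    then have 2: "of_real r * Q p = of_real ((\<Sum>a\<in>UNIV. (cmod (w1 a))\<^sup>2) / r)"
      unfolding Q_p sum_distrib_left by (simp add: sum_divide_distrib)
    show ?thesis unfolding F_def wp 2 1 harn_p w_t_p by simp
  qed
  \<comment> \<open>At a given point only the value of \<open>V\<close> matters, so
    \<open>test_function_bound\<close> applies to that one vector.\<close>
  have F_ge: "Re (F x) \<ge> harnack x" if x: "x \<in> W" for x
  proof -
    define v where "v = (\<Sum>c\<in>UNIV. V c x *s e c)"
    have "pd v w x = Y x" unfolding v_def Y_def using x by (simp add: pd_sum pd_scale)
    moreover have "gg v v x = Q x"
      unfolding v_def Q_def gg_def sesq_sum_left
      by (simp add: sesq_sum_right sesq_scale_left sesq_scale_right sum_distrib_left mult_ac)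
    ultimately show ?thesis using test_function_bound[OF x, of v] by (simp add: F_def)
  qed

  define m where "m = real CARD('m)"
  have m: "m > 0" by (simp add: m_def)
  define \<tau> where "\<tau> = t0 - \<epsilon>"
  have \<tau>: "\<tau> > 0" using after[OF p] by (simp add: \<tau>_def)
  define s where "s x = complex_of_real (snd x) - of_real \<epsilon>" for x :: "(complex^'m) \<times> real"
  have bl: "bounded_linear (\<lambda>x::(complex^'m) \<times> real. complex_of_real (snd x))"
    by (rule bounded_linear_compose[OF bounded_linear_of_real bounded_linear_snd])
  have s_smooth [simp]: "Cinf_on W s" unfolding s_def using Cinf_on_bounded_linear[OF bl] by simp
  have "(s has_derivative (\<lambda>y. complex_of_real (snd y))) (at x)" for x
    unfolding s_def using has_derivative_diff[OF bounded_linear.has_derivative[OF bl has_derivative_ident] has_derivative_const[of "complex_of_real \<epsilon>"]]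
    by simp
  note ds' = cder_has_derivative[OF this]
  have ds: "pt s x = 1" "pd v s x = 0" "pdb v s x = 0" for x v
    unfolding ds' by (simp_all add: tvec_def wirt_def wirtbar_def)
  have sp: "s p = of_real \<tau>" by (simp add: s_def p_def \<tau>_def)
  define h where "h x = s x * F x + of_real m * w x" for x
  have h: "Cinf_on W h" unfolding h_def by simp
  have h_t: "pt h p = F p + of_real \<tau> * pt F p + of_real m * pt w p"
    unfolding h_def using pW by (simp add: ds sp)
  have h_2: "pd (e a) (pdb (e a) h) p = of_real \<tau> * pd (e a) (pdb (e a) F) p + of_real m * w2 a a" for a
  proof -
    have "pd (e a) (pdb (e a) h) p = pd (e a) (\<lambda>x. s x * pdb (e a) F x + of_real m * pdb (e a) w x) p"
      unfolding h_def by (rule cder_cong[OF pW]) (simp add: ds)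
    then show ?thesis using pW by (simp add: ds sp w2_def)
  qed
  have Re_h: "Re (h (z, t)) = (t - \<epsilon>) * Re (F (z, t)) + m * Re (w (z, t))" for z t
    by (simp add: h_def s_def)
  have Re_hp: "Re (h (z0, t0)) = \<tau> * harnack p + m * r"
    using F_p Re_h[of z0 t0] by (simp add: p_def[symmetric] \<tau>_def wp)
  \<comment> \<open>Replacing F by F_V can only raise the function and leaves its value at
    \<open>p\<close> unchanged, so \<open>p\<close> stays a minimum; the factor t - epsilon is
    positive on \<open>W\<close>.\<close>
  have min': "exp (- t) * Re (h (z, t)) \<ge> exp (- t0) * Re (h (z0, t0))" if "(z, t) \<in> W" "t \<le> t0" for z t
  proof -
    have "exp (- t0) * Re (h (z0, t0)) \<le> exp (- t) * ((t - \<epsilon>) * harnack (z, t) + m * Re (w (z, t)))"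
      using min[OF that] by (simp only: Re_hp) (simp add: m_def p_def \<tau>_def r_def)
    also have "\<dots> \<le> exp (- t) * Re (h (z, t))"
      unfolding Re_h using F_ge[OF that(1)] after[OF that(1)] m by (intro mult_left_mono add_mono) auto
    finally show ?thesis .
  qed
  have "Re (pt h p) \<le> Re (h p)"
    using weighted_minimum_principle(1)[OF h p min'] by (simp add: p_def)
  moreover have "Re (\<Sum>a\<in>UNIV. pd (e a) (pdb (e a) h) p) \<ge> 0"
    using weighted_minimum_principle(2)[OF h p min'] by (simp only: Re_sum p_def sum_nonneg)
  ultimately have "Re (pt h p - (\<Sum>a\<in>UNIV. pd (e a) (pdb (e a) h) p)) \<le> \<tau> * harnack p + m * r"
    using Re_hp by (simp only: p_def minus_complex.sel)
  moreover have "pt h p - (\<Sum>a\<in>UNIV. pd (e a) (pdb (e a) h) p)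
     = F p + of_real \<tau> * (pt F p - (\<Sum>a\<in>UNIV. pd (e a) (pdb (e a) F) p)) + of_real m * of_real r"
    unfolding h_t h_2 w_t_p by (simp add: sum.distrib sum_distrib_left[symmetric] algebra_simps)
  moreover have "Re (pt F p - (\<Sum>a\<in>UNIV. pd (e a) (pdb (e a) F) p)) \<ge> (\<Sum>a\<in>UNIV. Re (w2 a a)) + (harnack p)\<^sup>2 / (m * r)"
    unfolding heat_F m_def
    by (rule pointwise_bound[where ?w2.0 = w2 and V = V0 and ?w1.0 = w1 and M = M, OF r _ _ _ w_t_p harn_p])
      (simp_all add: V0_def M_def w2_def hess_herm[OF pW])
  \<comment> \<open>The Laplacian of w exceeds F by |grad w|^2 / w. After trading it for F, the
    terms tau F and m r on the two sides of \<open>key\<close> cancel.\<close>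
  moreover have "(\<Sum>a\<in>UNIV. Re (w2 a a)) \<ge> harnack p"
    unfolding harn_p using r by (simp add: sum_nonneg)
  ultimately have key: "harnack p + \<tau> * (harnack p + (harnack p)\<^sup>2 / (m * r)) \<le> \<tau> * harnack p"
    using \<tau> F_p by (simp add: mult_left_mono) (smt (verit) mult_left_mono)
  show ?thesis
  proof (rule ccontr)
    assume "\<not> ?thesis"
    then have neg: "\<tau> * harnack p + m * r < 0" by (simp add: \<tau>_def m_def p_def r_def)
    have mr: "m * r > 0" using m r by simp
    have hneg: "harnack p < 0"
      using neg mr \<tau> by (smt (verit) mult_nonneg_nonneg)
    \<comment> \<open>Multiplying \<open>key\<close> by m r factors its left-over part; at a
      negative minimum both factors are negative.\<close>
    have "harnack p * (m * r + \<tau> * harnack p) = (harnack p + \<tau> * ((harnack p)\<^sup>2 / (m * r))) * (m * r)"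
      using m r by (simp add: distrib_left distrib_right power2_eq_square mult_ac)
    also have "\<dots> \<le> 0"
      using key mr by (intro mult_nonpos_nonneg) (simp_all add: distrib_left)
    finally have "harnack p * (m * r + \<tau> * harnack p) \<le> 0" .
    moreover have "harnack p * (m * r + \<tau> * harnack p) > 0"
      using hneg neg by (intro mult_neg_neg) auto
    ultimately show False by simp
  qed
qed

end

subsection \<open>From charts to open sets of space-time\<close>

text \<open>\<open>S\<close> may contain boundary points, such as those with t = 0. On the open part
  \<open>W\<close> the local extensions given by \<open>smooth_on\<close> coincide with
  \<open>h\<close>.\<close>

lemma smooth_on_imp_Cinf_on:
  assumes W: "open W" "W \<subseteq> S" and h: "smooth_on S h"
  shows "Cinf_on W h"
  unfolding Cinf_on_def
proof
  fix k show "Ck_on k W h"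
  proof (rule Ck_on_local)
    fix x assume x: "x \<in> W"
    then have "x \<in> S" using W by auto
    from bspec[OF h[unfolded smooth_on_def] this]
    obtain U H where U: "open U" "x \<in> U" "\<forall>k. Ck_on k U H" "\<forall>y\<in>S \<inter> U. H y = h y" by auto
    have "Ck_on k (U \<inter> W) H" using U(3) Ck_on_subset[of "U \<inter> W" U k H] by simp
    then have "Ck_on k (U \<inter> W) h"
      by (rule Ck_on_cong[rotated 2]) (use U W in auto)
    then show "\<exists>V. open V \<and> x \<in> V \<and> Ck_on k V h" using U(1,2) W x by blast
  qed
qed

lemma Cinf_on_fst:
  fixes h :: "'a::euclidean_space \<Rightarrow> 'b::real_normed_vector" and W :: "('a \<times> 'c::euclidean_space) set"
  assumes V: "open V" and h: "Cinf_on V h" and W: "fst ` W \<subseteq> V"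
  shows "Cinf_on W (\<lambda>x. h (fst x))"
  unfolding Cinf_on_def
proof
  fix k
  have "Ck_on k (fst -` V) (\<lambda>x::'a \<times> 'c. h (fst x))"
    using h by (intro Ck_on_compose_bounded_linear[OF V bounded_linear_fst]) (simp add: Cinf_on_def)
  then show "Ck_on k W (\<lambda>x. h (fst x))" by (rule Ck_on_subset[rotated]) (use W in auto)
qed

lemma frechet_derivative_slice:
  fixes h :: "'a::euclidean_space \<times> 'c::euclidean_space \<Rightarrow> 'b::real_normed_vector"
  assumes "h differentiable (at (z, t))"
  shows "((\<lambda>y. h (y, t)) has_derivative (\<lambda>v. frechet_derivative h (at (z, t)) (v, 0))) (at z)"
    and "((\<lambda>s. h (z, s)) has_derivative (\<lambda>s. frechet_derivative h (at (z, t)) (0, s))) (at t)"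
proof -
  have h: "(h has_derivative frechet_derivative h (at (z, t))) (at (z, t))"
    using assms by (simp add: frechet_derivative_works)
  have "((\<lambda>y. (y, t)) has_derivative (\<lambda>v. (v, 0))) (at z)" "((\<lambda>s. (z, s)) has_derivative (\<lambda>s. (0, s))) (at t)"
    by (auto intro!: derivative_eq_intros)
  from has_derivative_compose[OF this(1) h] has_derivative_compose[OF this(2) h]
  show "((\<lambda>y. h (y, t)) has_derivative (\<lambda>v. frechet_derivative h (at (z, t)) (v, 0))) (at z)"
    and "((\<lambda>s. h (z, s)) has_derivative (\<lambda>s. frechet_derivative h (at (z, t)) (0, s))) (at t)" .
qed

locale atlas =
  fixes X :: "'a topology" and A :: "('a, 'm::finite) chart set"
  assumes manifold: "complex_manifold X A"
begin

definition dom :: "('a, 'm) chart \<Rightarrow> (complex^'m) set" where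
  "dom c = snd c ` fst c"

lemma homeo: "c \<in> A \<Longrightarrow> homeomorphic_map (subtopology X (fst c)) (top_of_set (dom c)) (snd c)"
  and open_dom: "c \<in> A \<Longrightarrow> open (dom c)"
  and open_chart: "c \<in> A \<Longrightarrow> openin X (fst c)"
  and chart_cover: "(\<Union>c\<in>A. fst c) = topspace X"
  and transition: "c \<in> A \<Longrightarrow> d \<in> A \<Longrightarrow>
    holomorphic_map_on (snd c ` (fst c \<inter> fst d)) (snd d \<circ> coord_inv c)"
  using manifold unfolding complex_manifold_def dom_def by blast+

lemma chart_sub: "c \<in> A \<Longrightarrow> fst c \<subseteq> topspace X"
  using chart_cover by blast

lemma chart_inj: "c \<in> A \<Longrightarrow> inj_on (snd c) (fst c)"
  using homeomorphic_imp_injective_map[OF homeo, of c] chart_sub[of c] by (simp add: Int_absorb1)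

lemma coord_inv_coord: "c \<in> A \<Longrightarrow> p \<in> fst c \<Longrightarrow> coord_inv c (snd c p) = p"
  unfolding coord_inv_def by (rule inv_into_f_f[OF chart_inj])

lemma coord_coord_inv: "z \<in> dom c \<Longrightarrow> snd c (coord_inv c z) = z"
  unfolding coord_inv_def dom_def by (rule f_inv_into_f)

lemma coord_inv_in: "z \<in> dom c \<Longrightarrow> coord_inv c z \<in> fst c"
  unfolding coord_inv_def dom_def by (rule inv_into_into)

lemma coord_in: "p \<in> fst c \<Longrightarrow> snd c p \<in> dom c"
  by (simp add: dom_def)

definition local_rep :: "('a, 'm) chart \<Rightarrow> ('a \<Rightarrow> real \<Rightarrow> 'b) \<Rightarrow> (complex^'m) \<times> real \<Rightarrow> 'b" where
  "local_rep c h x = h (coord_inv c (fst x)) (snd x)"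

lemma local_rep_coord: "c \<in> A \<Longrightarrow> p \<in> fst c \<Longrightarrow> local_rep c h (snd c p, t) = h p t"
  by (simp add: local_rep_def coord_inv_coord)

end

text \<open>The lower time 0 serves facts valid for all t > 0; a positive lower time serves the
  maximum principle.\<close>

locale atlas_chart = atlas X A for X :: "'a topology" and A :: "('a, 'm::finite) chart set" +
  fixes c :: "('a, 'm) chart" and \<epsilon> :: real
  assumes chart: "c \<in> A" and eps: "\<epsilon> \<ge> 0"
begin

text \<open>Open, hence without its lower time, and unbounded above, so that the final time of the
  minimization is an interior time.\<close>

definition slab :: "((complex^'m) \<times> real) set" where
  "slab = dom c \<times> {\<epsilon><..}"

sublocale spacetime slab
  by unfold_locales (simp add: slab_def open_Times open_dom[OF chart])

lemma slab_iff: "(z, t) \<in> slab \<longleftrightarrow> z \<in> dom c \<and> \<epsilon> < t"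
  by (simp add: slab_def)

lemma dir_deriv_local_rep:
  fixes h :: "'a \<Rightarrow> real \<Rightarrow> 'b::real_normed_vector"
  assumes h: "Cinf_on slab (local_rep c h)" and x: "(z, t) \<in> slab"
  shows "dir_deriv c v (\<lambda>q. h q t) (coord_inv c z) = frechet_derivative (local_rep c h) (at (z, t)) (v, 0)"
proof -
  have "((\<lambda>y. local_rep c h (y, t)) has_derivative (\<lambda>v. frechet_derivative (local_rep c h) (at (z, t)) (v, 0))) (at z)"
    by (rule frechet_derivative_slice(1)[OF Cinf_on_differentiable[OF h x]])
  moreover have "(\<lambda>y. local_rep c h (y, t)) = (\<lambda>q. h q t) \<circ> coord_inv c"
    by (simp add: local_rep_def fun_eq_iff)
  ultimately show ?thesis
    using x by (simp add: dir_deriv_def frechet_derivative_eqI slab_iff coord_coord_inv)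
qed

lemma i_axis: "\<i> *s axis \<alpha> 1 = axis \<alpha> \<i>"
  by (simp add: vec_eq_iff axis_def)

lemma
  assumes h: "Cinf_on slab (local_rep c h)" and x: "(z, t) \<in> slab"
  shows dz_local_rep: "dz c \<alpha> (\<lambda>q. h q t) (coord_inv c z) = pd (axis \<alpha> 1) (local_rep c h) (z, t)"
    and dzbar_local_rep: "dzbar c \<alpha> (\<lambda>q. h q t) (coord_inv c z) = pdb (axis \<alpha> 1) (local_rep c h) (z, t)"
  unfolding dz_def dzbar_def dir_deriv_local_rep[OF h x] pd_frechet[OF h x] pdb_frechet[OF h x] i_axis
  by simp_all

lemma hess_local_rep:
  assumes h: "Cinf_on slab (local_rep c (\<lambda>q t. complex_of_real (h q t)))" and x: "(z, t) \<in> slab"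
  shows "hess c (\<lambda>q. h q t) (coord_inv c z) = chess (local_rep c (\<lambda>q t. complex_of_real (h q t))) (z, t)"
proof -
  let ?h = "\<lambda>q t. complex_of_real (h q t)"
  have "dz c \<alpha> (dzbar c \<beta> (\<lambda>q. ?h q t)) (coord_inv c z) = pd (axis \<alpha> 1) (pdb (axis \<beta> 1) (local_rep c ?h)) (z, t)" for \<alpha> \<beta>
  proof -
    let ?k = "\<lambda>q s. dzbar c \<beta> (\<lambda>q. ?h q s) q"
    have k: "local_rep c ?k y = pdb (axis \<beta> 1) (local_rep c ?h) y" if "y \<in> slab" for y
      using dzbar_local_rep[OF h, of "fst y" "snd y"] that by (simp add: local_rep_def)
    have "Cinf_on slab (local_rep c ?k)"
      by (rule Cinf_on_cong[OF open_W k[symmetric]]) (simp_all add: h)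
    then have "dz c \<alpha> (\<lambda>q. ?k q t) (coord_inv c z) = pd (axis \<alpha> 1) (local_rep c ?k) (z, t)"
      using x by (rule dz_local_rep)
    also have "\<dots> = pd (axis \<alpha> 1) (pdb (axis \<beta> 1) (local_rep c ?h)) (z, t)"
      using x k by (rule cder_cong)
    finally show ?thesis .
  qed
  then show ?thesis by (simp add: hess_def chess_def)
qed

lemma time_deriv_local_rep:
  assumes h: "Cinf_on slab (local_rep c h)" and x: "(z, t) \<in> slab"
  shows "time_deriv h (coord_inv c z) t = frechet_derivative (local_rep c h) (at (z, t)) (0, 1)"
    and "pt (local_rep c (\<lambda>q t. complex_of_real (h q t))) (z, t) = of_real (time_deriv h (coord_inv c z) t)"
proof -
  have lin: "linear (frechet_derivative (local_rep c h) (at (z, t)))"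
    using has_derivative_linear[OF Cinf_on_has_derivative[OF h x]] .
  have D: "((\<lambda>s. h (coord_inv c z) s) has_derivative (\<lambda>s. frechet_derivative (local_rep c h) (at (z, t)) (0, s))) (at t)"
    using frechet_derivative_slice(2)[OF Cinf_on_differentiable[OF h x]] by (simp add: local_rep_def)
  have "frechet_derivative (local_rep c h) (at (z, t)) (0, s) = s *\<^sub>R frechet_derivative (local_rep c h) (at (z, t)) (0, 1)" for s
    using linear_scale[OF lin, of s "(0, 1)"] by simp
  then have "(\<lambda>s. frechet_derivative (local_rep c h) (at (z, t)) (0, s)) =
      (\<lambda>s. s *\<^sub>R frechet_derivative (local_rep c h) (at (z, t)) (0, 1))" by (rule ext)
  from D[unfolded this] have "(h (coord_inv c z) has_vector_derivative frechet_derivative (local_rep c h) (at (z, t)) (0, 1)) (at t)"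
    by (simp only: has_vector_derivative_def)
  \<comment> \<open>Times in the slab are positive, so the one-sided convention of
    \<open>time_deriv\<close> at 0 does not intervene.\<close>
  moreover have "at t within {0..} = at t"
    using x eps by (intro at_within_interior) (simp add: slab_iff)
  ultimately show 1: "time_deriv h (coord_inv c z) t = frechet_derivative (local_rep c h) (at (z, t)) (0, 1)"
    by (simp add: time_deriv_def vector_derivative_at)
  have e: "local_rep c (\<lambda>q t. complex_of_real (h q t)) = (\<lambda>x. of_real (local_rep c h x))"
    by (simp add: local_rep_def fun_eq_iff)
  show "pt (local_rep c (\<lambda>q t. complex_of_real (h q t))) (z, t) = of_real (time_deriv h (coord_inv c z) t)"
    unfolding 1 e cder_def
    by (simp add: frechet_derivative_bounded_linear_compose[OF bounded_linear_of_real Cinf_on_differentiable[OF h x]]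
        tvec_def linear_0[OF lin])
qed

lemma Cinf_of_real: "Cinf_on slab h \<Longrightarrow> Cinf_on slab (\<lambda>x. complex_of_real (h x))"
  by (rule Cinf_on_bounded_linear_compose[OF open_W bounded_linear_of_real])

lemma Cinf_time_independent:
  assumes "Cinf_on (dom c) h"
  shows "Cinf_on slab (\<lambda>x. h (fst x))"
  using assms by (rule Cinf_on_fst[OF open_dom[OF chart]]) (auto simp: slab_def)

lemma pt_time_independent:
  assumes h: "Cinf_on (dom c) h" and x: "x \<in> slab"
  shows "pt (\<lambda>x. h (fst x)) x = 0"
proof -
  have "(h has_derivative frechet_derivative h (at (fst x))) (at (fst x))"
    using h x by (intro Cinf_on_has_derivative[of "dom c"]) (auto simp: slab_def)
  from has_derivative_compose[OF has_derivative_fst[OF has_derivative_ident] this]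
  have D: "((\<lambda>x. h (fst x)) has_derivative (\<lambda>v. frechet_derivative h (at (fst x)) (fst v))) (at x)" .
  have "linear (frechet_derivative h (at (fst x)))" using has_derivative_linear
    \<open>(h has_derivative frechet_derivative h (at (fst x))) (at (fst x))\<close> .
  then show ?thesis unfolding cder_has_derivative[OF D] by (simp add: tvec_def linear_0)
qed

end

subsection \<open>The logarithm of the determinant\<close>

text \<open>The derivative of log det G as a trace. The real logarithm is used, with no branch of
  the complex one, because the determinant is positive.\<close>

lemma (in open_domain)
  assumes G: "mCinf_on W G" and pd: "\<And>x. x \<in> W \<Longrightarrow> hermitian_pd (G x)"
  shows Cinf_ln_det: "Cinf_on W (\<lambda>x. complex_of_real (ln (Re (det (G x)))))"
    and cder_ln_det: "x \<in> W \<Longrightarrow> cder X (\<lambda>x. complex_of_real (ln (Re (det (G x))))) x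
      = trace (matrix_inv (G x) ** mder X G x)"
proof -
  have nz: "det (G x) \<noteq> 0" if "x \<in> W" for x using hermitian_pd_det_nonzero[OF pd[OF that]] .
  have pos: "Re (det (G x)) > 0" if "x \<in> W" for x using hermitian_pd_det_pos[OF pd[OF that]] .
  have det: "Cinf_on W (\<lambda>x. det (G x))" by (rule Cinf_det[OF G])
  have real: "complex_of_real (Re (det (G x))) = det (G x)" if "x \<in> W" for x
  proof -
    have "det (G x) \<in> \<real>"
      by (rule hermitian_det_real) (use pd[OF that] in \<open>unfold hermitian_pd_def, blast\<close>)
    then show ?thesis by simp
  qed
  let ?D = "\<lambda>x. frechet_derivative (\<lambda>x. det (G x)) (at x)"
  have D: "((\<lambda>x. complex_of_real (ln (Re (det (G x))))) has_derivative (\<lambda>v. ?D x v / det (G x))) (at x)"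
    if x: "x \<in> W" for x
  proof -
    have "((\<lambda>x. Re (det (G x))) has_derivative (\<lambda>v. Re (?D x v))) (at x)"
      by (rule bounded_linear.has_derivative[OF bounded_linear_Re Cinf_on_has_derivative[OF det x]])
    from has_derivative_ln[OF pos[OF x] this]
    have "((\<lambda>x. ln (Re (det (G x)))) has_derivative (\<lambda>v. Re (?D x v) * inverse (Re (det (G x))))) (at x)" .
    from bounded_linear.has_derivative[OF bounded_linear_of_real this]
    have "((\<lambda>x. complex_of_real (ln (Re (det (G x))))) has_derivative
        (\<lambda>v. complex_of_real (Re (?D x v) * inverse (Re (det (G x)))))) (at x)" .
    \<comment> \<open>The determinant is real on all of \<open>W\<close>, hence so are its
      directional derivatives.\<close>
    moreover have "complex_of_real (Re (?D x v)) = ?D x v" for v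
    proof -
      have "frechet_derivative (\<lambda>x. complex_of_real (Re (det (G x)))) (at x) = ?D x"
        by (rule frechet_derivative_local[OF open_W x]) (rule real)
      moreover have "frechet_derivative (\<lambda>x. complex_of_real (Re (det (G x)))) (at x) v = complex_of_real (Re (?D x v))"
        using frechet_derivative_bounded_linear_compose[OF bounded_linear_compose[OF bounded_linear_of_real bounded_linear_Re]
          Cinf_on_differentiable[OF det x]] .
      ultimately show ?thesis by simp
    qed
    ultimately show ?thesis using real[OF x] by (simp add: divide_inverse)
  qed
  show "Cinf_on W (\<lambda>x. complex_of_real (ln (Re (det (G x)))))"
    by (rule Cinf_on_I[OF open_W D Cinf_divide[OF Cinf_on_frechet_derivative[OF det] det nz]])
  show "cder X (\<lambda>x. complex_of_real (ln (Re (det (G x))))) x = trace (matrix_inv (G x) ** mder X G x)"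
    if x: "x \<in> W" for x
    using cder_det[OF G nz[OF x] x, of X] nz[OF x]
    unfolding cder_has_derivative[OF D[OF x]] by (simp add: cder_def field_simps)
qed

subsection \<open>The flow in a chart\<close>

lemma form_of_eq_sesq: "form_of h c q u v = Re (\<i> * (sesq (h c q) u v - sesq (h c q) v u))"
  by (simp add: form_of_def sesq_def right_diff_distrib sum_subtractf mult.assoc)

locale kr_flow = atlas X A for X :: "'a topology" and A :: "('a, 'm::finite) chart set" +
  fixes g :: "real \<Rightarrow> ('a, 'm) tensor11" and f :: "'a \<Rightarrow> real" and \<phi> w :: "'a \<Rightarrow> real \<Rightarrow> real"
  assumes kaehler_g: "\<And>t. t \<ge> 0 \<Longrightarrow> kaehler_metric A (g t)"
    and f_smooth: "smooth_fun A f"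
    and f_potential: "\<And>c x. c \<in> A \<Longrightarrow> x \<in> fst c \<Longrightarrow> hess c f x = g 0 c x - ricci (g 0) c x"
    and phi_smooth: "smooth_time_fun A \<phi>"
    and metric: "\<And>t c x. t \<ge> 0 \<Longrightarrow> c \<in> A \<Longrightarrow> x \<in> fst c \<Longrightarrow>
        g t c x = g 0 c x + hess c (\<lambda>y. \<phi> y t) x"
    and flow: "\<And>t c x. t \<ge> 0 \<Longrightarrow> c \<in> A \<Longrightarrow> x \<in> fst c \<Longrightarrow>
        time_deriv \<phi> x t = ln (Re (det (g t c x)) / Re (det (g 0 c x))) + \<phi> x t + f x"
    and w_def: "\<And>t x. t \<ge> 0 \<Longrightarrow> x \<in> topspace X \<Longrightarrow> w x t = - time_deriv \<phi> x t"
    and w_pos: "\<And>t x. t \<ge> 0 \<Longrightarrow> x \<in> topspace X \<Longrightarrow> w x t > 0"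
begin

lemma hermitian_pd_g:
  assumes "t \<ge> 0" "c \<in> A" "p \<in> fst c"
  shows "hermitian_pd (g t c p)"
  using kaehler_g[OF assms(1)] assms(2,3)
  unfolding kaehler_metric_def hermitian_metric_def hermitian_pd_def sesq_def by blast

end

locale kr_flow_chart = kr_flow X A g f \<phi> w + atlas_chart X A c \<epsilon>
  for X :: "'a topology" and A :: "('a, 'm::finite) chart set" and g f \<phi> w c \<epsilon>
begin

definition Gc :: "(complex^'m) \<times> real \<Rightarrow> complex^'m^'m" where
  "Gc x = g (snd x) c (coord_inv c (fst x))"

definition G0 :: "complex^'m \<Rightarrow> complex^'m^'m" where
  "G0 z = g 0 c (coord_inv c z)"

definition wc :: "(complex^'m) \<times> real \<Rightarrow> complex" where
  "wc = local_rep c (\<lambda>q t. complex_of_real (w q t))"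

definition \<Phi> :: "(complex^'m) \<times> real \<Rightarrow> complex" where
  "\<Phi> = local_rep c (\<lambda>q t. complex_of_real (\<phi> q t))"

lemma slab_D:
  assumes "x \<in> slab"
  shows "snd x > \<epsilon>" "snd x > 0" "snd x \<ge> 0" "fst x \<in> dom c" "coord_inv c (fst x) \<in> fst c"
    "coord_inv c (fst x) \<in> topspace X"
  using assms eps coord_inv_in[of "fst x" c] chart_sub[OF chart] by (auto simp: slab_def)

lemma phi_real: "Cinf_on slab (local_rep c \<phi>)"
proof -
  have "smooth_on (dom c \<times> {0..}) (\<lambda>(z, t). \<phi> (coord_inv c z) t)"
    using phi_smooth chart by (simp add: smooth_time_fun_def dom_def)
  moreover have "(\<lambda>(z, t). \<phi> (coord_inv c z) t) = local_rep c \<phi>"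
    by (simp add: local_rep_def fun_eq_iff)
  moreover have "slab \<subseteq> dom c \<times> {0..}" using eps by (auto simp: slab_def)
  ultimately show ?thesis using smooth_on_imp_Cinf_on[OF open_W] by metis
qed

lemma \<Phi>_smooth [simp]: "Cinf_on slab \<Phi>"
  using Cinf_of_real[OF phi_real] unfolding \<Phi>_def local_rep_def .

lemma wc_eq: "x \<in> slab \<Longrightarrow> wc x = - pt \<Phi> x"
  using time_deriv_local_rep(2)[OF phi_real, of "fst x" "snd x"] slab_D[of x]
  by (simp add: wc_def local_rep_def \<Phi>_def w_def)

lemma wc_smooth [simp]: "Cinf_on slab wc"
  by (rule Cinf_on_cong[OF open_W, of "\<lambda>x. - pt \<Phi> x"]) (simp_all add: wc_eq)

lemma w_real_smooth: "Cinf_on slab (local_rep c w)"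
proof -
  have "Cinf_on slab (\<lambda>x. Re (wc x))"
    by (rule Cinf_on_bounded_linear_compose[OF open_W bounded_linear_Re wc_smooth])
  then show ?thesis unfolding wc_def local_rep_def by simp
qed

lemma G0_smooth: "Cinf_on (dom c) (\<lambda>z. G0 z $ \<alpha> $ \<beta>)"
proof -
  have "smooth_on (dom c) G0"
  proof -
    have "\<forall>c\<in>A. smooth_on (snd c ` fst c) (g 0 c \<circ> coord_inv c)"
      using kaehler_g[OF order_refl] unfolding kaehler_metric_def hermitian_metric_def by blast
    with chart have "smooth_on (snd c ` fst c) (g 0 c \<circ> coord_inv c)" by blast
    then show ?thesis unfolding G0_def dom_def comp_def .
  qed
  then have G: "Cinf_on (dom c) G0" by (rule smooth_on_imp_Cinf_on[OF open_dom[OF chart] order_refl])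
  have "bounded_linear (\<lambda>M::complex^'m^'m. M $ \<alpha> $ \<beta>)"
    by (rule bounded_linear_compose[OF bounded_linear_vec_nth bounded_linear_vec_nth])
  from Cinf_on_bounded_linear_compose[OF open_dom[OF chart] this G] show ?thesis .
qed

lemma f_local: "Cinf_on (dom c) (\<lambda>z. complex_of_real (f (coord_inv c z)))"
proof -
  have "smooth_on (dom c) (\<lambda>z. f (coord_inv c z))"
    using f_smooth chart by (simp add: smooth_fun_def dom_def comp_def)
  then have "Cinf_on (dom c) (\<lambda>z. f (coord_inv c z))"
    by (rule smooth_on_imp_Cinf_on[OF open_dom[OF chart] order_refl])
  then show ?thesis by (rule Cinf_on_bounded_linear_compose[OF open_dom[OF chart] bounded_linear_of_real])
qed

lemma Gc_eq:
  assumes x: "x \<in> slab"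
  shows "Gc x = G0 (fst x) + chess \<Phi> x"
proof -
  have "hess c (\<lambda>q. \<phi> q (snd x)) (coord_inv c (fst x)) = chess \<Phi> x"
    using hess_local_rep[of \<phi> "fst x" "snd x"] \<Phi>_smooth x by (simp add: \<Phi>_def)
  then show ?thesis
    unfolding Gc_def G0_def metric[OF slab_D(3)[OF x] chart slab_D(5)[OF x]] by simp
qed

lemma Gc_smooth: "mCinf_on slab Gc"
  unfolding mCinf_on_def
proof (intro allI)
  fix \<alpha> \<beta>
  have "Cinf_on slab (\<lambda>x. G0 (fst x) $ \<alpha> $ \<beta> + chess \<Phi> x $ \<alpha> $ \<beta>)"
    using Cinf_time_independent[OF G0_smooth] mCinf_on_entry[OF mCinf_chess[OF \<Phi>_smooth]] by (rule Cinf_add)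
  then show "Cinf_on slab (\<lambda>x. Gc x $ \<alpha> $ \<beta>)"
    by (rule Cinf_on_cong[OF open_W, rotated]) (simp add: Gc_eq)
qed

lemma Gc_pd: "x \<in> slab \<Longrightarrow> hermitian_pd (Gc x)"
  unfolding Gc_def using slab_D by (intro hermitian_pd_g chart)

lemma G0_pd: "z \<in> dom c \<Longrightarrow> hermitian_pd (G0 z)"
  unfolding G0_def using coord_inv_in by (intro hermitian_pd_g chart) auto

text \<open>The type decomposition of the closed form: four instances of closedness, with arguments
  multiplied by the imaginary unit, isolate the part that is linear in \<open>u\<close> and \<open>v\<close>.\<close>

lemma Gc_kaehler:
  assumes x: "x \<in> slab"
  shows "pd u (\<lambda>y. sesq (Gc y) v b) x = pd v (\<lambda>y. sesq (Gc y) u b) x"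
proof -
  define S where "S v b = (\<lambda>y. sesq (Gc y) v b)" for v b
  have S: "Cinf_on slab (S v b)" for v b unfolding S_def by (rule Cinf_sesq[OF Gc_smooth])
  define D where "D u v b = frechet_derivative (S v b) (at x) (u, 0)" for u v b
  have D_c: "frechet_derivative (\<lambda>y. k * S v b y) (at x) (u, 0) = k * D u v b" for k u v b
    unfolding D_def
    by (rule frechet_derivative_bounded_linear_compose[OF bounded_linear_mult_right Cinf_on_differentiable[OF S x]])
  have D_i: "D u (\<i> *s v) b = \<i> * D u v b" "D u v (\<i> *s b) = - \<i> * D u v b" for u v b
    using D_c[of \<i> v b u] D_c[of "- \<i>" v b u]
    by (simp_all add: D_def S_def sesq_scale_left sesq_scale_right)
  have closed: "Im (D u v b) - Im (D v u b) + Im (D b u v) = 0" for u v b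
  proof -
    let ?h = "\<lambda>v b q t. form_of (g t) c q v b"
    have form: "local_rep c (?h v b) y = - 2 * Im (S v b y)" if y: "y \<in> slab" for v b y
    proof -
      have "local_rep c (?h v b) y = Re (\<i> * (sesq (Gc y) v b - sesq (Gc y) b v))"
        by (simp add: local_rep_def form_of_eq_sesq Gc_def)
      also have "sesq (Gc y) b v = cnj (sesq (Gc y) v b)"
        by (rule sesq_cnj[symmetric]) (use Gc_pd[OF y] in \<open>unfold hermitian_pd_def, blast\<close>)
      finally show ?thesis by (simp add: S_def)
    qed
    have bl: "bounded_linear (\<lambda>z. - 2 * Im z)"
      by (rule bounded_linear_compose[OF bounded_linear_mult_right bounded_linear_Im])
    have h: "Cinf_on slab (local_rep c (?h v b))" for v b
      by (rule Cinf_on_cong[OF open_W form[symmetric] Cinf_on_bounded_linear_compose[OF open_W bl S]])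
    have dd: "dir_deriv c u (\<lambda>q. form_of (g (snd x)) c q v b) (coord_inv c (fst x)) = - 2 * Im (D u v b)" for u v b
    proof -
      have "dir_deriv c u (\<lambda>q. form_of (g (snd x)) c q v b) (coord_inv c (fst x))
        = frechet_derivative (local_rep c (?h v b)) (at x) (u, 0)"
        using dir_deriv_local_rep[OF h, of "fst x" "snd x"] x by simp
      also have "frechet_derivative (local_rep c (?h v b)) (at x) = frechet_derivative (\<lambda>y. - 2 * Im (S v b y)) (at x)"
        by (rule frechet_derivative_local[OF open_W x form])
      also have "\<dots> (u, 0) = - 2 * Im (D u v b)"
        unfolding D_def by (rule frechet_derivative_bounded_linear_compose[OF bl Cinf_on_differentiable[OF S x]])
      finally show ?thesis .
    qed
    have "closed_form2 A (form_of (g (snd x)))"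
      using kaehler_g slab_D[OF x] by (simp add: kaehler_metric_def)
    then have "dir_deriv c u (\<lambda>q. form_of (g (snd x)) c q v b) (coord_inv c (fst x))
        - dir_deriv c v (\<lambda>q. form_of (g (snd x)) c q u b) (coord_inv c (fst x))
        + dir_deriv c b (\<lambda>q. form_of (g (snd x)) c q u v) (coord_inv c (fst x)) = 0"
      unfolding closed_form2_def using chart slab_D(5)[OF x] by blast
    then show ?thesis unfolding dd by simp
  qed
  have eq: "D u v b - \<i> * D (\<i> *s u) v b = D v u b - \<i> * D (\<i> *s v) u b"
    using closed[of u v b] closed[of "\<i> *s u" v b] closed[of u "\<i> *s v" b] closed[of "\<i> *s u" "\<i> *s v" b]
    by (simp add: D_i complex_eq_iff)
  have pd: "pd u (S v b) x = (D u v b - \<i> * D (\<i> *s u) v b) / 2" for u v b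
    unfolding D_def by (rule pd_frechet[OF S x])
  show ?thesis using pd[of u v b] pd[of v u b] unfolding S_def eq by (rule trans[OF _ sym])
qed

text \<open>Splitting the logarithm of the quotient requires both determinants to be positive;
  afterwards each summand can be differentiated separately.\<close>

lemma ln_det_flow:
  assumes x: "x \<in> slab"
  shows "pt \<Phi> x = complex_of_real (ln (Re (det (Gc x)))) - complex_of_real (ln (Re (det (G0 (fst x)))))
    + \<Phi> x + complex_of_real (f (coord_inv c (fst x)))"
proof -
  have "ln (Re (det (Gc x)) / Re (det (G0 (fst x)))) = ln (Re (det (Gc x))) - ln (Re (det (G0 (fst x))))"
    using hermitian_pd_det_pos[OF Gc_pd[OF x]] hermitian_pd_det_pos[OF G0_pd[OF slab_D(4)[OF x]]]
    by (rule ln_divide_pos)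
  then show ?thesis
    using time_deriv_local_rep(2)[OF phi_real, of "fst x" "snd x"] flow[OF _ chart, of "snd x" "coord_inv c (fst x)"] slab_D[OF x] x
    by (simp add: \<Phi>_def local_rep_def Gc_def G0_def)
qed

lemma dom_open_domain: "open_domain (dom c)"
  by unfold_locales (rule open_dom[OF chart])

lemma G0_mCinf: "mCinf_on (dom c) G0"
  by (simp add: mCinf_on_def G0_smooth)

lemma L0_smooth: "Cinf_on (dom c) (\<lambda>z. complex_of_real (ln (Re (det (G0 z)))))"
  by (rule open_domain.Cinf_ln_det[OF dom_open_domain G0_mCinf G0_pd])

text \<open>Differentiating the flow in time turns log det g(t) into minus the Laplacian of w, and
  so gives w_t. Taking the mixed Hessian gives - hess w = - Ric(t) + Ric(0) + hess phi + hess f,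
  whose last three terms add up to g(t).\<close>

lemma evolving: "evolving_metric slab Gc wc"
proof
  let ?L = "\<lambda>x. complex_of_real (ln (Re (det (Gc x))))"
  let ?K = "\<lambda>x. complex_of_real (ln (Re (det (G0 (fst x)))))"
  let ?f = "\<lambda>x. complex_of_real (f (coord_inv c (fst x)))"
  have L: "Cinf_on slab ?L" by (rule Cinf_ln_det[OF Gc_smooth Gc_pd])
  have L0: "Cinf_on slab ?K" by (rule Cinf_time_independent[OF L0_smooth])
  have f: "Cinf_on slab ?f" by (rule Cinf_time_independent[OF f_local])
  show "mCinf_on slab Gc" by (rule Gc_smooth)
  show "Cinf_on slab wc" by simp
  fix x assume x: "x \<in> slab"
  show "wc x \<in> \<real>" by (simp add: wc_def local_rep_def)
  show "Re (wc x) > 0" using w_pos slab_D[OF x] by (simp add: wc_def local_rep_def)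
  show "hermitian_pd (Gc x)" by (rule Gc_pd[OF x])
  show "pd (axis \<gamma> 1) (\<lambda>y. Gc y $ \<alpha> $ \<beta>) x = pd (axis \<alpha> 1) (\<lambda>y. Gc y $ \<gamma> $ \<beta>) x" for \<alpha> \<beta> \<gamma>
    using Gc_kaehler[OF x, of "axis \<gamma> 1" "axis \<alpha> 1" "axis \<beta> 1"] by (simp add: sesq_axis)
  have chess_w: "chess wc x $ \<alpha> $ \<beta> = - pd (axis \<alpha> 1) (pdb (axis \<beta> 1) (pt \<Phi>)) x" for \<alpha> \<beta>
  proof -
    have "chess wc x $ \<alpha> $ \<beta> = pd (axis \<alpha> 1) (\<lambda>y. - pdb (axis \<beta> 1) (pt \<Phi>) y) x"
    proof -
      have "pdb (axis \<beta> 1) wc y = - pdb (axis \<beta> 1) (pt \<Phi>) y" if y: "y \<in> slab" for y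
        using cder_cong[OF y wc_eq] y by simp
      then show ?thesis unfolding chess_def using cder_cong[OF x, of "pdb (axis \<beta> 1) wc"] by simp
    qed
    then show ?thesis using x by simp
  qed
  show G_t: "pt (\<lambda>y. Gc y $ \<alpha> $ \<beta>) x = - chess wc x $ \<alpha> $ \<beta>" for \<alpha> \<beta>
  proof -
    have "pt (\<lambda>y. Gc y $ \<alpha> $ \<beta>) x = pt (\<lambda>y. G0 (fst y) $ \<alpha> $ \<beta> + pd (axis \<alpha> 1) (pdb (axis \<beta> 1) \<Phi>) y) x"
      by (rule cder_cong[OF x]) (simp add: Gc_eq chess_def)
    also have "\<dots> = pt (pd (axis \<alpha> 1) (pdb (axis \<beta> 1) \<Phi>)) x"
      using x Cinf_time_independent[OF G0_smooth] pt_time_independent[OF G0_smooth x] by simp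
    also have "\<dots> = pd (axis \<alpha> 1) (pt (pdb (axis \<beta> 1) \<Phi>)) x"
      using x by (intro cder_commute) simp_all
    also have "\<dots> = pd (axis \<alpha> 1) (pdb (axis \<beta> 1) (pt \<Phi>)) x"
      by (rule cder_cong[OF x]) (rule cder_commute[OF \<Phi>_smooth])
    finally show ?thesis by (simp add: chess_w)
  qed
  show "pt wc x = trace (matrix_inv (Gc x) ** chess wc x) + wc x"
  proof -
    have "mder tvec Gc x = - chess wc x" by (simp add: mder_def vec_eq_iff G_t)
    then have tr: "trace (matrix_inv (Gc x) ** mder tvec Gc x) = - trace (matrix_inv (Gc x) ** chess wc x)"
      by (simp add: trace_mult_sum sum_negf)
    have "pt (pt \<Phi>) x = pt (\<lambda>x. ?L x - ?K x + \<Phi> x + ?f x) x"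
      by (rule cder_cong[OF x]) (rule ln_det_flow)
    also have "\<dots> = pt ?L x + pt \<Phi> x"
      using L L0 f x pt_time_independent[OF L0_smooth x] pt_time_independent[OF f_local x] by simp
    also have "pt ?L x = - trace (matrix_inv (Gc x) ** chess wc x)"
      using cder_ln_det[OF Gc_smooth Gc_pd x, of tvec] tr by simp
    finally have "pt (pt \<Phi>) x = - trace (matrix_inv (Gc x) ** chess wc x) - wc x"
      using wc_eq[OF x] by simp
    moreover have "pt wc x = - pt (pt \<Phi>) x"
      using cder_cong[where X = tvec, OF x wc_eq] x by simp
    ultimately show ?thesis by simp
  qed
  fix \<alpha> \<beta>
  let ?H = "\<lambda>h. pd (axis \<alpha> 1) (pdb (axis \<beta> 1) h) x"
  have "?H (pt \<Phi>) = pd (axis \<alpha> 1) (\<lambda>y. pdb (axis \<beta> 1) ?L y - pdb (axis \<beta> 1) ?K y + pdb (axis \<beta> 1) \<Phi> y + pdb (axis \<beta> 1) ?f y) x"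
  proof (rule cder_cong[OF x])
    fix y assume y: "y \<in> slab"
    have "pdb (axis \<beta> 1) (pt \<Phi>) y = pdb (axis \<beta> 1) (\<lambda>x. ?L x - ?K x + \<Phi> x + ?f x) y"
      by (rule cder_cong[OF y]) (rule ln_det_flow)
    then show "pdb (axis \<beta> 1) (pt \<Phi>) y = pdb (axis \<beta> 1) ?L y - pdb (axis \<beta> 1) ?K y + pdb (axis \<beta> 1) \<Phi> y + pdb (axis \<beta> 1) ?f y"
      using L L0 f y by simp
  qed
  also have "\<dots> = ?H ?L - ?H ?K + ?H \<Phi> + ?H ?f" using L L0 f x by simp
  finally have 1: "?H (pt \<Phi>) = ?H ?L - ?H ?K + ?H \<Phi> + ?H ?f" .
  have xx: "(fst x, snd x) \<in> slab" using x by simp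
  have "hess c f (coord_inv c (fst x)) = chess ?f x"
    using hess_local_rep[of "\<lambda>q t. f q", OF _ xx] f unfolding local_rep_def by simp
  \<comment> \<open>The potential condition makes the Hessian of f equal to g(0) plus the Hessian of
    log det g(0), which cancels the \<open>?K\<close> term of 1.\<close>
  then have "?H ?f = hess c f (coord_inv c (fst x)) $ \<alpha> $ \<beta>"
    by (simp add: chess_def)
  also have "\<dots> = G0 (fst x) $ \<alpha> $ \<beta> + hess c (\<lambda>q. ln (Re (det (g 0 c q)))) (coord_inv c (fst x)) $ \<alpha> $ \<beta>"
    using f_potential[OF chart slab_D(5)[OF x]] by (simp add: ricci_def G0_def)
  also have "hess c (\<lambda>q. ln (Re (det (g 0 c q)))) (coord_inv c (fst x)) = chess ?K x"
    using hess_local_rep[of "\<lambda>q t. ln (Re (det (g 0 c q)))", OF _ xx] L0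
    unfolding local_rep_def G0_def by simp
  also have "\<dots> $ \<alpha> $ \<beta> = ?H ?K" by (simp add: chess_def)
  finally have 2: "?H ?f = G0 (fst x) $ \<alpha> $ \<beta> + ?H ?K" .
  have 3: "Gc x $ \<alpha> $ \<beta> = G0 (fst x) $ \<alpha> $ \<beta> + ?H \<Phi>"
    by (simp add: Gc_eq[OF x] chess_def)
  have "pd (axis \<alpha> 1) (\<lambda>y. trace (matrix_inv (Gc y) ** mder (wirtbar (axis \<beta> 1)) Gc y)) x = ?H ?L"
    by (rule cder_cong[OF x]) (simp add: cder_ln_det[OF Gc_smooth Gc_pd])
  also have "\<dots> = - Gc x $ \<alpha> $ \<beta> - chess wc x $ \<alpha> $ \<beta>"
    using 1 2 3 chess_w by simp
  finally show "pd (axis \<alpha> 1) (\<lambda>y. trace (matrix_inv (Gc y) ** mder (wirtbar (axis \<beta> 1)) Gc y)) x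
     = - Gc x $ \<alpha> $ \<beta> - chess wc x $ \<alpha> $ \<beta>" .
qed

sublocale evolving_metric slab Gc wc
  by (rule evolving)

lemma grad_norm2_eq:
  assumes x: "(z, t) \<in> slab"
  shows "grad_norm2 (g t) c (\<lambda>q. w q t) (coord_inv c z) = grad2 (z, t)"
  unfolding grad_norm2_def grad2_def trace_mult_sum
  using dz_local_rep[OF wc_smooth[unfolded wc_def] x] dzbar_local_rep[OF wc_smooth[unfolded wc_def] x]
  by (subst sum.swap) (simp add: Gc_def wc_def mult.assoc)

lemma harnack_eq:
  assumes x: "(z, t) \<in> slab"
  shows "harnack (z, t) = time_deriv w (coord_inv c z) t - w (coord_inv c z) t
    - grad_norm2 (g t) c (\<lambda>q. w q t) (coord_inv c z) / w (coord_inv c z) t"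
  unfolding harnack_def grad_norm2_eq[OF x]
  using time_deriv_local_rep(2)[OF w_real_smooth x] by (simp add: wc_def local_rep_def)

lemma continuous_harnack: "continuous_on slab harnack"
proof -
  have re: "continuous_on slab (\<lambda>x. Re (h x))" if "Cinf_on slab h" for h
    using Cinf_on_continuous[OF that] by (rule continuous_on_Re)
  have "mCinf_on slab (\<lambda>x. \<chi> \<alpha> \<beta>. pd (axis \<alpha> 1) wc x * pdb (axis \<beta> 1) wc x)"
    by (simp add: mCinf_on_def)
  then have "continuous_on slab grad2"
    unfolding grad2_def by (intro re Cinf_trace_inv[OF Gc_smooth det_nz])
  then show ?thesis
    unfolding harnack_def
    by (intro continuous_on_diff continuous_on_divide re ballI)
      (simp_all add: less_imp_neq[OF evolving_metric.w_pos[OF evolving], symmetric])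
qed

end

subsection \<open>Chart independence of the gradient norm\<close>

text \<open>Invertibility of \<open>A\<close> yields R A^(-1) P as the inverse of \<open>B\<close>;
  cyclicity of the trace does the rest.\<close>

lemma trace_change_basis:
  fixes A B K M P R :: "complex^'m^'m::finite"
  assumes A: "A = P ** B ** R" and nz: "det A \<noteq> 0" and K: "K = P ** M ** R"
  shows "trace (matrix_inv A ** K) = trace (matrix_inv B ** M)"
proof -
  let ?N = "matrix_inv A"
  have "P ** (B ** R ** ?N) = mat 1"
    using matrix_inv_mult(1)[OF nz] by (simp add: A matrix_mul_assoc)
  then have "B ** (R ** ?N ** P) = mat 1"
    using matrix_left_right_inverse[of P "B ** R ** ?N"] by (simp add: matrix_mul_assoc)
  then have "matrix_inv B = R ** ?N ** P" by (rule matrix_inv_eqI)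
  then have "trace (matrix_inv B ** M) = trace (R ** (?N ** P ** M))" by (simp add: matrix_mul_assoc)
  also have "\<dots> = trace (?N ** P ** M ** R)" by (rule trace_mul_sym)
  finally show ?thesis by (simp add: K matrix_mul_assoc)
qed

context kr_flow
begin

lemma kr_flow_chartI: "c \<in> A \<Longrightarrow> \<epsilon> \<ge> 0 \<Longrightarrow> kr_flow_chart X A g f \<phi> w c \<epsilon>"
  by unfold_locales

text \<open>The transition map has a complex linear derivative, so the chain rule does not mix
  \<open>dz\<close> with \<open>dzbar\<close>, and that derivative is the matrix
  \<open>trans_jac\<close>.\<close>

lemma dz_change_chart:
  assumes c: "c \<in> A" and d: "d \<in> A" and p: "p \<in> fst c" "p \<in> fst d" and t: "t > 0"
  shows "dz c \<alpha> (\<lambda>q. complex_of_real (w q t)) p =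
    (\<Sum>\<gamma>\<in>UNIV. trans_jac c d p $ \<gamma> $ \<alpha> * dz d \<gamma> (\<lambda>q. complex_of_real (w q t)) p)"
proof -
  interpret D: kr_flow_chart X A g f \<phi> w d 0 using d by (intro kr_flow_chartI) auto
  define z where "z = snd c p"
  define z' where "z' = snd d p"
  have z': "(z', t) \<in> D.slab" using p(2) t by (simp add: D.slab_iff z'_def coord_in)
  have inv_z': "coord_inv d z' = p" by (simp add: z'_def coord_inv_coord d p)
  define \<psi> where "\<psi> = snd d \<circ> coord_inv c"
  define R where "R = snd c ` (fst c \<inter> fst d)"
  have zR: "z \<in> R" using p by (simp add: z_def R_def)
  \<comment> \<open>The two coordinate expressions of w are related only over the overlap, whose
    image must be open for derivatives to be compared.\<close>
  have "openin (subtopology X (fst c)) (fst c \<inter> fst d)"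
    using open_chart[OF d] by (metis Int_commute openin_subtopology_Int)
  then have "openin (top_of_set (dom c)) R"
    using homeomorphic_map_openness[OF homeo[OF c]] unfolding R_def by (metis openin_subset)
  then have R: "open R" using open_dom[OF c] openin_open_trans by blast
  obtain J :: "complex^'m^'m" where J: "(\<psi> has_derivative (\<lambda>v. J *v v)) (at z)"
    using transition[OF c d] zR unfolding holomorphic_map_on_def \<psi>_def R_def by blast
  have \<psi>z: "\<psi> z = z'" by (simp add: \<psi>_def z_def z'_def coord_inv_coord c p)
  have iJ: "J *v axis \<alpha> \<i> = \<i> *s (J *v axis \<alpha> 1)" for \<alpha>
    by (simp add: D.i_axis[symmetric] vector_scalar_commute)
  have J1: "(J *v axis \<alpha> 1) $ \<gamma> = J $ \<gamma> $ \<alpha>" for \<alpha> \<gamma>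
    by (simp add: matrix_vector_mult_def axis_def if_distrib[of "\<lambda>x. _ * x"] cong: if_cong)
  have jac: "trans_jac c d p = J"
  proof -
    have "((\<lambda>q. snd d q $ \<gamma>) \<circ> coord_inv c has_derivative (\<lambda>v. (J *v v) $ \<gamma>)) (at z)" for \<gamma>
      using bounded_linear.has_derivative[OF bounded_linear_vec_nth J, of \<gamma>] by (simp add: \<psi>_def comp_def)
    from frechet_derivative_eqI[OF this] show ?thesis
      by (simp add: trans_jac_def dz_def dir_deriv_def z_def[symmetric] iJ J1 vec_eq_iff)
  qed
  let ?L = "frechet_derivative D.wc (at (z', t))"
  have k: "((\<lambda>y. D.wc (y, t)) has_derivative (\<lambda>v. ?L (v, 0))) (at z')"
    by (rule frechet_derivative_slice(1)[OF Cinf_on_differentiable[OF D.wc_smooth z']])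
  have "((\<lambda>y. D.wc (\<psi> y, t)) has_derivative (\<lambda>v. ?L (J *v v, 0))) (at z)"
    by (rule has_derivative_compose[OF J]) (simp add: \<psi>z k)
  then have "((\<lambda>q. complex_of_real (w q t)) \<circ> coord_inv c has_derivative (\<lambda>v. ?L (J *v v, 0))) (at z)"
  proof (rule has_derivative_transform_within_open[OF _ R zR])
    fix y assume "y \<in> R"
    then show "D.wc (\<psi> y, t) = ((\<lambda>q. complex_of_real (w q t)) \<circ> coord_inv c) y"
      using c d by (auto simp: R_def \<psi>_def D.wc_def local_rep_def coord_inv_coord)
  qed
  from frechet_derivative_eqI[OF this]
  have "dz c \<alpha> (\<lambda>q. complex_of_real (w q t)) p = pd (J *v axis \<alpha> 1) D.wc (z', t)"
    by (simp add: dz_def dir_deriv_def z_def[symmetric] iJ D.pd_frechet[OF D.wc_smooth z'])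
  also have "\<dots> = (\<Sum>\<gamma>\<in>UNIV. J $ \<gamma> $ \<alpha> * pd (axis \<gamma> 1) D.wc (z', t))"
    by (simp add: D.pd_expand[OF D.wc_smooth z', of "J *v axis \<alpha> 1"] J1)
  also have "\<dots> = (\<Sum>\<gamma>\<in>UNIV. J $ \<gamma> $ \<alpha> * dz d \<gamma> (\<lambda>q. complex_of_real (w q t)) p)"
    using D.dz_local_rep[OF D.wc_smooth[unfolded D.wc_def] z'] by (simp add: inv_z' D.wc_def)
  finally show ?thesis by (simp add: jac)
qed

lemma grad_norm2_trace:
  assumes c: "c \<in> A" and p: "p \<in> fst c" and t: "t > 0"
  shows "grad_norm2 (g t) c (\<lambda>q. w q t) p = Re (trace (matrix_inv (g t c p) **
    (\<chi> \<alpha> \<beta>. dz c \<alpha> (\<lambda>q. complex_of_real (w q t)) p * cnj (dz c \<beta> (\<lambda>q. complex_of_real (w q t)) p))))"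
proof -
  interpret C: kr_flow_chart X A g f \<phi> w c 0 using c by (intro kr_flow_chartI) auto
  have z: "(snd c p, t) \<in> C.slab" using p t by (simp add: C.slab_iff coord_in)
  have inv: "coord_inv c (snd c p) = p" by (simp add: coord_inv_coord c p)
  have "dz c \<alpha> (\<lambda>q. complex_of_real (w q t)) p = pd (axis \<alpha> 1) C.wc (snd c p, t)" for \<alpha>
    using C.dz_local_rep[OF C.wc_smooth[unfolded C.wc_def] z] by (simp add: inv C.wc_def)
  then show ?thesis
    using C.grad_norm2_eq[OF z] by (simp add: C.grad2_def inv C.pdb_w[OF z] C.Gc_def)
qed

lemma grad_norm2_change_chart:
  assumes c: "c \<in> A" and d: "d \<in> A" and p: "p \<in> fst c" "p \<in> fst d" and t: "t > 0"
  shows "grad_norm2 (g t) c (\<lambda>q. w q t) p = grad_norm2 (g t) d (\<lambda>q. w q t) p"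
proof -
  define J where "J = trans_jac c d p"
  define a where "a c \<alpha> = dz c \<alpha> (\<lambda>q. complex_of_real (w q t)) p" for c :: "('a, 'm) chart" and \<alpha>
  let ?R = "\<chi> \<gamma> \<alpha>. cnj (J $ \<gamma> $ \<alpha>)"
  have entry: "(transpose J ** M ** ?R) $ \<alpha> $ \<beta> =
      (\<Sum>\<gamma>\<in>UNIV. \<Sum>\<delta>\<in>UNIV. J $ \<gamma> $ \<alpha> * cnj (J $ \<delta> $ \<beta>) * M $ \<gamma> $ \<delta>)" for M \<alpha> \<beta>
  proof -
    have "(transpose J ** M ** ?R) $ \<alpha> $ \<beta> =
      (\<Sum>\<delta>\<in>UNIV. \<Sum>\<gamma>\<in>UNIV. J $ \<gamma> $ \<alpha> * cnj (J $ \<delta> $ \<beta>) * M $ \<gamma> $ \<delta>)"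
      by (simp add: matrix_matrix_mult_def transpose_def sum_distrib_left sum_distrib_right mult_ac)
    then show ?thesis by (subst sum.swap)
  qed
  have "\<forall>c\<in>A. \<forall>d\<in>A. \<forall>p\<in>fst c \<inter> fst d. \<forall>\<alpha> \<beta>. g t c p $ \<alpha> $ \<beta> =
      (\<Sum>\<gamma>\<in>UNIV. \<Sum>\<delta>\<in>UNIV. trans_jac c d p $ \<gamma> $ \<alpha> * cnj (trans_jac c d p $ \<delta> $ \<beta>) * g t d p $ \<gamma> $ \<delta>)"
    using kaehler_g[OF less_imp_le[OF t]] unfolding kaehler_metric_def hermitian_metric_def by blast
  with c d p have "g t c p $ \<alpha> $ \<beta> = (transpose J ** g t d p ** ?R) $ \<alpha> $ \<beta>" for \<alpha> \<beta>
    unfolding entry unfolding J_def by blast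
  then have G: "g t c p = transpose J ** g t d p ** ?R" by (simp add: vec_eq_iff)
  have a: "a c \<alpha> = (\<Sum>\<gamma>\<in>UNIV. J $ \<gamma> $ \<alpha> * a d \<gamma>)" for \<alpha>
    unfolding a_def J_def by (rule dz_change_chart[OF c d p t])
  have "(\<chi> \<alpha> \<beta>. a c \<alpha> * cnj (a c \<beta>)) = transpose J ** (\<chi> \<alpha> \<beta>. a d \<alpha> * cnj (a d \<beta>)) ** ?R"
    unfolding vec_eq_iff entry by (simp add: a sum_product mult_ac)
  moreover have "det (g t c p) \<noteq> 0"
    using t c p by (intro hermitian_pd_det_nonzero hermitian_pd_g) auto
  ultimately have "trace (matrix_inv (g t c p) ** (\<chi> \<alpha> \<beta>. a c \<alpha> * cnj (a c \<beta>)))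
     = trace (matrix_inv (g t d p) ** (\<chi> \<alpha> \<beta>. a d \<alpha> * cnj (a d \<beta>)))"
    using G by (intro trace_change_basis[where P = "transpose J" and R = ?R])
  then show ?thesis
    using c d p t by (simp add: grad_norm2_trace a_def)
qed

subsection \<open>The minimum over space and time\<close>

text \<open>Makes \<open>weighted\<close> a function on the manifold, although
  \<open>grad_norm2\<close> refers to a chart; by \<open>grad_norm2_change_chart\<close> the choice
  does not affect its value.\<close>

definition chart_at :: "'a \<Rightarrow> ('a, 'm) chart" where
  "chart_at x = (SOME c. c \<in> A \<and> x \<in> fst c)"

lemma chart_at: "x \<in> topspace X \<Longrightarrow> chart_at x \<in> A \<and> x \<in> fst (chart_at x)"
  unfolding chart_at_def using chart_cover by (intro someI_ex[of "\<lambda>c. c \<in> A \<and> x \<in> fst c"]) blast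

definition weighted :: "real \<Rightarrow> 'a \<times> real \<Rightarrow> real" where
  "weighted \<epsilon> = (\<lambda>(x, t). exp (- t) * ((t - \<epsilon>) * (time_deriv w x t - w x t
     - grad_norm2 (g t) (chart_at x) (\<lambda>q. w q t) x / w x t) + real CARD('m) * w x t))"

text \<open>The terms \<open>Gc\<close>, \<open>wc\<close> and \<open>harnack\<close> do not involve
  the lower time of a slab, so this formula, proved over t > 0, also applies in slabs that start at
  a positive time.\<close>

lemma weighted_in_chart:
  assumes c: "c \<in> A" and x: "x \<in> fst c" and t: "t > 0"
  shows "weighted \<epsilon> (x, t) = exp (- t) * ((t - \<epsilon>) *
      evolving_metric.harnack (kr_flow_chart.Gc g c) (kr_flow_chart.wc w c) (snd c x, t) + real CARD('m) * w x t)"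
proof -
  interpret C: kr_flow_chart X A g f \<phi> w c 0 using c by (intro kr_flow_chartI) auto
  have z: "(snd c x, t) \<in> C.slab" using x t by (simp add: C.slab_iff coord_in)
  have "x \<in> topspace X" using chart_sub[OF c] x by blast
  from chart_at[OF this]
  have "grad_norm2 (g t) (chart_at x) (\<lambda>q. w q t) x = grad_norm2 (g t) c (\<lambda>q. w q t) x"
    using c x t by (intro grad_norm2_change_chart) auto
  then show ?thesis
    by (simp add: weighted_def C.harnack_eq[OF z] coord_inv_coord c x)
qed

text \<open>Continuity is local and \<open>chart_at\<close> may jump, so over each chart domain the
  function is rewritten in that one chart. Positivity of the lower time places the closed strip
  inside the open slab t > 0.\<close>

lemma continuous_weighted:
  assumes \<epsilon>: "\<epsilon> > 0"
  shows "continuous_map (prod_topology X (top_of_set {\<epsilon>..T})) euclideanreal (weighted \<epsilon>)"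
proof (rule pasting_lemma[where I = A and T = "\<lambda>c. fst c \<times> {\<epsilon>..T}" and f = "\<lambda>c. weighted \<epsilon>"])
  let ?Z = "prod_topology X (top_of_set {\<epsilon>..T})"
  show "openin ?Z (fst c \<times> {\<epsilon>..T})" if "c \<in> A" for c
    using open_chart[OF that] by (simp add: openin_prod_Times_iff)
  show "\<exists>c. c \<in> A \<and> y \<in> fst c \<times> {\<epsilon>..T} \<and> weighted \<epsilon> y = weighted \<epsilon> y" if "y \<in> topspace ?Z" for y
    using that chart_at[of "fst y"] by (intro exI[of _ "chart_at (fst y)"]) (auto simp: mem_Times_iff)
  show "continuous_map (subtopology ?Z (fst c \<times> {\<epsilon>..T})) euclideanreal (weighted \<epsilon>)" if c: "c \<in> A" for c
  proof -
    interpret C: kr_flow_chart X A g f \<phi> w c 0 using c by (intro kr_flow_chartI) auto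
    let ?S = "subtopology ?Z (fst c \<times> {\<epsilon>..T})"
    let ?k = "\<lambda>y. exp (- snd y) * ((snd y - \<epsilon>) * C.harnack y + real CARD('m) * Re (C.wc y))"
    have "continuous_on C.slab ?k"
      using C.continuous_harnack Cinf_on_continuous[OF C.wc_smooth]
      by (intro continuous_intros)
    then have k: "continuous_map (top_of_set C.slab) euclideanreal ?k" by simp
    have S: "?S = prod_topology (subtopology X (fst c)) (top_of_set {\<epsilon>..T})"
      by (simp add: subtopology_Times subtopology_subtopology)
    have "continuous_map ?S euclidean (snd c \<circ> fst)"
      unfolding S
      by (rule continuous_map_compose[OF continuous_map_fst])
        (rule continuous_map_into_fulltopology[OF homeomorphic_imp_continuous_map[OF homeo[OF c]]])
    moreover have "continuous_map ?S euclidean snd"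
      unfolding S by (rule continuous_map_into_fulltopology[OF continuous_map_snd])
    ultimately have "continuous_map ?S (prod_topology euclidean euclidean) (\<lambda>y. ((snd c \<circ> fst) y, snd y))"
      by (rule continuous_map_pairedI)
    then have "continuous_map ?S euclidean (\<lambda>y. ((snd c \<circ> fst) y, snd y))" by simp
    then have "continuous_map ?S (top_of_set C.slab) (\<lambda>y. ((snd c \<circ> fst) y, snd y))"
      using \<epsilon> by (intro continuous_map_into_subtopology) (auto simp: C.slab_def dom_def)
    from continuous_map_compose[OF this k]
    have "continuous_map ?S euclideanreal (?k \<circ> (\<lambda>y. ((snd c \<circ> fst) y, snd y)))" .
    then show ?thesis
    proof (rule continuous_map_eq)
      fix y assume "y \<in> topspace ?S"
      then obtain x t where y: "y = (x, t)" "x \<in> fst c" "\<epsilon> \<le> t" by auto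
      then show "(?k \<circ> (\<lambda>y. ((snd c \<circ> fst) y, snd y))) y = weighted \<epsilon> y"
        using \<epsilon> weighted_in_chart[OF c, of x t \<epsilon>] c
        by (simp add: C.wc_def local_rep_coord)
    qed
  qed
qed auto

text \<open>By compactness a minimum exists. At the lower time the first summand vanishes and m w >
  0 remains; at any later time, the final one included, \<open>harnack_minimum\<close>
  applies.\<close>

lemma weighted_nonneg:
  assumes comp: "compact_space X" and \<epsilon>: "0 < \<epsilon>" "\<epsilon> \<le> T" and x: "x \<in> topspace X"
  shows "weighted \<epsilon> (x, T) \<ge> 0"
proof (rule ccontr)
  assume neg: "\<not> weighted \<epsilon> (x, T) \<ge> 0"
  let ?Z = "prod_topology X (top_of_set {\<epsilon>..T})"
  have "compact_space ?Z"
    using comp by (simp add: compact_space_prod_topology compact_space_subtopology)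
  then have "compact (weighted \<epsilon> ` topspace ?Z)"
    using image_compactin[OF _ continuous_weighted[OF \<epsilon>(1)]] by (simp add: compact_space_def)
  moreover have xT: "(x, T) \<in> topspace ?Z" using x \<epsilon> by simp
  ultimately obtain y where y: "y \<in> topspace ?Z" "\<And>y'. y' \<in> topspace ?Z \<Longrightarrow> weighted \<epsilon> y \<le> weighted \<epsilon> y'"
    using compact_attains_inf[of "weighted \<epsilon> ` topspace ?Z"] by blast
  obtain x0 t0 where y_eq: "y = (x0, t0)" by (cases y)
  have x0: "x0 \<in> topspace X" "\<epsilon> \<le> t0" "t0 \<le> T" using y(1) by (auto simp: y_eq)
  have neg0: "weighted \<epsilon> (x0, t0) < 0" using y(2)[OF xT] neg by (simp add: y_eq)
  have "t0 \<noteq> \<epsilon>"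
  proof
    assume "t0 = \<epsilon>"
    then have "weighted \<epsilon> (x0, t0) > 0" using w_pos[of t0 x0] x0 \<epsilon> by (simp add: weighted_def)
    then show False using neg0 by simp
  qed
  then have t0: "\<epsilon> < t0" using x0 by simp
  obtain c where c: "c \<in> A" "x0 \<in> fst c" using chart_cover x0 by blast
  interpret C: kr_flow_chart X A g f \<phi> w c \<epsilon> using c \<epsilon> by (intro kr_flow_chartI) auto
  have weighted: "weighted \<epsilon> (coord_inv c z, t) = exp (- t) * ((t - \<epsilon>) * C.harnack (z, t) + real CARD('m) * Re (C.wc (z, t)))"
    if "(z, t) \<in> C.slab" for z t
    using that weighted_in_chart[OF c(1), of "coord_inv c z" t \<epsilon>] \<epsilon>
    by (simp add: C.slab_iff coord_inv_in coord_coord_inv C.wc_def local_rep_def)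
  have p: "(snd c x0, t0) \<in> C.slab" using c t0 by (simp add: C.slab_iff coord_in)
  have x0_inv: "coord_inv c (snd c x0) = x0" by (simp add: coord_inv_coord c)
  have "(t0 - \<epsilon>) * C.harnack (snd c x0, t0) + real CARD('m) * Re (C.wc (snd c x0, t0)) \<ge> 0"
  proof (rule C.harnack_minimum[OF p])
    show "\<epsilon> < t" if "(z, t) \<in> C.slab" for z t using that by (simp add: C.slab_iff)
    fix z t assume zt: "(z, t) \<in> C.slab" "t \<le> t0"
    then have "(coord_inv c z, t) \<in> topspace ?Z"
      using chart_sub[OF c(1)] x0 coord_inv_in[of z c] by (auto simp: C.slab_iff)
    from y(2)[OF this]
    show "exp (- t0) * ((t0 - \<epsilon>) * C.harnack (snd c x0, t0) + real CARD('m) * Re (C.wc (snd c x0, t0)))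
      \<le> exp (- t) * ((t - \<epsilon>) * C.harnack (z, t) + real CARD('m) * Re (C.wc (z, t)))"
      using weighted[OF zt(1)] weighted[OF p] by (simp add: y_eq x0_inv)
  qed
  then have "weighted \<epsilon> (x0, t0) \<ge> 0" using weighted[OF p] by (simp add: x0_inv)
  then show False using neg0 by simp
qed

text \<open>Nonnegativity is needed only at the final time, since \<open>T\<close> is arbitrary. The
  limit of the lower time at 0 gives T F + m w >= 0, and division by T the claim.\<close>

lemma harnack_inequality:
  assumes comp: "compact_space X" and T: "T > 0" and c: "c \<in> A" and x: "x \<in> fst c"
  shows "time_deriv w x T - grad_norm2 (g T) c (\<lambda>q. w q T) x / w x T + real CARD('m) / T * w x T \<ge> w x T"
proof -
  define E where "E = time_deriv w x T - w x T - grad_norm2 (g T) c (\<lambda>q. w q T) x / w x T"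
  define b where "b = real CARD('m) * w x T"
  have xX: "x \<in> topspace X" using chart_sub[OF c] x by blast
  have grad: "grad_norm2 (g T) (chart_at x) (\<lambda>q. w q T) x = grad_norm2 (g T) c (\<lambda>q. w q T) x"
    using chart_at[OF xX] c x T by (intro grad_norm2_change_chart) auto
  have "(T - \<epsilon>) * E + b \<ge> 0" if "0 < \<epsilon>" "\<epsilon> \<le> T" for \<epsilon>
    using weighted_nonneg[OF comp that xX] by (simp add: weighted_def grad E_def b_def zero_le_mult_iff)
  then have "\<forall>\<^sub>F \<epsilon> in at_right 0. (T - \<epsilon>) * E + b \<ge> 0"
    using T by (auto simp: eventually_at_right_field intro!: exI[of _ T])
  moreover have "((\<lambda>\<epsilon>. (T - \<epsilon>) * E + b) \<longlongrightarrow> (T - 0) * E + b) (at_right 0)"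
    by (intro tendsto_intros)
  ultimately have "(T - 0) * E + b \<ge> 0"
    by (intro tendsto_lowerbound[where F = "at_right (0::real)"]) (simp_all add: trivial_limit_at_right_real)
  then have "T * E + b \<ge> 0" by simp
  then have "E + b / T \<ge> 0" using T by (simp add: field_simps)
  then show ?thesis by (simp add: E_def b_def)
qed

end

theorem theorem2p1:
  fixes X :: "'a topology"
    and A :: "('a, 'm::finite) chart set"
    and g :: "real \<Rightarrow> ('a, 'm) tensor11"
    and f :: "'a \<Rightarrow> real"
    and \<phi> w :: "'a \<Rightarrow> real \<Rightarrow> real"
  assumes manifold: "complex_manifold X A"
    and compact: "compact_space X"
    and c1_pos: "c1_positive A"
    and kaehler: "\<And>t. t \<ge> 0 \<Longrightarrow> kaehler_metric A (g t)"
    and kaehler_class: "cohomologous A (form_of (g 0)) (form_of (ricci (g 0)))"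
    and f_smooth: "smooth_fun A f"
    and f_potential: "\<And>c x. c \<in> A \<Longrightarrow> x \<in> fst c \<Longrightarrow> hess c f x = g 0 c x - ricci (g 0) c x"
    and phi_smooth: "smooth_time_fun A \<phi>"
    and metric: "\<And>t c x. t \<ge> 0 \<Longrightarrow> c \<in> A \<Longrightarrow> x \<in> fst c \<Longrightarrow>
        g t c x = g 0 c x + hess c (\<lambda>y. \<phi> y t) x"
    and flow: "\<And>t c x. t \<ge> 0 \<Longrightarrow> c \<in> A \<Longrightarrow> x \<in> fst c \<Longrightarrow>
        time_deriv \<phi> x t = ln (Re (det (g t c x)) / Re (det (g 0 c x))) + \<phi> x t + f x"
    and w_def: "\<And>t x. t \<ge> 0 \<Longrightarrow> x \<in> topspace X \<Longrightarrow> w x t = - time_deriv \<phi> x t"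
    and w_pos: "\<And>t x. t \<ge> 0 \<Longrightarrow> x \<in> topspace X \<Longrightarrow> w x t > 0"
  shows "\<forall>t>0. \<forall>c\<in>A. \<forall>x\<in>fst c.
      time_deriv w x t - grad_norm2 (g t) c (\<lambda>y. w y t) x / w x t + real CARD('m) / t * w x t \<ge> w x t
      \<and> w x t > 0"
proof (intro allI impI ballI conjI)
  interpret kr_flow X A g f \<phi> w
    by unfold_locales (fact manifold kaehler f_smooth f_potential phi_smooth metric flow w_def w_pos)+
  fix t :: real and c x assume t: "t > 0" and c: "c \<in> A" and x: "x \<in> fst c"
  show "w x t \<le> time_deriv w x t - grad_norm2 (g t) c (\<lambda>y. w y t) x / w x t + real CARD('m) / t * w x t"
    by (rule harnack_inequality[OF compact t c x])
  show "0 < w x t" using w_pos[of t x] chart_sub[OF c] x t by auto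
qed

end
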